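(* Let $G$ be a finite simple graph with maximum degree $\Delta=\Delta(G)$ such that $G$ is Class 1 (i.e. $\chi'(G)=\Delta(G)$) and $G$ is triangle-free or chordless. Then any two proper $(\Delta(G)+1)$-edge-colorings of $G$ are $K$-equivalent.
   Context: A (proper) $t$-coloring of a graph $G$ is a map $\alpha:E(G)\to\{1,\dots,t\}$ such that adjacent edges receive different colors. For distinct colors $c,d$, $K_\alpha(c,d)$ denotes the subgraph of $G$ formed by the edges colored $c$ or $d$. A Kempe chain is a connected component of some $K_\alpha(c,d)$; a $K$-change (Kempe change) consists of choosing a Kempe chain and swapping the two colors $c,d$ on its edges (which yields another proper $t$-coloring). Two $t$-colorings are $K$-equivalent if one can be obtained from the other by a finite sequence of $K$-changes, all using colors from $\{1,\dots,t\}$. A graph is chordless if no cycle $C$ of $G$ has a chord, i.e. an edge of $G$ joining two vertices of $C$ that are not consecutive on $C$. $\chi'(G)$ is the chromatic index (minimum $t$ such that a proper $t$-coloring exists). *)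

theory Defs
  imports Main
begin

definition simple_graph :: "'a set \<Rightarrow> 'a set set \<Rightarrow> bool" where
  "simple_graph V E \<longleftrightarrow> finite V \<and> (\<forall>e\<in>E. \<exists>u v. u \<in> V \<and> v \<in> V \<and> u \<noteq> v \<and> e = {u, v})"

definition degree :: "'a set set \<Rightarrow> 'a \<Rightarrow> nat" where
  "degree E v = card {e \<in> E. v \<in> e}"

definition max_degree :: "'a set \<Rightarrow> 'a set set \<Rightarrow> nat" where
  "max_degree V E = Max (insert 0 (degree E ` V))"

definition edge_coloring :: "'a set set \<Rightarrow> nat \<Rightarrow> ('a set \<Rightarrow> nat) \<Rightarrow> bool" where
  "edge_coloring E t \<alpha> \<longleftrightarrow>
     (\<forall>e\<in>E. \<alpha> e \<in> {1..t}) \<and> (\<forall>e. e \<notin> E \<longrightarrow> \<alpha> e = 0) \<and>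
     (\<forall>e\<in>E. \<forall>f\<in>E. e \<noteq> f \<and> e \<inter> f \<noteq> {} \<longrightarrow> \<alpha> e \<noteq> \<alpha> f)"

definition chromatic_index :: "'a set set \<Rightarrow> nat" where
  "chromatic_index E = (LEAST t. \<exists>\<alpha>. edge_coloring E t \<alpha>)"

definition kempe_edges :: "'a set set \<Rightarrow> ('a set \<Rightarrow> nat) \<Rightarrow> nat \<Rightarrow> nat \<Rightarrow> 'a set set" where
  "kempe_edges E \<alpha> c d = {e \<in> E. \<alpha> e = c \<or> \<alpha> e = d}"

definition kempe_adj :: "'a set set \<Rightarrow> ('a set \<Rightarrow> nat) \<Rightarrow> nat \<Rightarrow> nat \<Rightarrow> ('a set \<times> 'a set) set" where
  "kempe_adj E \<alpha> c d = {(e, f). e \<in> kempe_edges E \<alpha> c d \<and> f \<in> kempe_edges E \<alpha> c d \<and> e \<inter> f \<noteq> {}}"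

text \<open>A Kempe chain: the edge set of a connected component of K_alpha(c,d).
  (Components consisting of an isolated vertex have no edges and swapping on them is trivial.)\<close>
definition kempe_chain :: "'a set set \<Rightarrow> ('a set \<Rightarrow> nat) \<Rightarrow> nat \<Rightarrow> nat \<Rightarrow> 'a set set \<Rightarrow> bool" where
  "kempe_chain E \<alpha> c d C \<longleftrightarrow>
     (\<exists>e \<in> kempe_edges E \<alpha> c d. C = {f. (e, f) \<in> (kempe_adj E \<alpha> c d)\<^sup>*})"

definition kempe_swap :: "('a set \<Rightarrow> nat) \<Rightarrow> nat \<Rightarrow> nat \<Rightarrow> 'a set set \<Rightarrow> ('a set \<Rightarrow> nat)" where
  "kempe_swap \<alpha> c d C = (\<lambda>e. if e \<in> C then (if \<alpha> e = c then d else c) else \<alpha> e)"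

definition kempe_step :: "'a set set \<Rightarrow> nat \<Rightarrow> ('a set \<Rightarrow> nat) \<Rightarrow> ('a set \<Rightarrow> nat) \<Rightarrow> bool" where
  "kempe_step E t \<alpha> \<beta> \<longleftrightarrow> edge_coloring E t \<alpha> \<and>
     (\<exists>c d C. c \<in> {1..t} \<and> d \<in> {1..t} \<and> c \<noteq> d \<and> kempe_chain E \<alpha> c d C \<and>
        \<beta> = kempe_swap \<alpha> c d C)"

definition K_equivalent :: "'a set set \<Rightarrow> nat \<Rightarrow> ('a set \<Rightarrow> nat) \<Rightarrow> ('a set \<Rightarrow> nat) \<Rightarrow> bool" where
  "K_equivalent E t \<alpha> \<beta> \<longleftrightarrow> (kempe_step E t)\<^sup>*\<^sup>* \<alpha> \<beta>"

definition triangle_free :: "'a set set \<Rightarrow> bool" where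
  "triangle_free E \<longleftrightarrow> \<not> (\<exists>u v w. u \<noteq> v \<and> v \<noteq> w \<and> u \<noteq> w \<and>
       {u, v} \<in> E \<and> {v, w} \<in> E \<and> {u, w} \<in> E)"

definition is_cycle :: "'a set set \<Rightarrow> 'a list \<Rightarrow> bool" where
  "is_cycle E vs \<longleftrightarrow> length vs \<ge> 3 \<and> distinct vs \<and>
     (\<forall>i < length vs. {vs ! i, vs ! ((i + 1) mod length vs)} \<in> E)"

definition chordless :: "'a set set \<Rightarrow> bool" where
  "chordless E \<longleftrightarrow> \<not> (\<exists>vs i j. is_cycle E vs \<and> i < length vs \<and> j < length vs \<and> i \<noteq> j \<and>
       j \<noteq> (i + 1) mod length vs \<and> i \<noteq> (j + 1) mod length vs \<and> {vs ! i, vs ! j} \<in> E)"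

end

theory Submission
  imports Defs "HOL-Library.Transitive_Closure_Table"
begin

text \<open>In a triangle-free or chordless graph every triangle is a block; only this is used, and it is
  inherited by subgraphs. Let \<open>\<gamma>\<close> be a \<open>k\<close>-coloring and let \<open>M\<close> be one of its color classes. It suffices
  to bring every \<open>(k + 1)\<close>-coloring to one in which \<open>M\<close> is the class of the color \<open>k + 1\<close>: deleting
  \<open>M\<close> then reduces the claim from \<open>k\<close> to \<open>k - 1\<close>.

  Since every vertex misses a color, each edge at a vertex \<open>v\<close> starts a Vizing fan at \<open>v\<close>, which is
  either shifted, so that the edge gives up its color, or is cyclic. The key point is that cyclic fans
  can also be inverted by Kempe changes. If one cannot, then \<open>v\<close>, missing \<open>b\<close>, and each leaf \<open>u\<close>,
  missing \<open>m u\<close>, are the two ends of a \<open>(m u, b)\<close>-chain; because triangles are blocks this makes the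
  leaves pairwise nonadjacent, and one may work with a fan at a leaf without disturbing the others.\<close>

text \<open>A path fan can be shifted because a color missing at the center allows its last spoke to
  be recolored first. In a cyclic fan no assigned color is missing at the center, so no spoke can go
  first; this is the obstacle. Moreover, inverting it only permutes the colors of its spokes: the
  color to be removed does not leave the center but lands on the spoke of the leaf to which it was
  assigned. A vertex not covered by \<open>M\<close> meets at most k - 1 edges, hence misses two of
  the k + 1 colors, and it can be assigned one other than k + 1; this keeps the color from landing
  there.

  Every swap made to prepare an inversion is compensated after it, on the same component or on that
  component together with the center and at most one leaf, so that the result is exactly
  \<open>recolor\<close>. This works as long as the swapped component avoids the center, and linkage
  is the obstruction to that.\<close>

locale edge_graph =
  fixes E :: "'a set set" and t :: nat
  assumes finite_E: "finite E"
    and edgeE: "e \<in> E \<Longrightarrow> \<exists>x y. x \<noteq> y \<and> e = {x, y}"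
begin

abbreviation coloring :: "('a set \<Rightarrow> nat) \<Rightarrow> bool" where
  "coloring \<alpha> \<equiv> edge_coloring E t \<alpha>"

definition miss :: "('a set \<Rightarrow> nat) \<Rightarrow> 'a \<Rightarrow> nat \<Rightarrow> bool" where
  "miss \<alpha> x c \<longleftrightarrow> c \<in> {1..t} \<and> (\<forall>y. {x, y} \<in> E \<longrightarrow> \<alpha> {x, y} \<noteq> c)"

text \<open>A closed vertex set is a union of components of the \<open>(c, d)\<close>-subgraph, so interchanging \<open>c\<close> and
  \<open>d\<close> on the edges that touch it is a sequence of Kempe changes.\<close>

definition closed :: "('a set \<Rightarrow> nat) \<Rightarrow> nat \<Rightarrow> nat \<Rightarrow> 'a set \<Rightarrow> bool" where
  "closed \<alpha> c d S \<longleftrightarrow>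
     (\<forall>x y. x \<in> S \<and> {x, y} \<in> E \<and> (\<alpha> {x, y} = c \<or> \<alpha> {x, y} = d) \<longrightarrow> y \<in> S)"

text \<open>Components are vertex sets here, so a vertex that meets neither color is a component of
  its own, whereas \<open>kempe_chain\<close> only sees edges.\<close>

definition linked :: "('a set \<Rightarrow> nat) \<Rightarrow> nat \<Rightarrow> nat \<Rightarrow> 'a \<Rightarrow> 'a \<Rightarrow> bool" where
  "linked \<alpha> c d = (\<lambda>x y. {x, y} \<in> E \<and> (\<alpha> {x, y} = c \<or> \<alpha> {x, y} = d))\<^sup>*\<^sup>*"

text \<open>Unlike \<open>kempe_swap\<close>, which sends every color other than \<open>c\<close> to
  \<open>c\<close>, this map leaves third colors alone; it is therefore an involution without any
  condition on \<open>S\<close>.\<close>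

definition swap_on :: "nat \<Rightarrow> nat \<Rightarrow> 'a set \<Rightarrow> ('a set \<Rightarrow> nat) \<Rightarrow> 'a set \<Rightarrow> nat" where
  "swap_on c d S \<alpha> e =
     (if e \<inter> S = {} then \<alpha> e else if \<alpha> e = c then d else if \<alpha> e = d then c else \<alpha> e)"

text \<open>An edge is an unordered pair, so the leaf is read off from it by \<open>THE\<close>. All
  spokes in \<open>U\<close> change at once, which makes the result independent of the order of the
  leaves.\<close>

definition recolor :: "'a \<Rightarrow> 'a set \<Rightarrow> ('a \<Rightarrow> nat) \<Rightarrow> ('a set \<Rightarrow> nat) \<Rightarrow> 'a set \<Rightarrow> nat" where
  "recolor v U m \<alpha> e = (if \<exists>u\<in>U. e = {v, u} then m (THE u. e = {v, u}) else \<alpha> e)"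

text \<open>Properness of both ends is bundled in, so that each link of a chain of equivalences
  hands the next one its coloring hypothesis.\<close>

definition kempe_equiv :: "('a set \<Rightarrow> nat) \<Rightarrow> ('a set \<Rightarrow> nat) \<Rightarrow> bool" where
  "kempe_equiv \<alpha> \<beta> \<longleftrightarrow> coloring \<alpha> \<and> coloring \<beta> \<and> K_equivalent E t \<alpha> \<beta>"

section \<open>Colorings and missing colors, vertex by vertex\<close>

lemma no_loop [simp]: "{x} \<notin> E" "{x, x} \<notin> E"
proof -
  show "{x} \<notin> E" using edgeE[of "{x}"] by (auto simp: doubleton_eq_iff)
  then show "{x, x} \<notin> E" by simp
qed

lemma coloringI:
  assumes "\<And>x y. {x, y} \<in> E \<Longrightarrow> \<alpha> {x, y} \<in> {1..t}" "\<And>e. e \<notin> E \<Longrightarrow> \<alpha> e = 0"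
    and inj: "\<And>x y z. {x, y} \<in> E \<Longrightarrow> {x, z} \<in> E \<Longrightarrow> \<alpha> {x, y} = \<alpha> {x, z} \<Longrightarrow> y = z"
  shows "coloring \<alpha>"
  unfolding edge_coloring_def
proof (intro conjI ballI allI impI)
  show "\<alpha> e \<in> {1..t}" if "e \<in> E" for e using edgeE[OF that] assms(1) that by auto
  show "\<alpha> e = 0" if "e \<notin> E" for e using assms(2) that by auto
  show "\<alpha> e \<noteq> \<alpha> f" if ef: "e \<in> E" "f \<in> E" "e \<noteq> f \<and> e \<inter> f \<noteq> {}" for e f
  proof -
    obtain x where x: "x \<in> e" "x \<in> f" using ef by auto
    obtain y where y: "e = {x, y}" using edgeE[OF ef(1)] x by auto
    obtain z where z: "f = {x, z}" using edgeE[OF ef(2)] x by auto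
    show ?thesis using inj ef y z by metis
  qed
qed

lemma col_range: "coloring \<alpha> \<Longrightarrow> {x, y} \<in> E \<Longrightarrow> \<alpha> {x, y} \<in> {1..t}"
  by (auto simp: edge_coloring_def)

lemma col_outside: "coloring \<alpha> \<Longrightarrow> e \<notin> E \<Longrightarrow> \<alpha> e = 0"
  by (auto simp: edge_coloring_def)

lemma col_inj:
  assumes "coloring \<alpha>" "{x, y} \<in> E" "{x, z} \<in> E" "\<alpha> {x, y} = \<alpha> {x, z}"
  shows "y = z"
proof (rule ccontr)
  assume "y \<noteq> z"
  then have "{x, y} \<noteq> {x, z}" by (auto simp: doubleton_eq_iff)
  then show False using assms by (auto simp: edge_coloring_def)
qed

lemma miss_range: "miss \<alpha> x c \<Longrightarrow> c \<in> {1..t}"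
  and missD: "miss \<alpha> x c \<Longrightarrow> {x, y} \<in> E \<Longrightarrow> \<alpha> {x, y} \<noteq> c"
  and missD': "miss \<alpha> x c \<Longrightarrow> {y, x} \<in> E \<Longrightarrow> \<alpha> {y, x} \<noteq> c"
  by (auto simp: miss_def insert_commute)

section \<open>Interchanging two colors on a closed vertex set\<close>

lemma closedD: "closed \<alpha> c d S \<Longrightarrow> x \<in> S \<Longrightarrow> {x, y} \<in> E \<Longrightarrow> \<alpha> {x, y} = c \<or> \<alpha> {x, y} = d \<Longrightarrow> y \<in> S"
  by (auto simp: closed_def)

lemma closedD': "closed \<alpha> c d S \<Longrightarrow> x \<in> S \<Longrightarrow> {y, x} \<in> E \<Longrightarrow> \<alpha> {y, x} = c \<or> \<alpha> {y, x} = d \<Longrightarrow> y \<in> S"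
  using closedD[of \<alpha> c d S x y] by (simp add: insert_commute)

lemma swap_on_edge:
  "swap_on c d S \<alpha> {x, y} =
     (if x \<in> S \<or> y \<in> S then (if \<alpha> {x, y} = c then d else if \<alpha> {x, y} = d then c else \<alpha> {x, y})
      else \<alpha> {x, y})"
  by (auto simp: swap_on_def)

lemma swap_on_invol [simp]: "swap_on c d S (swap_on c d S \<alpha>) = \<alpha>"
  by (rule ext) (auto simp: swap_on_def)

lemma closed_swap_on [simp]: "closed (swap_on c d S \<alpha>) c d S \<longleftrightarrow> closed \<alpha> c d S"
  by (auto simp: closed_def swap_on_edge split: if_splits)

lemma swap_on_closed:
  assumes "closed \<alpha> c d S" "{x, y} \<in> E"
  shows "swap_on c d S \<alpha> {x, y} =
    (if x \<in> S then (if \<alpha> {x, y} = c then d else if \<alpha> {x, y} = d then c else \<alpha> {x, y})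
      else \<alpha> {x, y})"
  using closedD'[OF assms(1) _ assms(2)] by (auto simp: swap_on_edge)

lemma coloring_swap_on:
  assumes "coloring \<alpha>" "closed \<alpha> c d S" "c \<in> {1..t}" "d \<in> {1..t}"
  shows "coloring (swap_on c d S \<alpha>)"
proof (rule coloringI)
  show "swap_on c d S \<alpha> {x, y} \<in> {1..t}" if "{x, y} \<in> E" for x y
    using col_range[OF assms(1) that] assms(3,4) by (auto simp: swap_on_edge)
  show "swap_on c d S \<alpha> e = 0" if "e \<notin> E" for e
    using col_outside[OF assms(1) that] assms(3,4) by (auto simp: swap_on_def)
  show "y = z" if "{x, y} \<in> E" "{x, z} \<in> E" "swap_on c d S \<alpha> {x, y} = swap_on c d S \<alpha> {x, z}" for x y z
    using that(3) col_inj[OF assms(1) that(1,2)]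
    unfolding swap_on_closed[OF assms(2) that(1)] swap_on_closed[OF assms(2) that(2)]
    by (simp split: if_splits)
qed

text \<open>Induction on the number of edges of \<open>F\<close>: the chain \<open>C\<close> of any
  edge of \<open>F\<close> lies inside \<open>F\<close>, swapping it is one Kempe change, and since
  the two-colored subgraph keeps its edges, \<open>F - C\<close> is again a union of chains for the
  new coloring.\<close>

lemma kempe_swap_closed:
  assumes "c \<in> {1..t}" "d \<in> {1..t}" "c \<noteq> d" "finite F"
  shows "coloring \<alpha> \<Longrightarrow> F \<subseteq> kempe_edges E \<alpha> c d \<Longrightarrow>
    (\<And>e f. e \<in> F \<Longrightarrow> f \<in> kempe_edges E \<alpha> c d \<Longrightarrow> e \<inter> f \<noteq> {} \<Longrightarrow> f \<in> F) \<Longrightarrow>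
    K_equivalent E t \<alpha> (kempe_swap \<alpha> c d F)"
  using assms(4)
proof (induction "card F" arbitrary: F \<alpha> rule: less_induct)
  case less
  show ?case
  proof (cases "F = {}")
    case True
    then have "kempe_swap \<alpha> c d F = \<alpha>" by (auto simp: kempe_swap_def)
    then show ?thesis by (simp add: K_equivalent_def)
  next
    case False
    then obtain e where e: "e \<in> F" by auto
    define C where "C = {f. (e, f) \<in> (kempe_adj E \<alpha> c d)\<^sup>*}"
    define \<beta> where "\<beta> = kempe_swap \<alpha> c d C"
    have CF: "C \<subseteq> F"
    proof
      fix f assume "f \<in> C"
      then have "(e, f) \<in> (kempe_adj E \<alpha> c d)\<^sup>*" by (simp add: C_def)
      then show "f \<in> F"
        by (induction) (use e less.prems(3) in \<open>auto simp: kempe_adj_def\<close>)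
    qed
    have chain: "kempe_chain E \<alpha> c d C"
      using e less.prems(2) by (auto simp: kempe_chain_def C_def)
    have step: "kempe_step E t \<alpha> \<beta>"
      unfolding kempe_step_def \<beta>_def using assms less.prems(1) chain by blast
    have Cclosed: "f \<in> C" if "g \<in> C" "f \<in> kempe_edges E \<alpha> c d" "g \<inter> f \<noteq> {}" for f g
    proof -
      have "(g, f) \<in> kempe_adj E \<alpha> c d"
        using that CF less.prems(2) by (auto simp: kempe_adj_def)
      then show ?thesis using that(1) by (auto simp: C_def intro: rtrancl_into_rtrancl)
    qed
    have ke: "kempe_edges E \<beta> c d = kempe_edges E \<alpha> c d"
      using CF less.prems(2) by (auto simp: kempe_edges_def \<beta>_def kempe_swap_def)
    have CE: "f \<in> E" "\<alpha> f = c \<or> \<alpha> f = d" if "f \<in> C" for f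
      using that CF less.prems(2) by (auto simp: kempe_edges_def)
    have Cclosed': "f \<in> C" if "g \<in> C" "f \<in> E" "\<alpha> f = c \<or> \<alpha> f = d" "g \<inter> f \<noteq> {}" for f g
      using Cclosed[of g f] that by (auto simp: kempe_edges_def)
    have col\<beta>: "coloring \<beta>"
      unfolding edge_coloring_def
    proof (intro conjI ballI allI impI)
      show "\<beta> f \<in> {1..t}" if "f \<in> E" for f
        using that less.prems(1) assms(1,2) by (auto simp: \<beta>_def kempe_swap_def edge_coloring_def)
      show "\<beta> f = 0" if "f \<notin> E" for f
        using that less.prems(1) CE by (auto simp: \<beta>_def kempe_swap_def edge_coloring_def)
      show "\<beta> f \<noteq> \<beta> g" if "f \<in> E" "g \<in> E" "f \<noteq> g \<and> f \<inter> g \<noteq> {}" for f g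
      proof -
        have "\<alpha> f \<noteq> \<alpha> g" using that less.prems(1) by (auto simp: edge_coloring_def)
        then show ?thesis
          using CE[of f] CE[of g] Cclosed'[of f g] Cclosed'[of g f] that assms(3)
          by (auto simp: \<beta>_def kempe_swap_def Int_commute)
      qed
    qed
    have eC: "e \<in> C" by (auto simp: C_def)
    have "K_equivalent E t \<beta> (kempe_swap \<beta> c d (F - C))"
    proof (rule less.hyps[OF _ col\<beta>])
      show "card (F - C) < card F"
        using e eC less.prems(4) by (intro psubset_card_mono) auto
      show "F - C \<subseteq> kempe_edges E \<beta> c d" using less.prems(2) ke by auto
      show "f \<in> F - C" if "g \<in> F - C" "f \<in> kempe_edges E \<beta> c d" "g \<inter> f \<noteq> {}" for g f
        using that less.prems(2,3) Cclosed[of f g] ke by (auto simp: Int_commute)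
    qed (use less.prems(4) in auto)
    moreover have "kempe_swap \<beta> c d (F - C) = kempe_swap \<alpha> c d F"
      using CF by (intro ext) (auto simp: \<beta>_def kempe_swap_def)
    ultimately show ?thesis
      using step by (simp add: K_equivalent_def converse_rtranclp_into_rtranclp)
  qed
qed

lemma kempe_equiv_swap_on:
  assumes "coloring \<alpha>" "closed \<alpha> c d S" "c \<in> {1..t}" "d \<in> {1..t}" "c \<noteq> d"
  shows "kempe_equiv \<alpha> (swap_on c d S \<alpha>)"
proof -
  define F where "F = {e \<in> kempe_edges E \<alpha> c d. e \<inter> S \<noteq> {}}"
  have "K_equivalent E t \<alpha> (kempe_swap \<alpha> c d F)"
  proof (rule kempe_swap_closed[OF assms(3,4,5) _ assms(1)])
    show "finite F" using finite_E by (auto simp: F_def kempe_edges_def)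
    show "F \<subseteq> kempe_edges E \<alpha> c d" by (auto simp: F_def)
    show "f \<in> F" if ef: "e \<in> F" "f \<in> kempe_edges E \<alpha> c d" "e \<inter> f \<noteq> {}" for e f
    proof -
      obtain x where x: "x \<in> e" "x \<in> f" using ef(3) by auto
      obtain y where y: "e = {x, y}" using edgeE[of e] x ef by (auto simp: F_def kempe_edges_def)
      have "x \<in> S" using ef(1) y closedD'[OF assms(2), of y x] by (auto simp: F_def kempe_edges_def)
      then show ?thesis using ef(2) x by (auto simp: F_def)
    qed
  qed
  \<comment> \<open>Off \<open>E\<close> a coloring is 0, which is neither \<open>c\<close> nor
    \<open>d\<close> because colors start at 1, so the two maps also agree on sets that are not
    edges.\<close>
  moreover have "kempe_swap \<alpha> c d F = swap_on c d S \<alpha>"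
    using col_outside[OF assms(1)] assms(3,4)
    by (fastforce simp: kempe_swap_def swap_on_def F_def kempe_edges_def)
  ultimately show ?thesis
    using coloring_swap_on[OF assms(1-4)] assms(1) by (simp add: kempe_equiv_def)
qed

section \<open>Kempe equivalence as an equivalence relation\<close>

lemma kempe_equiv_refl: "coloring \<alpha> \<Longrightarrow> kempe_equiv \<alpha> \<alpha>"
  by (simp add: kempe_equiv_def K_equivalent_def)

lemma kempe_equiv_trans [trans]: "kempe_equiv \<alpha> \<beta> \<Longrightarrow> kempe_equiv \<beta> \<gamma> \<Longrightarrow> kempe_equiv \<alpha> \<gamma>"
  by (auto simp: kempe_equiv_def K_equivalent_def)

lemma kempe_equiv_coloring: "kempe_equiv \<alpha> \<beta> \<Longrightarrow> coloring \<beta>"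
  by (simp add: kempe_equiv_def)

text \<open>A Kempe change is a \<open>swap_on\<close> over the vertices of its chain. This vertex
  set is still closed after the change and \<open>swap_on\<close> is an involution, so the same swap
  leads back, without identifying the chain in the new coloring.\<close>

lemma kempe_equiv_step_sym:
  assumes "kempe_step E t \<alpha> \<beta>"
  shows "kempe_equiv \<beta> \<alpha>"
proof -
  obtain c d C where *: "coloring \<alpha>" "c \<in> {1..t}" "d \<in> {1..t}" "c \<noteq> d" "kempe_chain E \<alpha> c d C"
    "\<beta> = kempe_swap \<alpha> c d C"
    using assms by (auto simp: kempe_step_def)
  obtain e where e: "e \<in> kempe_edges E \<alpha> c d" "C = {f. (e, f) \<in> (kempe_adj E \<alpha> c d)\<^sup>*}"
    using *(5) by (auto simp: kempe_chain_def)
  have CK: "f \<in> kempe_edges E \<alpha> c d" if "f \<in> C" for f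
    using that[unfolded e(2)] e(1) by (auto elim: rtranclE simp: kempe_adj_def)
  have C: "g \<in> C" if "f \<in> C" "g \<in> kempe_edges E \<alpha> c d" "f \<inter> g \<noteq> {}" for f g
  proof -
    have "(f, g) \<in> kempe_adj E \<alpha> c d" using that CK by (auto simp: kempe_adj_def)
    then show ?thesis using that(1) e(2) by (auto intro: rtrancl_into_rtrancl)
  qed
  have ke: "kempe_edges E \<beta> c d = kempe_edges E \<alpha> c d"
    using CK by (auto simp: kempe_edges_def *(6) kempe_swap_def)
  define S where "S = \<Union>C"
  have cl: "closed \<alpha> c d S"
    unfolding closed_def
  proof (intro allI impI, elim conjE)
    fix x y assume xy: "x \<in> S" "{x, y} \<in> E" "\<alpha> {x, y} = c \<or> \<alpha> {x, y} = d"
    then obtain f where f: "f \<in> C" "x \<in> f" by (auto simp: S_def)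
    have "{x, y} \<in> C" using C[OF f(1), of "{x, y}"] xy f by (auto simp: kempe_edges_def)
    then show "y \<in> S" by (auto simp: S_def)
  qed
  have "\<beta> = swap_on c d S \<alpha>"
  proof
    fix f
    show "\<beta> f = swap_on c d S \<alpha> f"
    proof (cases "\<alpha> f = c \<or> \<alpha> f = d")
      case True
      then have "f \<in> kempe_edges E \<alpha> c d"
        using *(1-3) by (auto simp: edge_coloring_def kempe_edges_def)
      then have "f \<in> C \<longleftrightarrow> f \<inter> S \<noteq> {}"
        using C edgeE[of f] by (auto simp: S_def kempe_edges_def)
      then show ?thesis using True by (auto simp: *(6) kempe_swap_def swap_on_def)
    next
      case False
      then have "f \<notin> C" using CK by (auto simp: kempe_edges_def)
      then show ?thesis using False by (auto simp: *(6) kempe_swap_def swap_on_def)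
    qed
  qed
  moreover have "coloring (swap_on c d S \<alpha>)" using coloring_swap_on[OF *(1) cl *(2,3)] .
  ultimately have "kempe_equiv \<beta> (swap_on c d S \<beta>)" using kempe_equiv_swap_on[of \<beta> c d S] cl * by simp
  then show ?thesis using \<open>\<beta> = swap_on c d S \<alpha>\<close> by simp
qed

lemma kempe_equiv_sym: "kempe_equiv \<alpha> \<beta> \<Longrightarrow> kempe_equiv \<beta> \<alpha>"
proof -
  assume *: "kempe_equiv \<alpha> \<beta>"
  then have "(kempe_step E t)\<^sup>*\<^sup>* \<alpha> \<beta>" "coloring \<alpha>" by (auto simp: kempe_equiv_def K_equivalent_def)
  then show "kempe_equiv \<beta> \<alpha>"
    by (induction) (auto intro: kempe_equiv_refl kempe_equiv_trans kempe_equiv_step_sym)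
qed

section \<open>Components of the two-colored subgraphs\<close>

lemma linked_refl [simp]: "linked \<alpha> c d x x"
  by (simp add: linked_def)

lemma linked_sym: "linked \<alpha> c d x y \<Longrightarrow> linked \<alpha> c d y x"
  unfolding linked_def by (rule sympD[OF symp_rtranclp]) (auto simp: symp_def insert_commute)

lemma linked_trans: "linked \<alpha> c d x y \<Longrightarrow> linked \<alpha> c d y z \<Longrightarrow> linked \<alpha> c d x z"
  by (simp add: linked_def)

lemma linked_edge: "{x, y} \<in> E \<Longrightarrow> \<alpha> {x, y} = c \<or> \<alpha> {x, y} = d \<Longrightarrow> linked \<alpha> c d x y"
  by (auto simp: linked_def)

lemma linked_commute: "linked \<alpha> c d = linked \<alpha> d c"
  unfolding linked_def by (simp add: disj_commute)

lemma linked_closed: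
  assumes "linked \<alpha> c d x y" "closed \<alpha> c d S" "x \<in> S"
  shows "y \<in> S"
  using assms(1) unfolding linked_def
  by (induction) (use assms(2,3) in \<open>auto dest: closedD\<close>)

lemma closed_component: "closed \<alpha> c d {x. linked \<alpha> c d u x}"
  unfolding closed_def using linked_trans linked_edge by blast

text \<open>Swapping \<open>c\<close> and \<open>d\<close> on this set alters all components except
  that of \<open>u\<close> at once, and every edge at \<open>u\<close> keeps its color.\<close>

lemma closed_co_component: "closed \<alpha> c d {x. \<not> linked \<alpha> c d u x}"
  unfolding closed_def
proof (intro allI impI, elim conjE)
  fix x y assume "x \<in> {x. \<not> linked \<alpha> c d u x}" "{x, y} \<in> E" "\<alpha> {x, y} = c \<or> \<alpha> {x, y} = d"
  then show "y \<in> {x. \<not> linked \<alpha> c d u x}"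
    using linked_trans[of \<alpha> c d u y x] linked_sym[OF linked_edge[of x y \<alpha> c d]] by auto
qed

lemma miss_swap_on:
  assumes "closed \<alpha> c d S" "c \<in> {1..t}" "d \<in> {1..t}" "c \<noteq> d"
  shows "miss (swap_on c d S \<alpha>) x e \<longleftrightarrow>
    (if x \<in> S then miss \<alpha> x (if e = c then d else if e = d then c else e) else miss \<alpha> x e)"
  using assms(2-4) unfolding miss_def by (auto simp: swap_on_closed[OF assms(1)])

text \<open>Components of the two-colored subgraph are paths or cycles, and a vertex missing one of
  the colors has degree at most one there, so a component has at most two such vertices. Concretely,
  the vertices of a simple path from \<open>u\<close> to \<open>v\<close> form a closed set; this
  would put \<open>w\<close> in the interior of the path, where both colors occur.\<close>

lemma linked_ends:
  assumes \<alpha>: "coloring \<alpha>" and cd: "c \<noteq> d"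
    and m: "miss \<alpha> u c \<or> miss \<alpha> u d" "miss \<alpha> v c \<or> miss \<alpha> v d" "miss \<alpha> w c \<or> miss \<alpha> w d"
    and l: "linked \<alpha> c d u v" "linked \<alpha> c d u w"
  shows "u = v \<or> u = w \<or> v = w"
proof -
  let ?r = "\<lambda>x y. {x, y} \<in> E \<and> (\<alpha> {x, y} = c \<or> \<alpha> {x, y} = d)"
  obtain xs where "rtrancl_path ?r u xs v"
    using l(1) unfolding linked_def rtranclp_eq_rtrancl_path by (rule exE)
  then obtain xs where xs: "rtrancl_path ?r u xs v" "distinct (u # xs)"
    by (rule rtrancl_path_distinct)
  define p where "p = u # xs"
  have d: "distinct p" and len: "length p = Suc (length xs)" using xs(2) by (auto simp: p_def)
  have step: "?r (p ! i) (p ! Suc i)" if "i < length xs" for i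
    using rtrancl_path_nth[OF xs(1) that] by (simp add: p_def)
  have step': "?r (p ! Suc i) (p ! i)" if "i < length xs" for i
    using step[OF that] by (simp add: insert_commute)
  have last: "p ! length xs = v"
    using rtrancl_path_last[OF xs(1)] xs(1) by (cases xs rule: rev_cases) (auto simp: p_def elim: rtrancl_path.cases)
  have first: "p ! 0 = u" by (simp add: p_def)
  have two: "z = x \<or> z = y" if "?r a x" "?r a y" "x \<noteq> y" "?r a z" for a x y z
    using that col_inj[OF \<alpha>] by metis
  have one: "x = y" if "?r a x" "?r a y" "miss \<alpha> a c \<or> miss \<alpha> a d" for a x y
    using that col_inj[OF \<alpha>] missD by metis
  have inner: "p ! i \<noteq> p ! Suc (Suc i)" if "Suc i < length xs" for i
    using d that len by (simp add: nth_eq_iff_index_eq)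
  show ?thesis
  proof (rule ccontr)
    assume neq: "\<not> ?thesis"
    then have pos: "0 < length xs" using first last by auto
    have inp: "p ! k \<in> set p" if "k \<le> length xs" for k using that len by simp
    \<comment> \<open>Each end of the path spends its only admissible edge on the path, and each
      inner vertex both of its edges.\<close>
    have "closed \<alpha> c d (set p)"
      unfolding closed_def
    proof (intro allI impI, elim conjE)
      fix x y assume "x \<in> set p" and xy: "{x, y} \<in> E" "\<alpha> {x, y} = c \<or> \<alpha> {x, y} = d"
      then obtain i where i: "x = p ! i" "i \<le> length xs" using len by (metis in_set_conv_nth less_Suc_eq_le)
      consider "i = 0" | "i = length xs" "0 < i" | "0 < i" "i < length xs" using i(2) by linarith
      then show "y \<in> set p"
      proof cases
        case 1
        then show ?thesis using one[OF step[OF pos], of y] xy i(1) m(1) first inp[of 1] pos by auto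
      next
        case 2
        then obtain j where j: "i = Suc j" using gr0_implies_Suc by blast
        then show ?thesis using one[OF step'[of j], of y] xy i m(2) last inp[of j] 2 by auto
      next
        case 3
        then obtain j where j: "i = Suc j" using gr0_implies_Suc by blast
        then show ?thesis
          using two[OF step'[of j] step[of "Suc j"], of y] inner[of j]
            inp[of j] inp[of "Suc i"] xy i(1) 3
          by auto
      qed
    qed
    then have "w \<in> set p" using linked_closed[OF l(2), of "set p"] by (simp add: p_def)
    then obtain i where i: "w = p ! i" "i \<le> length xs" using len by (metis in_set_conv_nth less_Suc_eq_le)
    have "i \<noteq> 0" using i neq first by metis
    moreover have "i \<noteq> length xs" using i neq last by metis
    ultimately obtain j where j: "i = Suc j" "i < length xs" using i(2) by (cases i) auto
    then show False
      using one[OF step'[of j] step[of "Suc j"]] inner[of j] i m(3) by auto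
  qed
qed

subsection \<open>Fans\<close>

lemma recolor_edge:
  assumes "v \<notin> U"
  shows "recolor v U m \<alpha> {x, y} =
    (if x = v \<and> y \<in> U then m y else if y = v \<and> x \<in> U then m x else \<alpha> {x, y})"
proof -
  have the: "(THE u. {v, w} = {v, u}) = w" for w
    by (rule the_equality) (auto simp: doubleton_eq_iff)
  have the': "(THE u. {w, v} = {v, u}) = w" for w
    by (rule the_equality) (auto simp: doubleton_eq_iff)
  show ?thesis
    using assms the the' by (auto simp: recolor_def doubleton_eq_iff)
qed

lemma recolor_apart: "v \<notin> e \<Longrightarrow> recolor v U m \<alpha> e = \<alpha> e"
  by (auto simp: recolor_def)

lemma recolor_apart': "x \<noteq> v \<Longrightarrow> y \<noteq> v \<Longrightarrow> recolor v U m \<alpha> {x, y} = \<alpha> {x, y}"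
  by (simp add: recolor_apart)

lemma recolor_cong:
  assumes "\<And>u. u \<in> U \<Longrightarrow> m u = m' u"
  shows "recolor v U m \<alpha> = recolor v U m' \<alpha>"
proof
  fix e
  have "(THE u. {v, w} = {v, u}) = w" for w
    by (rule the_equality) (auto simp: doubleton_eq_iff)
  then show "recolor v U m \<alpha> e = recolor v U m' \<alpha> e"
    using assms by (auto simp: recolor_def)
qed

lemma fun_eq_edges:
  assumes "\<And>e. e \<notin> E \<Longrightarrow> \<phi> e = \<psi> e" "\<And>x y. {x, y} \<in> E \<Longrightarrow> \<phi> {x, y} = \<psi> {x, y}"
  shows "\<phi> = \<psi>"
proof
  fix e show "\<phi> e = \<psi> e" using assms edgeE[of e] by (cases "e \<in> E") auto
qed

lemma recolor_outside:
  assumes "e \<notin> E" "\<forall>u\<in>U. {v, u} \<in> E"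
  shows "recolor v U m \<alpha> e = \<alpha> e"
  using assms by (auto simp: recolor_def)

lemma miss_recolor_other:
  assumes "v \<notin> U" "x \<notin> U" "x \<noteq> v"
  shows "miss (recolor v U m \<alpha>) x c \<longleftrightarrow> miss \<alpha> x c"
  using assms by (auto simp: miss_def recolor_edge)

lemma miss_recolor_center:
  assumes "v \<notin> U"
  shows "miss (recolor v U m \<alpha>) v c \<longleftrightarrow>
    c \<in> {1..t} \<and> (\<forall>y. {v, y} \<in> E \<longrightarrow> (if y \<in> U then m y else \<alpha> {v, y}) \<noteq> c)"
  using assms by (auto simp: miss_def recolor_edge)

text \<open>The color given up by a spoke is free at its leaf; this is what allows a shifted fan to
  be run backwards.\<close>

lemma miss_recolor_old:
  assumes "coloring \<alpha>" "v \<notin> U" "x \<in> U" "{v, x} \<in> E" "m x \<noteq> \<alpha> {v, x}"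
  shows "miss (recolor v U m \<alpha>) x (\<alpha> {v, x})"
  unfolding miss_def
proof (intro conjI allI impI)
  show "\<alpha> {v, x} \<in> {1..t}" using col_range assms by auto
  fix y assume y: "{x, y} \<in> E"
  have xv: "{x, v} = {v, x}" by auto
  have "x \<noteq> v" using assms by auto
  then show "recolor v U m \<alpha> {x, y} \<noteq> \<alpha> {v, x}"
    using assms y col_inj[OF assms(1), of x v y] unfolding xv by (auto simp: recolor_edge)
qed

text \<open>If \<open>d\<close> is the color of the edge, then no other edge at \<open>v\<close> or
  \<open>u\<close> has color \<open>c\<close> or \<open>d\<close>, so the edge alone is a chain and
  recoloring it is a Kempe change.\<close>

lemma kempe_equiv_recolor_single:
  assumes \<alpha>: "coloring \<alpha>" and e: "{v, u} \<in> E" and m: "miss \<alpha> v c" "miss \<alpha> u c"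
  shows "kempe_equiv \<alpha> (recolor v {u} (\<lambda>_. c) \<alpha>)"
proof -
  define d where "d = \<alpha> {v, u}"
  have uv: "{u, v} = {v, u}" by auto
  have vu: "v \<noteq> u" using e by auto
  have only: "(x = v \<and> y = u) \<or> (x = u \<and> y = v)"
    if xy: "{x, y} \<in> E" "\<alpha> {x, y} = d \<or> \<alpha> {x, y} = c" "x = v \<or> x = u" for x y
  proof (cases "x = v")
    case True
    then show ?thesis
      using xy missD[OF m(1), of y] col_inj[OF \<alpha> e, of y] unfolding d_def by metis
  next
    case False
    then have "x = u" using xy by simp
    then show ?thesis
      using xy missD[OF m(2), of y] col_inj[OF \<alpha>, of u v y] e unfolding d_def uv[symmetric] by metis
  qed
  have only': "(x = v \<and> y = u) \<or> (x = u \<and> y = v)"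
    if "{x, y} \<in> E" "\<alpha> {x, y} = d \<or> \<alpha> {x, y} = c" "y = v \<or> y = u" for x y
    using only[of y x] that unfolding insert_commute[of y x "{}"] by blast
  have cl: "closed \<alpha> d c {v, u}"
    unfolding closed_def using only by blast
  have "kempe_equiv \<alpha> (swap_on d c {v, u} \<alpha>)"
    by (rule kempe_equiv_swap_on[OF \<alpha> cl])
      (use m e col_range[OF \<alpha> e] in \<open>auto simp: d_def dest: miss_range missD\<close>)
  moreover have "swap_on d c {v, u} \<alpha> = recolor v {u} (\<lambda>_. c) \<alpha>"
  proof (rule fun_eq_edges)
    show "swap_on d c {v, u} \<alpha> e = recolor v {u} (\<lambda>_. c) \<alpha> e" if "e \<notin> E" for e
      using that col_outside[OF \<alpha> that] recolor_outside[of e "{u}" v] e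
        col_range[OF \<alpha> e] miss_range[OF m(1)]
      by (auto simp: swap_on_def d_def)
    show "swap_on d c {v, u} \<alpha> {x, y} = recolor v {u} (\<lambda>_. c) \<alpha> {x, y}" if xy: "{x, y} \<in> E" for x y
    proof (cases "{x, y} = {v, u}")
      case True
      then show ?thesis unfolding True using vu by (simp add: swap_on_edge recolor_edge d_def)
    next
      case False
      have "\<not> (x = v \<and> y = u)" "\<not> (x = u \<and> y = v)" using False by auto
      then have "\<not> (\<alpha> {x, y} = d \<or> \<alpha> {x, y} = c)" if "x = v \<or> x = u \<or> y = v \<or> y = u"
        using that xy only[of x y] only'[of x y] by blast
      then show ?thesis using False vu by (auto simp: swap_on_edge recolor_edge doubleton_eq_iff)
    qed
  qed
  ultimately show ?thesis by simp
qed

text \<open>Each leaf misses the color of the next spoke, and the last leaf misses \<open>c\<close>. If \<open>v\<close> misses \<open>c\<close>,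
  every spoke \<open>{v, u}\<close> can be recolored with \<open>m u\<close>, starting from the last one.\<close>

definition fan :: "('a set \<Rightarrow> nat) \<Rightarrow> 'a \<Rightarrow> ('a \<Rightarrow> nat) \<Rightarrow> 'a list \<Rightarrow> nat \<Rightarrow> bool" where
  "fan \<alpha> v m us c \<longleftrightarrow> us \<noteq> [] \<and> distinct us \<and> (\<forall>u\<in>set us. {v, u} \<in> E \<and> miss \<alpha> u (m u)) \<and>
     map m us = map (\<lambda>u. \<alpha> {v, u}) (tl us) @ [c]"

definition cyclic_fan :: "('a set \<Rightarrow> nat) \<Rightarrow> 'a \<Rightarrow> ('a \<Rightarrow> nat) \<Rightarrow> 'a list \<Rightarrow> bool" where
  "cyclic_fan \<alpha> v m us \<longleftrightarrow> fan \<alpha> v m us (\<alpha> {v, hd us})"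

lemma fan_center: "fan \<alpha> v m us c \<Longrightarrow> v \<notin> set us"
  by (auto simp: fan_def)

lemma kempe_equiv_path_shift:
  assumes "coloring \<alpha>" "fan \<alpha> v m us c" "miss \<alpha> v c"
  shows "kempe_equiv \<alpha> (recolor v (set us) m \<alpha>)"
  using assms(2)
proof (induction us)
  case Nil
  then show ?case by (simp add: fan_def)
next
  case (Cons u us)
  have e: "{v, u} \<in> E" "miss \<alpha> u (m u)" "u \<notin> set us" using Cons.prems by (auto simp: fan_def)
  have vu: "v \<noteq> u" using e by auto
  show ?case
  proof (cases "us = []")
    case True
    then have "m u = c" using Cons.prems by (auto simp: fan_def)
    moreover have "recolor v {u} (\<lambda>_. c) \<alpha> = recolor v {u} m \<alpha>" if "m u = c"
      by (rule recolor_cong) (use that in auto)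
    ultimately show ?thesis
      using kempe_equiv_recolor_single[OF assms(1) e(1) assms(3)] e True by simp
  next
    case False
    then have mu: "m u = \<alpha> {v, hd us}" and f: "fan \<alpha> v m us c"
      using Cons.prems by (cases us; auto simp: fan_def)+
    define \<beta> where "\<beta> = recolor v (set us) m \<alpha>"
    have eq: "kempe_equiv \<alpha> \<beta>" unfolding \<beta>_def by (rule Cons.IH[OF f])
    have v: "v \<notin> set us" using fan_center[OF f] .
    have hd: "{v, hd us} \<in> E" using f False by (auto simp: fan_def)
    \<comment> \<open>The spoke of \<open>hd us\<close> has given up the color \<open>m u\<close>.
      The colors placed on the tail are those of later spokes and \<open>c\<close>, so none of them
      is \<open>m u\<close>.\<close>
    have "miss \<beta> v (m u)"
      unfolding \<beta>_def miss_recolor_center[OF v]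
    proof (intro conjI allI impI)
      show "m u \<in> {1..t}" using e miss_range by blast
      fix y assume y: "{v, y} \<in> E"
      show "(if y \<in> set us then m y else \<alpha> {v, y}) \<noteq> m u"
      proof (cases "y \<in> set us")
        case True
        then have "m y \<in> set (map (\<lambda>u. \<alpha> {v, u}) (tl us) @ [c])"
          using f unfolding fan_def by (metis image_eqI set_map)
        then consider "m y = c" | w where "w \<in> set (tl us)" "m y = \<alpha> {v, w}" by auto
        then show ?thesis
        proof cases
          case 1
          then show ?thesis using True missD[OF assms(3) hd] mu by auto
        next
          case 2
          then have "w \<noteq> hd us" "{v, w} \<in> E" using f False by (cases us; auto simp: fan_def)+
          then show ?thesis using True 2 mu col_inj[OF assms(1) _ hd] by auto
        qed
      next
        case False
        then have "y \<noteq> hd us" using \<open>us \<noteq> []\<close> by auto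
        then show ?thesis using False mu col_inj[OF assms(1) y hd] by auto
      qed
    qed
    moreover have "miss \<beta> u (m u)"
      unfolding \<beta>_def using miss_recolor_other[OF v e(3)] vu e by auto
    ultimately have "kempe_equiv \<beta> (recolor v {u} (\<lambda>_. m u) \<beta>)"
      using kempe_equiv_recolor_single[OF kempe_equiv_coloring[OF eq] e(1)] by simp
    moreover have "recolor v {u} (\<lambda>_. m u) \<beta> = recolor v (set (u # us)) m \<alpha>"
    proof (rule fun_eq_edges)
      show "recolor v {u} (\<lambda>_. m u) \<beta> e = recolor v (set (u # us)) m \<alpha> e" if "e \<notin> E" for e
      proof -
        have "{v, w} \<in> E" if "w \<in> set us" for w using f that by (auto simp: fan_def)
        then show ?thesis
          using recolor_outside[OF that, of "{u}" v] recolor_outside[OF that, of "set us" v]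
            recolor_outside[OF that, of "set (u # us)" v] e(1)
          by (auto simp: \<beta>_def)
      qed
      show "recolor v {u} (\<lambda>_. m u) \<beta> {x, y} = recolor v (set (u # us)) m \<alpha> {x, y}" if "{x, y} \<in> E" for x y
        using v vu by (auto simp: \<beta>_def recolor_edge)
    qed
    ultimately show ?thesis using kempe_equiv_trans[OF eq] by simp
  qed
qed

text \<open>A longest list works, because a spoke colored \<open>m (last us)\<close> outside it
  could be appended. So either the center misses that color or the fan runs back into one of its own
  leaves.\<close>

lemma fan_maximal:
  assumes e: "{v, u} \<in> E" and m: "\<And>x. {v, x} \<in> E \<Longrightarrow> miss \<alpha> x (m x)"
  obtains us where "fan \<alpha> v m us (m (last us))" "hd us = u"
    "\<And>w. {v, w} \<in> E \<Longrightarrow> \<alpha> {v, w} = m (last us) \<Longrightarrow> w \<in> set us"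
proof -
  define N where "N = {w. {v, w} \<in> E}"
  have "finite (\<Union>E)" using finite_E edgeE by (fastforce intro!: finite_Union)
  then have finN: "finite N" by (rule finite_subset[rotated]) (auto simp: N_def)
  define P where "P us \<longleftrightarrow> us \<noteq> [] \<and> hd us = u \<and> distinct us \<and> set us \<subseteq> N \<and>
    map m (butlast us) = map (\<lambda>u. \<alpha> {v, u}) (tl us)" for us
  have "P [u]" using e by (simp add: P_def N_def)
  moreover have "\<forall>us. P us \<longrightarrow> length us < Suc (card N)"
    using finN by (metis P_def card_mono distinct_card le_imp_less_Suc)
  ultimately obtain us where us: "P us" "\<And>us'. P us' \<Longrightarrow> length us' \<le> length us"
    using ex_has_greatest_nat[of P "[u]" length "Suc (card N)"] by auto
  have "fan \<alpha> v m us (m (last us))"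
  proof -
    have "map m us = map m (butlast us @ [last us])" using us(1) by (simp add: P_def)
    also have "\<dots> = map m (butlast us) @ [m (last us)]" by simp
    finally show ?thesis using us(1) m by (auto simp: fan_def P_def N_def)
  qed
  moreover have "w \<in> set us" if "{v, w} \<in> E" "\<alpha> {v, w} = m (last us)" for w
  proof (rule ccontr)
    assume w: "w \<notin> set us"
    have "map m us = map m (butlast us @ [last us])" using us(1) by (simp add: P_def)
    also have "\<dots> = map m (butlast us) @ [m (last us)]" by simp
    finally have "P (us @ [w])" using us(1) that w by (auto simp: P_def N_def)
    then show False using us(2)[of "us @ [w]"] by simp
  qed
  ultimately show ?thesis using that us(1) by (auto simp: P_def)
qed

text \<open>Written with \<open>rotate1\<close>, the condition no longer distinguishes a first leaf,
  so it visibly survives rotations of the list.\<close>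

lemma cyclic_fan_iff:
  "cyclic_fan \<alpha> v m us \<longleftrightarrow> us \<noteq> [] \<and> distinct us \<and> (\<forall>u\<in>set us. {v, u} \<in> E \<and> miss \<alpha> u (m u)) \<and>
     map m us = map (\<lambda>u. \<alpha> {v, u}) (rotate1 us)"
  by (cases us) (auto simp: cyclic_fan_def fan_def)

lemma cyclic_fan_rotate: "cyclic_fan \<alpha> v m us \<Longrightarrow> cyclic_fan \<alpha> v m (rotate k us)"
proof (induction k)
  case (Suc k)
  then have *: "cyclic_fan \<alpha> v m (rotate k us)" by simp
  then have "map m (rotate1 (rotate k us)) = map (\<lambda>u. \<alpha> {v, u}) (rotate1 (rotate1 (rotate k us)))"
    unfolding cyclic_fan_iff by (metis rotate1_map)
  then show ?case using * by (auto simp: cyclic_fan_iff)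
qed simp

lemma cyclic_fanD:
  assumes "cyclic_fan \<alpha> v m us"
  shows "us \<noteq> []" "distinct us" "u \<in> set us \<Longrightarrow> {v, u} \<in> E" "u \<in> set us \<Longrightarrow> miss \<alpha> u (m u)"
    "v \<notin> set us" "u \<in> set us \<Longrightarrow> u \<noteq> v"
  using assms by (auto simp: cyclic_fan_iff)

lemma cyclic_fan_image:
  assumes "cyclic_fan \<alpha> v m us"
  shows "m ` set us = (\<lambda>u. \<alpha> {v, u}) ` set us"
  using assms unfolding cyclic_fan_iff by (metis set_map set_rotate1)

lemma cyclic_fan_next: "cyclic_fan \<alpha> v m us \<Longrightarrow> u \<in> set us \<Longrightarrow> \<exists>w\<in>set us. m u = \<alpha> {v, w}"
  using cyclic_fan_image by fastforce

lemma cyclic_fan_inj: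
  assumes "coloring \<alpha>" "cyclic_fan \<alpha> v m us"
  shows "inj_on m (set us)"
proof -
  have "inj_on (\<lambda>u. \<alpha> {v, u}) (set us)"
    using col_inj[OF assms(1)] cyclic_fanD(3)[OF assms(2)] by (auto intro!: inj_onI)
  then have "distinct (map (\<lambda>u. \<alpha> {v, u}) (rotate1 us))"
    using cyclic_fanD(2)[OF assms(2)] by (simp add: distinct_map)
  then show ?thesis
    using assms(2) unfolding cyclic_fan_iff by (metis distinct_map)
qed

lemma cyclic_fan_miss_center:
  "cyclic_fan \<alpha> v m us \<Longrightarrow> miss \<alpha> v b \<Longrightarrow> u \<in> set us \<Longrightarrow> m u \<noteq> b"
  using cyclic_fan_next[of \<alpha> v m us u] cyclic_fanD(3)[of \<alpha> v m us] missD[of \<alpha> v b] by metis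

lemma cyclic_fan_outside:
  assumes "coloring \<alpha>" "cyclic_fan \<alpha> v m us" "u \<in> set us" "{v, w} \<in> E" "w \<notin> set us"
  shows "\<alpha> {v, w} \<noteq> m u"
proof
  assume "\<alpha> {v, w} = m u"
  then obtain x where "x \<in> set us" "\<alpha> {v, w} = \<alpha> {v, x}" using cyclic_fan_next[OF assms(2,3)] by auto
  then show False using col_inj[OF assms(1,4)] cyclic_fanD(3)[OF assms(2)] assms(5) by metis
qed

text \<open>\<open>recolor\<close> depends only on the set of leaves, so any leaf may be put last
  before a swap is made at it.\<close>

lemma cyclic_fan_last:
  assumes "cyclic_fan \<alpha> v m us" "u \<in> set us"
  obtains us' where "cyclic_fan \<alpha> v m us'" "set us' = set us" "length us' = length us" "last us' = u"
proof -
  obtain xs ys where us: "us = xs @ u # ys" using assms(2) by (meson split_list)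
  have "rotate (length (xs @ [u])) us = ys @ xs @ [u]"
    using rotate_append[of "xs @ [u]" ys] us by simp
  then show ?thesis
    using that[of "ys @ xs @ [u]"] cyclic_fan_rotate[OF assms(1), of "length (xs @ [u])"] us by auto
qed

section \<open>Inverting a cyclic fan by swaps that are compensated afterwards\<close>

lemma swap_on_outside:
  assumes "coloring \<alpha>" "c \<in> {1..t}" "d \<in> {1..t}" "e \<notin> E"
  shows "swap_on c d S \<alpha> e = 0"
  using assms col_outside[OF assms(1,4)] by (auto simp: swap_on_def)

text \<open>Conjugation: swap, invert, swap back. No spoke of a leaf in \<open>S\<close> receives
  \<open>c\<close> or \<open>d\<close>, so \<open>S\<close> is still closed after the inversion, and
  the second swap restores the edges away from \<open>v\<close> while it leaves the inverted spokes
  alone.\<close>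

lemma cyclic_fan_swap_on:
  assumes \<alpha>: "coloring \<alpha>" and cyc: "cyclic_fan \<alpha> v m us"
    and cl: "closed \<alpha> c d S" and v: "v \<notin> S" and cd: "c \<in> {1..t}" "d \<in> {1..t}" "c \<noteq> d"
    and m: "\<And>u. u \<in> set us \<Longrightarrow> u \<in> S \<Longrightarrow> m u \<noteq> c \<and> m u \<noteq> d"
  shows "cyclic_fan (swap_on c d S \<alpha>) v m us"
    and "kempe_equiv (swap_on c d S \<alpha>) (recolor v (set us) m (swap_on c d S \<alpha>)) \<Longrightarrow>
      kempe_equiv \<alpha> (recolor v (set us) m \<alpha>)"
proof -
  let ?\<alpha> = "swap_on c d S \<alpha>"
  note C = cyclic_fanD[OF cyc]
  have col: "?\<alpha> {v, w} = \<alpha> {v, w}" if "{v, w} \<in> E" for w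
    using swap_on_closed[OF cl that] v by simp
  have "map (\<lambda>u. ?\<alpha> {v, u}) (rotate1 us) = map (\<lambda>u. \<alpha> {v, u}) (rotate1 us)"
    using col C(3) by simp
  moreover have "miss ?\<alpha> u (m u)" if "u \<in> set us" for u
    using C(4)[OF that] m[OF that] by (simp add: miss_swap_on[OF cl cd])
  ultimately show "cyclic_fan ?\<alpha> v m us" using cyc by (simp add: cyclic_fan_iff)
  assume eq: "kempe_equiv ?\<alpha> (recolor v (set us) m ?\<alpha>)"
  define \<beta> where "\<beta> = recolor v (set us) m ?\<alpha>"
  have clb: "closed \<beta> c d S"
    unfolding closed_def
  proof (intro allI impI, elim conjE)
    fix x y assume xy: "x \<in> S" "{x, y} \<in> E" "\<beta> {x, y} = c \<or> \<beta> {x, y} = d"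
    then have "\<not> (y = v \<and> x \<in> set us)" using m[of x] C(5) v by (auto simp: \<beta>_def recolor_edge)
    then have "\<beta> {x, y} = ?\<alpha> {x, y}" using C(5) xy(1) v by (auto simp: \<beta>_def recolor_edge)
    then show "y \<in> S" using closedD[of ?\<alpha> c d S x y] xy cl by simp
  qed
  have "kempe_equiv \<alpha> \<beta>"
    using kempe_equiv_trans[OF kempe_equiv_swap_on[OF \<alpha> cl cd] eq] by (simp add: \<beta>_def)
  also have "kempe_equiv \<beta> (swap_on c d S \<beta>)"
    by (rule kempe_equiv_swap_on[OF kempe_equiv_coloring[OF \<open>kempe_equiv \<alpha> \<beta>\<close>] clb cd])
  also have "swap_on c d S \<beta> = recolor v (set us) m \<alpha>"
  proof (rule fun_eq_edges)
    show "swap_on c d S \<beta> e = recolor v (set us) m \<alpha> e" if "e \<notin> E" for e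
      using swap_on_outside[OF kempe_equiv_coloring[OF \<open>kempe_equiv \<alpha> \<beta>\<close>] cd(1,2) that]
        recolor_outside[OF that, of "set us" v] C(3) col_outside[OF \<alpha> that] by simp
    have vx: "swap_on c d S \<beta> {v, y} = recolor v (set us) m \<alpha> {v, y}" if "{v, y} \<in> E" for y
      using that m[of y] col[OF that] v C(5) closedD'[OF cl _ that] 
      by (auto simp: swap_on_edge \<beta>_def recolor_edge)
    show "swap_on c d S \<beta> {x, y} = recolor v (set us) m \<alpha> {x, y}" if xy: "{x, y} \<in> E" for x y
    proof -
      consider "x = v" | "y = v" | "x \<noteq> v" "y \<noteq> v" by auto
      then show ?thesis
      proof cases
        case 1
        then show ?thesis using vx xy by simp
      next
        case 2
        then show ?thesis using vx[of x] xy by (simp add: insert_commute)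
      next
        case 3
        then show ?thesis by (simp add: swap_on_edge \<beta>_def recolor_apart')
      qed
    qed
  qed
  finally show "kempe_equiv \<alpha> (recolor v (set us) m \<alpha>)" .
qed

text \<open>Let \<open>a\<close> be the color assigned to the last leaf \<open>u\<close>. Swapping
  \<open>a\<close> and \<open>b\<close> on the component of \<open>u\<close> changes nothing at
  \<open>v\<close> and makes \<open>u\<close> miss \<open>b\<close>, which \<open>v\<close> misses
  too, so the cycle opens into a path fan. After the shift the spoke of \<open>u\<close> has color
  \<open>b\<close> instead of \<open>a\<close>; a second swap, on the same component extended by
  \<open>v\<close>, corrects this and undoes the first swap.\<close>

lemma cyclic_fan_unlinked_last:
  assumes \<alpha>: "coloring \<alpha>" and cyc: "cyclic_fan \<alpha> v m us" and b: "miss \<alpha> v b"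
    and nl: "\<not> linked \<alpha> (m (last us)) b (last us) v"
  shows "kempe_equiv \<alpha> (recolor v (set us) m \<alpha>)"
proof -
  note C = cyclic_fanD[OF cyc]
  define u a where "u = last us" and "a = m u"
  have u: "u \<in> set us" using C(1) by (simp add: u_def)
  have ab: "a \<noteq> b" "a \<in> {1..t}" "b \<in> {1..t}"
    using cyclic_fan_miss_center[OF cyc b u] miss_range[OF C(4)[OF u]] miss_range[OF b] by (auto simp: a_def)
  have inj: "inj_on m (set us)" by (rule cyclic_fan_inj[OF \<alpha> cyc])
  have mu: "m w \<noteq> a \<and> m w \<noteq> b" if "w \<in> set us" "w \<noteq> u" for w
    using that inj_onD[OF inj] u cyclic_fan_miss_center[OF cyc b] by (auto simp: a_def)
  define S where "S = {x. linked \<alpha> a b u x}"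
  have cl: "closed \<alpha> a b S" unfolding S_def by (rule closed_component)
  have v: "v \<notin> S" "u \<in> S" using nl by (auto simp: S_def a_def u_def)
  define \<alpha>1 where "\<alpha>1 = swap_on a b S \<alpha>"
  have eq1: "kempe_equiv \<alpha> \<alpha>1" unfolding \<alpha>1_def by (rule kempe_equiv_swap_on[OF \<alpha> cl ab(2,3,1)])
  have col: "\<alpha>1 {v, w} = \<alpha> {v, w}" if "{v, w} \<in> E" for w
    using swap_on_closed[OF cl that] v by (simp add: \<alpha>1_def)
  define m' where "m' = m(u := b)"
  have us: "us = butlast us @ [u]" using C(1) by (simp add: u_def)
  have "map m us = map (\<lambda>u. \<alpha> {v, u}) (tl us) @ [\<alpha> {v, hd us}]"
    using cyc by (simp add: cyclic_fan_def fan_def)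
  then have "map m (butlast us) = map (\<lambda>u. \<alpha> {v, u}) (tl us)"
    using us by (metis butlast_snoc map_butlast)
  moreover have "map m' (butlast us) = map m (butlast us)"
    using C(1,2) us by (metis (no_types, lifting) distinct_butlast fun_upd_other m'_def map_cong not_distinct_conv_prefix)
  moreover have "map m' us = map m' (butlast us) @ [b]"
    by (subst us) (simp add: m'_def)
  moreover have "\<And>w. w \<in> set (tl us) \<Longrightarrow> {v, w} \<in> E" using C(1,3) by (meson list.set_sel(2))
  ultimately have "map m' us = map (\<lambda>u. \<alpha>1 {v, u}) (tl us) @ [b]"
    using col by simp
  moreover have "miss \<alpha>1 w (m' w)" if "w \<in> set us" for w
  proof (cases "w = u")
    case True
    then show ?thesis
      using C(4)[OF u] v ab unfolding \<alpha>1_def miss_swap_on[OF cl ab(2,3,1)] by (simp add: m'_def a_def)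
  next
    case False
    then show ?thesis
      using C(4)[OF that] mu[OF that] unfolding \<alpha>1_def miss_swap_on[OF cl ab(2,3,1)] by (simp add: m'_def)
  qed
  ultimately have "fan \<alpha>1 v m' us b" using C by (simp add: fan_def)
  moreover have "miss \<alpha>1 v b"
    using b v unfolding \<alpha>1_def miss_swap_on[OF cl ab(2,3,1)] by simp
  ultimately have eq2: "kempe_equiv \<alpha>1 (recolor v (set us) m' \<alpha>1)" (is "kempe_equiv _ ?\<alpha>2")
    using kempe_equiv_path_shift[OF kempe_equiv_coloring[OF eq1]] by blast
  have eq12: "kempe_equiv \<alpha> ?\<alpha>2" by (rule kempe_equiv_trans[OF eq1 eq2])
  have at_v: "?\<alpha>2 {v, w} = (if w = u then b else if w \<in> set us then m w else \<alpha> {v, w})" if "{v, w} \<in> E" for w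
    using C(5) col[OF that] u by (auto simp: recolor_edge m'_def)
  \<comment> \<open>The old spoke of color \<open>a\<close> lies on the fan and has been recolored,
    and \<open>b\<close> was missing at \<open>v\<close>. So the spoke of \<open>u\<close> is now
    the only edge at \<open>v\<close> with one of the two colors, and adding \<open>v\<close> keeps
    the component closed.\<close>
  have only_u: "w = u" if "{v, w} \<in> E" "?\<alpha>2 {v, w} = a \<or> ?\<alpha>2 {v, w} = b" for w
    using that at_v[OF that(1)] mu[of w] cyclic_fan_outside[OF \<alpha> cyc u that(1)] missD[OF b that(1)]
    by (auto simp: a_def split: if_splits)
  have cl2: "closed ?\<alpha>2 a b (insert v S)"
    unfolding closed_def
  proof (intro allI impI, elim conjE)
    fix x y assume xy: "x \<in> insert v S" "{x, y} \<in> E" "?\<alpha>2 {x, y} = a \<or> ?\<alpha>2 {x, y} = b"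
    show "y \<in> insert v S"
    proof (cases "x = v \<or> y = v")
      case True
      then show ?thesis using only_u[of y] xy v by auto
    next
      case False
      then have "?\<alpha>2 {x, y} = \<alpha>1 {x, y}" by (simp add: recolor_apart')
      then show ?thesis using closedD[of \<alpha>1 a b S x y] cl xy False by (simp add: \<alpha>1_def)
    qed
  qed
  note eq12
  also have "kempe_equiv ?\<alpha>2 (swap_on a b (insert v S) ?\<alpha>2)"
    by (rule kempe_equiv_swap_on[OF kempe_equiv_coloring[OF eq12] cl2 ab(2,3,1)])
  also have "swap_on a b (insert v S) ?\<alpha>2 = recolor v (set us) m \<alpha>" (is "?L = ?R")
  proof (rule fun_eq_edges)
    show "?L e = ?R e" if "e \<notin> E" for e
      using swap_on_outside[OF kempe_equiv_coloring[OF eq12] ab(2,3) that]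
        recolor_outside[OF that, of "set us" v] C(3) col_outside[OF \<alpha> that] by simp
    have vx: "?L {v, y} = ?R {v, y}" if "{v, y} \<in> E" for y
    proof -
      have R: "?R {v, y} = (if y \<in> set us then m y else \<alpha> {v, y})"
        using C(5) by (simp add: recolor_edge)
      have L: "?L {v, y} = (if ?\<alpha>2 {v, y} = a then b else if ?\<alpha>2 {v, y} = b then a else ?\<alpha>2 {v, y})"
        by (simp add: swap_on_edge)
      show ?thesis
      proof (cases "y = u")
        case True
        then show ?thesis unfolding L R using at_v[OF that] u ab(1) by (simp add: a_def)
      next
        case False
        then have "?\<alpha>2 {v, y} \<noteq> a" "?\<alpha>2 {v, y} \<noteq> b" using only_u[OF that] by blast+
        then have "?L {v, y} = ?\<alpha>2 {v, y}" unfolding L by simp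
        then show ?thesis unfolding R using at_v[OF that] False by simp
      qed
    qed
    show "?L {x, y} = ?R {x, y}" if xy: "{x, y} \<in> E" for x y
    proof -
      consider "x = v" | "y = v" | "x \<noteq> v" "y \<noteq> v" by auto
      then show ?thesis
      proof cases
        case 1
        then show ?thesis using vx xy by simp
      next
        case 2
        then show ?thesis using vx[of x] xy by (simp add: insert_commute)
      next
        case 3
        then have "swap_on a b (insert v S) ?\<alpha>2 {x, y} = swap_on a b S \<alpha>1 {x, y}"
          by (simp add: swap_on_edge recolor_apart')
        then show ?thesis using 3 by (simp add: \<alpha>1_def recolor_apart')
      qed
    qed
  qed
  finally show ?thesis .
qed

lemma cyclic_fan_unlinked:
  assumes "coloring \<alpha>" "cyclic_fan \<alpha> v m us" "miss \<alpha> v b" "u \<in> set us"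
    and "\<not> linked \<alpha> (m u) b u v"
  shows "kempe_equiv \<alpha> (recolor v (set us) m \<alpha>)"
proof -
  obtain us' where us': "cyclic_fan \<alpha> v m us'" "set us' = set us" "last us' = u"
    using cyclic_fan_last[OF assms(2,4)] by blast
  then show ?thesis
    using cyclic_fan_unlinked_last[OF assms(1) us'(1) assms(3)] assms(5) by simp
qed

text \<open>Let \<open>u = last us\<close>; the spoke of its successor \<open>x\<close> has color
  \<open>a = m u\<close>, and \<open>d = m x\<close> is the color of the spoke of
  \<open>hd us\<close>. If \<open>u\<close> and \<open>x\<close> lie in different components,
  swapping on that of \<open>u\<close> makes \<open>u\<close> miss \<open>d\<close>, and the fan
  closes up without \<open>x\<close>. Once this shorter fan is inverted, the spokes of
  \<open>u\<close> and \<open>x\<close> have the colors \<open>d\<close> and \<open>a\<close>; a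
  swap on the component extended by \<open>v\<close> and \<open>x\<close> exchanges them and undoes
  the first swap.\<close>

lemma cyclic_fan_unlinked_consecutive:
  assumes \<alpha>: "coloring \<alpha>" and cyc: "cyclic_fan \<alpha> v m (x # us)" and ne: "us \<noteq> []"
    and nl: "\<not> linked \<alpha> (m (last us)) (m x) (last us) x"
    and IH: "\<And>\<beta> m'. coloring \<beta> \<Longrightarrow> cyclic_fan \<beta> v m' us \<Longrightarrow> kempe_equiv \<beta> (recolor v (set us) m' \<beta>)"
  shows "kempe_equiv \<alpha> (recolor v (set (x # us)) m \<alpha>)"
proof -
  note C = cyclic_fanD[OF cyc]
  define u a d where "u = last us" and "a = m u" and "d = m x"
  have u: "u \<in> set us" using ne by (simp add: u_def)
  have ux: "u \<noteq> x" "u \<in> set (x # us)" "x \<in> set (x # us)" using C(2) u by auto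
  have inj: "inj_on m (set (x # us))" by (rule cyclic_fan_inj[OF \<alpha> cyc])
  have map: "map m (x # us) = map (\<lambda>u. \<alpha> {v, u}) us @ [\<alpha> {v, x}]"
    using cyc by (simp add: cyclic_fan_def fan_def)
  have us: "us = butlast us @ [u]" using ne by (simp add: u_def)
  have dv: "d = \<alpha> {v, hd us}" using map ne by (cases us) (auto simp: d_def)
  have "last (map m (x # us)) = \<alpha> {v, x}" unfolding map by simp
  then have av: "a = \<alpha> {v, x}" using ne by (simp add: a_def u_def last_map)
  have ad: "a \<in> {1..t}" "d \<in> {1..t}" "a \<noteq> d"
    using inj_onD[OF inj, of u x] ux miss_range[OF C(4)[OF ux(2)]] miss_range[OF C(4)[OF ux(3)]]
    by (auto simp: a_def d_def)
  have mu: "m w \<noteq> a \<and> m w \<noteq> d" if "w \<in> set us" "w \<noteq> u" for w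
    using that inj_onD[OF inj] ux C(2) by (auto simp: a_def d_def)
  define S where "S = {y. linked \<alpha> a d u y}"
  have cl: "closed \<alpha> a d S" unfolding S_def by (rule closed_component)
  have xS: "x \<notin> S" "u \<in> S" using nl by (auto simp: S_def a_def d_def u_def)
  \<comment> \<open>The spoke \<open>{v, x}\<close> has color \<open>a\<close>, so a component
    containing \<open>v\<close> would contain \<open>x\<close>.\<close>
  have vS: "v \<notin> S" using closedD[OF cl, of v x] C(3)[OF ux(3)] av xS by auto
  define \<alpha>1 where "\<alpha>1 = swap_on a d S \<alpha>"
  have eq1: "kempe_equiv \<alpha> \<alpha>1" unfolding \<alpha>1_def by (rule kempe_equiv_swap_on[OF \<alpha> cl ad])
  have col: "\<alpha>1 {v, w} = \<alpha> {v, w}" if "{v, w} \<in> E" for w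
    using swap_on_closed[OF cl that] vS by (simp add: \<alpha>1_def)
  define m' where "m' = m(u := d)"
  have "map m us = map (\<lambda>u. \<alpha> {v, u}) (tl us) @ [\<alpha> {v, x}]"
    using map ne by (cases us) auto
  then have "map m (butlast us) = map (\<lambda>u. \<alpha> {v, u}) (tl us)"
    using us by (metis butlast_snoc map_butlast)
  moreover have "map m' (butlast us) = map m (butlast us)"
    using C(2) us by (metis (no_types, lifting) distinct.simps(2) distinct_butlast fun_upd_other m'_def map_cong not_distinct_conv_prefix)
  moreover have "map m' us = map m' (butlast us) @ [d]"
    by (subst us) (simp add: m'_def)
  moreover have "\<And>w. w \<in> set us \<Longrightarrow> {v, w} \<in> E" using C(3) by auto
  moreover have "\<And>w. w \<in> set (tl us) \<Longrightarrow> {v, w} \<in> E" using C(3) ne by (simp add: list.set_sel(2))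
  moreover have "\<alpha>1 {v, hd us} = d" using dv col C(3)[of "hd us"] ne by simp
  ultimately have "map m' us = map (\<lambda>u. \<alpha>1 {v, u}) (tl us) @ [\<alpha>1 {v, hd us}]"
    using col by simp
  moreover have "miss \<alpha>1 w (m' w)" if "w \<in> set us" for w
  proof (cases "w = u")
    case True
    then show ?thesis
      using C(4)[OF ux(2)] xS ad unfolding \<alpha>1_def miss_swap_on[OF cl ad] by (simp add: m'_def a_def)
  next
    case False
    then show ?thesis
      using C(4)[of w] that mu[OF that] unfolding \<alpha>1_def miss_swap_on[OF cl ad] by (simp add: m'_def)
  qed
  ultimately have "cyclic_fan \<alpha>1 v m' us" using C ne by (simp add: fan_def cyclic_fan_def)
  then have eq2: "kempe_equiv \<alpha>1 (recolor v (set us) m' \<alpha>1)" (is "kempe_equiv _ ?\<alpha>2")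
    using IH[OF kempe_equiv_coloring[OF eq1]] by blast
  have vus: "v \<notin> set us" using C(5) by simp
  have eq12: "kempe_equiv \<alpha> ?\<alpha>2" by (rule kempe_equiv_trans[OF eq1 eq2])
  have at_v: "?\<alpha>2 {v, w} = (if w = u then d else if w \<in> set us then m w else \<alpha> {v, w})" if "{v, w} \<in> E" for w
    using vus col[OF that] u by (auto simp: recolor_edge m'_def)
  have only_u: "w = u \<or> w = x" if "{v, w} \<in> E" "?\<alpha>2 {v, w} = a \<or> ?\<alpha>2 {v, w} = d" for w
    using that at_v[OF that(1)] mu[of w] cyclic_fan_outside[OF \<alpha> cyc ux(2) that(1)]
      cyclic_fan_outside[OF \<alpha> cyc ux(3) that(1)]
    by (auto simp: a_def d_def split: if_splits)
  have x_only: "y = v" if "{x, y} \<in> E" "\<alpha>1 {x, y} = a \<or> \<alpha>1 {x, y} = d" for y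
  proof -
    have "\<alpha> {x, y} = a \<or> \<alpha> {x, y} = d"
      using that swap_on_closed[OF cl that(1)] xS by (simp add: \<alpha>1_def)
    then have "\<alpha> {x, y} = a" using missD[OF C(4)[OF ux(3)] that(1)] by (simp add: d_def)
    then show ?thesis
      using col_inj[OF \<alpha> that(1), of v] C(3)[OF ux(3)] av by (simp add: insert_commute)
  qed
  have cl2: "closed ?\<alpha>2 a d (insert v (insert x S))"
    unfolding closed_def
  proof (intro allI impI, elim conjE)
    fix w y assume wy: "w \<in> insert v (insert x S)" "{w, y} \<in> E" "?\<alpha>2 {w, y} = a \<or> ?\<alpha>2 {w, y} = d"
    show "y \<in> insert v (insert x S)"
    proof (cases "w = v \<or> y = v")
      case True
      then show ?thesis using only_u[of y] wy xS by auto
    next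
      case False
      then have "?\<alpha>2 {w, y} = \<alpha>1 {w, y}" by (simp add: recolor_apart')
      then show ?thesis using closedD[of \<alpha>1 a d S w y] cl wy False x_only[of y] by (auto simp: \<alpha>1_def)
    qed
  qed
  note eq12
  also have "kempe_equiv ?\<alpha>2 (swap_on a d (insert v (insert x S)) ?\<alpha>2)"
    by (rule kempe_equiv_swap_on[OF kempe_equiv_coloring[OF eq12] cl2 ad])
  also have "swap_on a d (insert v (insert x S)) ?\<alpha>2 = recolor v (set (x # us)) m \<alpha>" (is "?L = ?R")
  proof (rule fun_eq_edges)
    show "?L e = ?R e" if "e \<notin> E" for e
      using swap_on_outside[OF kempe_equiv_coloring[OF eq12] ad(1,2) that]
        recolor_outside[OF that, of "set (x # us)" v] C(3) col_outside[OF \<alpha> that] by simp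
    have vx: "?L {v, y} = ?R {v, y}" if "{v, y} \<in> E" for y
    proof -
      have R: "?R {v, y} = (if y \<in> set (x # us) then m y else \<alpha> {v, y})"
        using C(5) by (simp add: recolor_edge)
      have L: "?L {v, y} = (if ?\<alpha>2 {v, y} = a then d else if ?\<alpha>2 {v, y} = d then a else ?\<alpha>2 {v, y})"
        by (simp add: swap_on_edge)
      show ?thesis
      proof (cases "y = u \<or> y = x")
        case True
        then show ?thesis unfolding L R using at_v[OF that] ux u C(2) ad(3) av by (auto simp: a_def d_def)
      next
        case False
        then have "?\<alpha>2 {v, y} \<noteq> a" "?\<alpha>2 {v, y} \<noteq> d" using only_u[OF that] by blast+
        then have "?L {v, y} = ?\<alpha>2 {v, y}" unfolding L by simp
        then show ?thesis unfolding R using at_v[OF that] False by simp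
      qed
    qed
    show "?L {w, y} = ?R {w, y}" if wy: "{w, y} \<in> E" for w y
    proof -
      consider "w = v" | "y = v" | "w \<noteq> v" "y \<noteq> v" by auto
      then show ?thesis
      proof cases
        case 1
        then show ?thesis using vx wy by simp
      next
        case 2
        then show ?thesis using vx[of w] wy by (simp add: insert_commute)
      next
        case 3
        then have 1: "?\<alpha>2 {w, y} = \<alpha>1 {w, y}" by (simp add: recolor_apart')
        have yw: "{y, w} = {w, y}" by auto
        have "\<not> (\<alpha>1 {w, y} = a \<or> \<alpha>1 {w, y} = d)" if "w = x \<or> y = x"
          using that 3 x_only[of y] x_only[of w] wy yw by auto
        then have "?L {w, y} = swap_on a d S \<alpha>1 {w, y}"
          using 1 3 by (auto simp: swap_on_edge)
        then show ?thesis using 3 by (simp add: \<alpha>1_def recolor_apart')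
      qed
    qed
  qed
  finally show ?thesis .
qed

text \<open>Distinct spokes have distinct colors. The last leaf is excluded because its color
  \<open>c\<close> is not tied to a later spoke and may repeat that of an earlier leaf.\<close>

lemma fan_inj:
  assumes "coloring \<alpha>" "fan \<alpha> v m us c" "x \<in> set (butlast us)" "y \<in> set (butlast us)" "m x = m y"
  shows "x = y"
proof -
  have "distinct us" "us \<noteq> []" using assms(2) by (auto simp: fan_def)
  have E: "\<And>w. w \<in> set us \<Longrightarrow> {v, w} \<in> E" using assms(2) by (auto simp: fan_def)
  have "map m us = map (\<lambda>u. \<alpha> {v, u}) (tl us) @ [c]" using assms(2) by (simp add: fan_def)
  then have "map m (butlast us) = map (\<lambda>u. \<alpha> {v, u}) (tl us)" by (simp add: map_butlast)
  moreover have "distinct (map (\<lambda>u. \<alpha> {v, u}) (tl us))"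
    unfolding distinct_map
  proof
    show "distinct (tl us)" using \<open>distinct us\<close> by (rule distinct_tl)
    show "inj_on (\<lambda>u. \<alpha> {v, u}) (set (tl us))"
      using E col_inj[OF assms(1)] list.set_sel(2)[OF \<open>us \<noteq> []\<close>] by (blast intro!: inj_onI)
  qed
  ultimately have "distinct (map m (butlast us))" by simp
  then have "inj_on m (set (butlast us))" by (simp add: distinct_map)
  then show ?thesis using assms(3-5) by (auto dest: inj_onD)
qed

lemma fan_next:
  assumes "fan \<alpha> v m us c" "x \<in> set (butlast us)"
  shows "\<exists>w\<in>set (tl us). m x = \<alpha> {v, w}"
proof -
  have "map m us = map (\<lambda>u. \<alpha> {v, u}) (tl us) @ [c]" using assms(1) by (simp add: fan_def)
  then have "map m (butlast us) = map (\<lambda>u. \<alpha> {v, u}) (tl us)" by (simp add: map_butlast)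
  then have "m ` set (butlast us) = (\<lambda>u. \<alpha> {v, u}) ` set (tl us)" by (metis set_map)
  then show ?thesis using assms(2) by auto
qed

lemma fan_last: "fan \<alpha> v m us c \<Longrightarrow> m (last us) = c"
proof -
  assume *: "fan \<alpha> v m us c"
  then have "us \<noteq> []" by (simp add: fan_def)
  have "map m us = map (\<lambda>u. \<alpha> {v, u}) (tl us) @ [c]" using * by (simp add: fan_def)
  then have "last (map m us) = c" by simp
  then show ?thesis using \<open>us \<noteq> []\<close> by (simp add: last_map)
qed

text \<open>After the fan at the leaf \<open>x\<close> is shifted, \<open>v\<close> misses the old color of \<open>{v, x}\<close>, so \<open>us\<close> is a
  path fan at \<open>v\<close> and can be shifted too. It remains to run the fan at \<open>x\<close> backwards. If that
  reversed fan is cyclic, it is invertible because \<open>v\<close> and \<open>x\<close> are not linked any more: in \<open>\<alpha>\<close> the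
  chain of \<open>x\<close> already ends at \<open>last us\<close>, hence avoids \<open>last ys\<close>.\<close>

lemma cyclic_fan_invert_by_leaf:
  assumes \<alpha>: "coloring \<alpha>" and cyc: "cyclic_fan \<alpha> v m (x # us)" and ne: "us \<noteq> []"
    and l: "linked \<alpha> (m (last us)) (m x) (last us) x"
    and nadj: "\<And>u. u \<in> set us \<Longrightarrow> {x, u} \<notin> E"
    and fan: "fan \<alpha> x n ys e" and hd: "hd ys = v" and e: "miss \<alpha> x e"
  shows "kempe_equiv \<alpha> (recolor v (set (x # us)) m \<alpha>)"
proof -
  note C = cyclic_fanD[OF cyc]
  define a d where "a = m (last us)" and "d = m x"
  have inj: "inj_on m (set (x # us))" by (rule cyclic_fan_inj[OF \<alpha> cyc])
  have map: "map m (x # us) = map (\<lambda>u. \<alpha> {v, u}) us @ [\<alpha> {v, x}]"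
    using cyc by (simp add: cyclic_fan_def fan_def)
  have dv: "d = \<alpha> {v, hd us}" using map ne by (cases us) (auto simp: d_def)
  have "last (map m (x # us)) = \<alpha> {v, x}" unfolding map by simp
  then have av: "a = \<alpha> {v, x}" using ne by (simp add: a_def last_map)
  have xv: "{x, v} = {v, x}" by auto
  have vx: "{v, x} \<in> E" "{x, v} \<in> E" "x \<noteq> v" "v \<notin> set us" "x \<notin> set us"
    unfolding xv using C(2,3,5) by auto
  have lastus: "last us \<in> set us" "{v, last us} \<in> E" "miss \<alpha> (last us) a" "last us \<noteq> v"
    using ne C(3,4,6) by (auto simp: a_def)
  have hdus: "hd us \<in> set us" "{v, hd us} \<in> E" using ne C(3) by auto
  have mx: "miss \<alpha> x d" using C(4) by (simp add: d_def)
  have ad: "a \<noteq> d" using inj_onD[OF inj, of "last us" x] lastus vx by (auto simp: a_def d_def)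
  have ys: "ys \<noteq> []" "distinct ys" "v \<in> set ys" "x \<notin> set ys" "set ys \<inter> set us = {}"
    "\<And>y. y \<in> set ys \<Longrightarrow> {x, y} \<in> E" "\<And>y. y \<in> set ys \<Longrightarrow> miss \<alpha> y (n y)"
    "map n ys = map (\<lambda>u. \<alpha> {x, u}) (tl ys) @ [e]"
    using fan hd nadj fan_center[OF fan] by (auto simp: fan_def)
  have yv: "ys = v # tl ys" using ys(1) hd by (cases ys) auto
  define \<alpha>1 where "\<alpha>1 = recolor x (set ys) n \<alpha>"
  have eq1: "kempe_equiv \<alpha> \<alpha>1" unfolding \<alpha>1_def by (rule kempe_equiv_path_shift[OF \<alpha> fan e])
  have nv: "n y \<noteq> \<alpha> {x, y}" if "y \<in> set ys" for y
    using missD'[OF ys(7)[OF that], of x] ys(6)[OF that] by auto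
  have m1: "miss \<alpha>1 y (\<alpha> {x, y})" if "y \<in> set ys" for y
    unfolding \<alpha>1_def by (rule miss_recolor_old) (use \<alpha> ys(4) that ys(6)[OF that] nv[OF that] in auto)
  have at_v1: "\<alpha>1 {v, u} = \<alpha> {v, u}" if "u \<noteq> x" for u
    using that vx by (simp add: \<alpha>1_def recolor_apart')
  \<comment> \<open>No leaf in \<open>us\<close> is adjacent to \<open>x\<close>, hence none lies in
    \<open>ys\<close>, and the shift at \<open>x\<close> does not affect what these leaves
    miss.\<close>
  have "miss \<alpha>1 u (m u)" if "u \<in> set us" for u
    unfolding \<alpha>1_def using miss_recolor_other[OF ys(4), of u] C(4)[of u] that ys(5) vx by auto
  moreover have "map m us = map (\<lambda>u. \<alpha>1 {v, u}) (tl us) @ [a]"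
  proof -
    have "map m us = map (\<lambda>u. \<alpha> {v, u}) (tl us) @ [a]" using map ne av by (cases us) auto
    moreover have "x \<notin> set (tl us)" using vx ne by (meson list.set_sel(2))
    then have "\<alpha>1 {v, u} = \<alpha> {v, u}" if "u \<in> set (tl us)" for u
      using at_v1[of u] that by auto
    ultimately show ?thesis by simp
  qed
  ultimately have fan1: "fan \<alpha>1 v m us a" using C ne by (simp add: fan_def)
  have "miss \<alpha>1 v a" using m1[OF ys(3)] av xv by simp
  then have eq2: "kempe_equiv \<alpha>1 (recolor v (set us) m \<alpha>1)"
    by (rule kempe_equiv_path_shift[OF kempe_equiv_coloring[OF eq1] fan1])
  define \<alpha>2 where "\<alpha>2 = recolor v (set us) m \<alpha>1"
  have eq12: "kempe_equiv \<alpha> \<alpha>2" using kempe_equiv_trans[OF eq1 eq2] by (simp add: \<alpha>2_def)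
  have \<alpha>2: "coloring \<alpha>2" by (rule kempe_equiv_coloring[OF eq12])
  have at_x: "\<alpha>2 {x, y} = (if y \<in> set ys then n y else \<alpha> {x, y})" for y
    using ys(4) vx by (auto simp: \<alpha>2_def \<alpha>1_def recolor_edge)
  have at_v: "\<alpha>2 {v, u} = (if u \<in> set us then m u else if u = x then n v else \<alpha> {v, u})" for u
    using ys(3,4) vx by (auto simp: \<alpha>2_def \<alpha>1_def recolor_edge)
  have apart: "\<alpha>2 {p, q} = \<alpha> {p, q}" if "p \<noteq> v" "q \<noteq> v" "p \<noteq> x" "q \<noteq> x" for p q
    using that by (simp add: \<alpha>2_def \<alpha>1_def recolor_apart')
  \<comment> \<open>Every vertex of \<open>ys\<close> other than \<open>v\<close> still misses the
    old color of its spoke at \<open>x\<close>. At \<open>v\<close> that color, \<open>a\<close>,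
    has been taken by \<open>last us\<close>; instead \<open>v\<close> misses \<open>d\<close>,
    freed by \<open>hd us\<close>, and \<open>d\<close> is also the color that \<open>{v, x}\<close>
    has to receive.\<close>
  define n' where "n' y = (if y = v then d else \<alpha> {x, y})" for y
  have mv2: "miss \<alpha>2 v d"
  proof -
    have "miss \<alpha>2 v (\<alpha>1 {v, hd us})" unfolding \<alpha>2_def miss_recolor_center[OF vx(4)]
    proof (intro conjI allI impI)
      show "\<alpha>1 {v, hd us} \<in> {1..t}" using col_range[OF kempe_equiv_coloring[OF eq1] hdus(2)] .
      fix y assume y: "{v, y} \<in> E"
      have \<alpha>1hd: "\<alpha>1 {v, hd us} = d" using at_v1 hdus(1) vx(5) dv by metis
      show "(if y \<in> set us then m y else \<alpha>1 {v, y}) \<noteq> \<alpha>1 {v, hd us}"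
      proof (cases "y \<in> set us")
        case True
        then show ?thesis using inj_onD[OF inj, of y x] vx \<alpha>1hd by (auto simp: d_def)
      next
        case False
        then show ?thesis using col_inj[OF kempe_equiv_coloring[OF eq1] y hdus(2)] hdus(1) by auto
      qed
    qed
    then show ?thesis using at_v1 hdus(1) vx(5) dv by metis
  qed
  have m2: "miss \<alpha>2 y (n' y)" if "y \<in> set ys" for y
  proof (cases "y = v")
    case True
    then show ?thesis using mv2 by (simp add: n'_def)
  next
    case False
    then have "miss \<alpha>2 y (\<alpha> {x, y})"
      using miss_recolor_other[OF vx(4), of y] m1[OF that] that ys(5) by (auto simp: \<alpha>2_def)
    then show ?thesis using False by (simp add: n'_def)
  qed
  have rev: "map n' (rev ys) = map (\<lambda>u. \<alpha>2 {x, u}) (tl (rev ys)) @ [d]" "\<alpha>2 {x, hd (rev ys)} = e"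
  proof -
    have "map n' (tl ys) = map (\<lambda>u. \<alpha> {x, u}) (tl ys)"
      using ys(2) yv by (auto simp: n'_def) (metis distinct.simps(2))
    also have "\<dots> = map n (butlast ys)" using ys(8) by (simp add: map_butlast)
    also have "\<dots> = map (\<lambda>u. \<alpha>2 {x, u}) (butlast ys)"
      using at_x by (auto dest: in_set_butlastD)
    finally have "map n' (rev (tl ys)) = map (\<lambda>u. \<alpha>2 {x, u}) (rev (butlast ys))"
      by (metis rev_map)
    moreover have "rev (butlast ys) = tl (rev ys)" by (metis butlast_rev rev_rev_ident)
    moreover have "rev ys = rev (tl ys) @ [v]" by (subst yv) simp
    ultimately show "map n' (rev ys) = map (\<lambda>u. \<alpha>2 {x, u}) (tl (rev ys)) @ [d]" by (simp add: n'_def)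
    show "\<alpha>2 {x, hd (rev ys)} = e"
      using at_x fan_last[OF fan] ys(1) by (simp add: hd_rev)
  qed
  have fan2: "fan \<alpha>2 x n' (rev ys) d"
    using rev(1) m2 ys by (auto simp: fan_def)
  have "kempe_equiv \<alpha>2 (recolor x (set (rev ys)) n' \<alpha>2)"
  \<comment> \<open>The first spoke of the reversed fan has color \<open>e\<close> and its last leaf
    misses \<open>d\<close>. If \<open>e\<close> and \<open>d\<close> differ, then \<open>x\<close>
    still misses \<open>d\<close> and the fan is a path; otherwise it is cyclic.\<close>
  proof (cases "e = d")
    case False
    have "miss \<alpha>2 x d"
      unfolding miss_def
    proof (intro conjI allI impI)
      show "d \<in> {1..t}" using miss_range[OF mx] .
      fix y assume y: "{x, y} \<in> E"
      show "\<alpha>2 {x, y} \<noteq> d"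
      proof (cases "y \<in> set ys")
        case True
        show ?thesis
        proof (cases "y = last ys")
          case True
          then show ?thesis using at_x ys(1) fan_last[OF fan] False by simp
        next
          case False
          then have "y \<in> set (butlast ys)" using True by (metis append_butlast_last_id ys(1) in_set_butlast_appendI set_ConsD list.set(1) Un_iff set_append empty_iff)
          then obtain w where "w \<in> set (tl ys)" "n y = \<alpha> {x, w}" using fan_next[OF fan] by blast
          then show ?thesis using True at_x missD[OF mx, of w] ys(6)[of w] ys(1) by (simp add: list.set_sel(2))
        qed
      next
        case False
        then show ?thesis using at_x missD[OF mx y] by simp
      qed
    qed
    then show ?thesis by (rule kempe_equiv_path_shift[OF \<alpha>2 fan2])
  next
    case True
    have cyc2: "cyclic_fan \<alpha>2 x n' (rev ys)"
      using fan2 rev(2) True by (simp add: cyclic_fan_def)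
    have nva: "n v \<noteq> a" using nv[OF ys(3)] av xv by simp
    \<comment> \<open>The color \<open>a\<close> was on \<open>{v, x}\<close>, the first spoke of
      the fan at \<open>x\<close>, and a shifted fan drops the color of its first spoke.\<close>
    have mxa: "miss \<alpha>2 x a"
      unfolding miss_def
    proof (intro conjI allI impI)
      show "a \<in> {1..t}" using miss_range[OF lastus(3)] .
      fix y assume y: "{x, y} \<in> E"
      show "\<alpha>2 {x, y} \<noteq> a"
      proof (cases "y \<in> set ys")
        case T: True
        show ?thesis
        proof (cases "y = last ys")
          case True
          then show ?thesis using at_x ys(1) fan_last[OF fan] \<open>e = d\<close> ad by simp
        next
          case False
          then have "y \<in> set (butlast ys)" using T by (metis append_butlast_last_id ys(1) set_ConsD list.set(1) Un_iff set_append empty_iff)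
          then obtain w where w: "w \<in> set (tl ys)" "n y = \<alpha> {x, w}" using fan_next[OF fan] by blast
          then have "w \<noteq> v" "{x, w} \<in> E" using ys(2,6) yv by (metis distinct.simps(2), metis ys(1) list.set_sel(2))
          then have "\<alpha> {x, w} \<noteq> a" using col_inj[OF \<alpha> _ vx(2)] av xv by metis
          then show ?thesis using T at_x w by simp
        qed
      next
        case False
        then have "y \<noteq> v" using ys(3) by auto
        then show ?thesis using False at_x col_inj[OF \<alpha> y vx(2)] av xv by auto
      qed
    qed
    define z where "z = last ys"
    have z: "z \<in> set ys" "miss \<alpha> z d" "z \<noteq> x"
      using ys(1,4) ys(7)[of z] fan_last[OF fan] True by (auto simp: z_def)
    have zl: "z \<noteq> last us" using z ys(5) lastus by auto
    have nz: "\<not> linked \<alpha> a d z x"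
      using linked_ends[OF \<alpha> ad, of x "last us" z] mx lastus(3) z zl l vx(5) lastus(1)
      by (auto simp: a_def d_def dest: linked_sym)
    define S where "S = {y. linked \<alpha> a d z y}"
    have cl: "closed \<alpha> a d S" unfolding S_def by (rule closed_component)
    have xS: "x \<notin> S" using nz by (simp add: S_def)
    have vS: "v \<notin> S" using closedD[OF cl, of v x] vx av xS by auto
    have uS: "last us \<notin> S"
      using linked_trans[of \<alpha> a d z "last us" x] l nz by (auto simp: S_def a_def d_def)
    \<comment> \<open>This set separates \<open>x\<close> from \<open>v\<close> in the new coloring:
      at \<open>x\<close> the only edge with one of the two colors is \<open>{x, z}\<close>, and at
      \<open>v\<close> it is the spoke of \<open>last us\<close>, which lies outside
      \<open>S\<close>.\<close>
    have "closed \<alpha>2 a d (insert x S)"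
      unfolding closed_def
    proof (intro allI impI, elim conjE)
      fix p q assume pq: "p \<in> insert x S" "{p, q} \<in> E" "\<alpha>2 {p, q} = a \<or> \<alpha>2 {p, q} = d"
      have at_x': "y = z" if "{x, y} \<in> E" "\<alpha>2 {x, y} = a \<or> \<alpha>2 {x, y} = d" for y
      proof -
        have "\<alpha>2 {x, y} = d" using that missD[OF mxa] by auto
        moreover have "\<alpha>2 {x, z} = d" using at_x z(1) fan_last[OF fan] True by (simp add: z_def)
        ultimately show ?thesis using col_inj[OF \<alpha>2 that(1) ys(6)[OF z(1)]] by simp
      qed
      have at_v': "y = last us" if "{v, y} \<in> E" "\<alpha>2 {v, y} = a \<or> \<alpha>2 {v, y} = d" for y
      proof -
        have "\<alpha>2 {v, y} = a" using that missD[OF mv2] by auto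
        moreover have "\<alpha>2 {v, last us} = a" using at_v lastus(1) by (simp add: a_def)
        ultimately show ?thesis using col_inj[OF \<alpha>2 that(1) lastus(2)] by simp
      qed
      have qp: "{q, p} = {p, q}" by auto
      consider "p = x" | "p \<noteq> x" "q = x" | "p \<noteq> x" "q = v" | "p \<noteq> x" "q \<noteq> x" "q \<noteq> v" by auto
      then show "q \<in> insert x S"
      proof cases
        case 1
        then show ?thesis using at_x' pq z by (auto simp: S_def)
      next
        case 2
        then show ?thesis by simp
      next
        case 3
        then show ?thesis using at_v'[of p] pq uS qp by auto
      next
        case 4
        then have "p \<noteq> v" using pq(1) vS by auto
        then show ?thesis using apart[of p q] 4 closedD[OF cl, of p q] pq by auto
      qed
    qed
    moreover have "v \<notin> insert x S" using vS vx by auto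
    ultimately have "\<not> linked \<alpha>2 a d x v" using linked_closed[of \<alpha>2 a d x v] by blast
    then have "\<not> linked \<alpha>2 (n' v) a v x"
      using linked_sym linked_commute[of \<alpha>2 a d] by (auto simp: n'_def)
    then show ?thesis
      using cyclic_fan_unlinked[OF \<alpha>2 cyc2 mxa, of v] ys(3) by simp
  qed
  with eq12 have "kempe_equiv \<alpha> (recolor x (set ys) n' \<alpha>2)" using kempe_equiv_trans by simp
  also have "recolor x (set ys) n' \<alpha>2 = recolor v (set (x # us)) m \<alpha>" (is "?L = ?R")
  proof (rule fun_eq_edges)
    show "?L e = ?R e" if "e \<notin> E" for e
      using recolor_outside[OF that, of "set (x # us)" v] recolor_outside[OF that, of "set ys" x]
        col_outside[OF \<alpha> that] col_outside[OF \<alpha>2 that] C(3) ys(6) by simp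
    have R: "?R {p, q} = (if p = v \<and> q \<in> set (x # us) then m q else if q = v \<and> p \<in> set (x # us) then m p else \<alpha> {p, q})" for p q
      by (rule recolor_edge[OF C(5)])
    have Rx: "?L {x, q} = ?R {x, q}" if "{x, q} \<in> E" for q
      unfolding R using at_x[of q] ys(3,4) vx by (auto simp: recolor_edge n'_def d_def)
    have Rv: "?L {v, q} = ?R {v, q}" if "{v, q} \<in> E" "q \<noteq> x" for q
      unfolding R using at_v[of q] that ys(4) vx by (simp add: recolor_apart')
    show "?L {p, q} = ?R {p, q}" if pq: "{p, q} \<in> E" for p q
    proof -
      have qp: "{q, p} = {p, q}" by auto
      consider "p = x" | "q = x" | "p = v" "q \<noteq> x" | "q = v" "p \<noteq> x" | "p \<noteq> x" "q \<noteq> x" "p \<noteq> v" "q \<noteq> v" by auto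
      then show ?thesis
      proof cases
        case 5
        then show ?thesis using apart[of p q] by (simp add: recolor_apart')
      qed (use Rx[of q] Rx[of p] Rv[of p] Rv[of q] pq qp in auto)
    qed
  qed
  finally show ?thesis .
qed

text \<open>Each of the two leaves misses the color of the other spoke, so \<open>x\<close>,
  \<open>v\<close>, \<open>y\<close> form a whole component of the two colors, and swapping it
  exchanges the spokes.\<close>

lemma cyclic_fan_two:
  assumes \<alpha>: "coloring \<alpha>" and cyc: "cyclic_fan \<alpha> v m [x, y]"
  shows "kempe_equiv \<alpha> (recolor v (set [x, y]) m \<alpha>)"
proof -
  note C = cyclic_fanD[OF cyc]
  define a d where "a = \<alpha> {v, x}" and "d = \<alpha> {v, y}"
  have E: "{v, x} \<in> E" "{v, y} \<in> E" "x \<noteq> y" "v \<noteq> x" "v \<noteq> y" using C(2,3,5) by auto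
  have m: "m x = d" "m y = a" using cyc by (auto simp: cyclic_fan_def fan_def a_def d_def)
  have miss: "miss \<alpha> x d" "miss \<alpha> y a" using C(4) m by auto
  have ad: "a \<in> {1..t}" "d \<in> {1..t}" "a \<noteq> d"
    using miss miss_range missD'[OF miss(1) E(1)] by (auto simp: a_def)
  have sw: "{x, v} = {v, x}" "{y, v} = {v, y}" by auto
  have atv: "z = x \<or> z = y" if "{v, z} \<in> E" "\<alpha> {v, z} = a \<or> \<alpha> {v, z} = d" for z
    using that col_inj[OF \<alpha> that(1)] E unfolding a_def d_def by blast
  have atx: "z = v" if "{x, z} \<in> E" "\<alpha> {x, z} = a \<or> \<alpha> {x, z} = d" for z
    using that col_inj[OF \<alpha> that(1), of v] E missD[OF miss(1) that(1)] unfolding a_def sw by blast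
  have aty: "z = v" if "{y, z} \<in> E" "\<alpha> {y, z} = a \<or> \<alpha> {y, z} = d" for z
    using that col_inj[OF \<alpha> that(1), of v] E missD[OF miss(2) that(1)] unfolding d_def sw by blast
  have cl: "closed \<alpha> a d {v, x, y}"
    unfolding closed_def using atv atx aty by blast
  have "kempe_equiv \<alpha> (swap_on a d {v, x, y} \<alpha>)" by (rule kempe_equiv_swap_on[OF \<alpha> cl ad])
  also have "swap_on a d {v, x, y} \<alpha> = recolor v (set [x, y]) m \<alpha>" (is "?L = ?R")
  proof (rule fun_eq_edges)
    show "?L e = ?R e" if "e \<notin> E" for e
      using swap_on_outside[OF \<alpha> ad(1,2) that] col_outside[OF \<alpha> that]
        recolor_outside[OF that, of "set [x, y]" v] E by simp
    have R: "?R {p, q} = (if p = v \<and> q \<in> {x, y} then m q else if q = v \<and> p \<in> {x, y} then m p else \<alpha> {p, q})" for p q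
      by (subst recolor_edge[OF C(5)]) (simp only: list.set)
    have Rv: "?L {v, z} = ?R {v, z}" if "{v, z} \<in> E" for z
    proof -
      have L: "?L {v, z} = (if \<alpha> {v, z} = a then d else if \<alpha> {v, z} = d then a else \<alpha> {v, z})"
        by (simp add: swap_on_edge)
      consider "z = x" | "z = y" | "z \<noteq> x" "z \<noteq> y" by auto
      then show ?thesis
        unfolding L R using m E atv[OF that] by cases (auto simp: a_def d_def)
    qed
    show "?L {p, q} = ?R {p, q}" if pq: "{p, q} \<in> E" for p q
    proof -
      have qp: "{q, p} = {p, q}" by auto
      consider "p = v" | "q = v" | "p \<noteq> v" "q \<noteq> v" by auto
      then show ?thesis
      proof cases
        case 3
        then have "\<not> (\<alpha> {p, q} = a \<or> \<alpha> {p, q} = d)" if "p = x \<or> p = y \<or> q = x \<or> q = y"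
          using that atx[of p] atx[of q] aty[of p] aty[of q] pq qp by auto
        then show ?thesis using 3 by (auto simp: swap_on_edge recolor_apart')
      qed (use Rv[of q] Rv[of p] pq qp in auto)
    qed
  qed
  finally show ?thesis .
qed

section \<open>Changing, cutting and gluing fans\<close>

lemma fan_butlast:
  "fan \<alpha> v m us c \<Longrightarrow> map m (butlast us) = map (\<lambda>u. \<alpha> {v, u}) (tl us)"
  by (simp add: fan_def map_butlast)

text \<open>The color of the first spoke never enters the fan condition, so only the spokes of
  \<open>tl us\<close> have to keep theirs. The last leaf may be assigned a new color, since nothing
  follows it.\<close>

lemma fan_transfer:
  assumes fan: "fan \<alpha> v m us c" and miss: "\<And>u. u \<in> set us \<Longrightarrow> miss \<beta> u (m' u)"
    and col: "\<And>u. u \<in> set (tl us) \<Longrightarrow> \<beta> {v, u} = \<alpha> {v, u}"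
    and m': "\<And>u. u \<in> set us \<Longrightarrow> u \<noteq> last us \<Longrightarrow> m' u = m u" "m' (last us) = c'"
  shows "fan \<beta> v m' us c'"
proof -
  have us: "us \<noteq> []" "distinct us" using fan by (auto simp: fan_def)
  then have sp: "us = butlast us @ [last us]" by simp
  then have "last us \<notin> set (butlast us)" using us(2) by (metis distinct.simps(2) distinct_rev rev.simps(2) rev_rev_ident set_rev)
  then have "map m' (butlast us) = map m (butlast us)"
    using m'(1) by (metis (no_types, lifting) in_set_butlastD map_cong)
  then have "map m' (butlast us @ [last us]) = map (\<lambda>u. \<beta> {v, u}) (tl us) @ [c']"
    using fan_butlast[OF fan] m'(2) col by simp
  then show ?thesis using fan miss sp by (simp add: fan_def)
qed

text \<open>Serves to truncate a fan and, when a swap exchanges the colors of two spokes, to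
  reassemble its pieces in another order.\<close>

lemma fan_append_iff:
  assumes "as \<noteq> []"
  shows "fan \<alpha> v m (as @ w # bs) c \<longleftrightarrow>
    fan \<alpha> v m as (\<alpha> {v, w}) \<and> fan \<alpha> v m (w # bs) c \<and> set as \<inter> set (w # bs) = {}"
proof -
  obtain a as' where as: "as = a # as'" using assms by (cases as) auto
  have "map m (as @ w # bs) = map (\<lambda>u. \<alpha> {v, u}) (tl (as @ w # bs)) @ [c] \<longleftrightarrow>
    map m as @ map m (w # bs) = (map (\<lambda>u. \<alpha> {v, u}) (tl as) @ [\<alpha> {v, w}]) @ (map (\<lambda>u. \<alpha> {v, u}) bs @ [c])"
    by (simp add: as)
  also have "\<dots> \<longleftrightarrow> map m as = map (\<lambda>u. \<alpha> {v, u}) (tl as) @ [\<alpha> {v, w}] \<and>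
      map m (w # bs) = map (\<lambda>u. \<alpha> {v, u}) bs @ [c]"
    by (rule append_eq_append_conv) (simp add: as)
  finally show ?thesis using assms by (auto simp: fan_def)
qed

section \<open>The effect of recolorings on a single color class\<close>

lemma class_eqI:
  assumes "\<And>x y. {x, y} \<in> E \<Longrightarrow> \<beta> {x, y} = q \<longleftrightarrow> {x, y} \<in> B" "B \<subseteq> E"
  shows "{e \<in> E. \<beta> e = q} = B"
proof
  show "{e \<in> E. \<beta> e = q} \<subseteq> B" using assms(1) edgeE by blast
  show "B \<subseteq> {e \<in> E. \<beta> e = q}" using assms edgeE by blast
qed

lemma class_swap_on:
  assumes "q \<noteq> c" "q \<noteq> d"
  shows "{e \<in> E. swap_on c d S \<alpha> e = q} = {e \<in> E. \<alpha> e = q}"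
  using assms by (auto simp: swap_on_def split: if_splits)

lemma class_recolor_single:
  assumes "{v, u} \<in> E"
  shows "{e \<in> E. recolor v {u} (\<lambda>_. c) \<alpha> e = q} =
    (if c = q then insert {v, u} {e \<in> E. \<alpha> e = q} else {e \<in> E. \<alpha> e = q} - {{v, u}})"
proof (rule class_eqI)
  have vu: "v \<notin> {u}" using assms by auto
  fix x y assume xy: "{x, y} \<in> E"
  have "{x, y} = {v, u} \<longleftrightarrow> (x = v \<and> y = u) \<or> (x = u \<and> y = v)" by (auto simp: doubleton_eq_iff)
  then show "recolor v {u} (\<lambda>_. c) \<alpha> {x, y} = q \<longleftrightarrow>
    {x, y} \<in> (if c = q then insert {v, u} {e \<in> E. \<alpha> e = q} else {e \<in> E. \<alpha> e = q} - {{v, u}})"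
    unfolding recolor_edge[OF vu] using xy by auto
qed (use assms in auto)

text \<open>If the maximal fan from \<open>u\<close> closes up at an inner vertex, the two vertices missing the
  same color \<open>c\<close> cannot both be \<open>(c, b)\<close>-linked to the center.\<close>

lemma release_or_cyclic:
  assumes \<alpha>: "coloring \<alpha>" and e: "{v, u} \<in> E" and b: "miss \<alpha> v b"
    and n: "\<And>x. {v, x} \<in> E \<Longrightarrow> miss \<alpha> x (n x)"
  obtains (release) \<beta> where "kempe_equiv \<alpha> \<beta>"
      "{f \<in> E. \<beta> f = \<alpha> {v, u}} = {f \<in> E. \<alpha> f = \<alpha> {v, u}} - {{v, u}}"
    | (cyclic) us where "cyclic_fan \<alpha> v n us" "hd us = u"
proof -
  define q where "q = \<alpha> {v, u}"
  obtain ys where fan: "fan \<alpha> v n ys (n (last ys))" and hd: "hd ys = u"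
    and max: "\<And>w. {v, w} \<in> E \<Longrightarrow> \<alpha> {v, w} = n (last ys) \<Longrightarrow> w \<in> set ys"
    using fan_maximal[OF e n] by metis
  define z c where "z = last ys" and "c = n z"
  have fan: "fan \<alpha> v n ys c" using fan by (simp add: z_def c_def)
  have fy: "ys \<noteq> []" "distinct ys" "\<And>y. y \<in> set ys \<Longrightarrow> {v, y} \<in> E" "\<And>y. y \<in> set ys \<Longrightarrow> miss \<alpha> y (n y)"
    using fan by (auto simp: fan_def)
  have zys: "z \<in> set ys" using fy(1) by (simp add: z_def)
  \<comment> \<open>A path fan starting at \<open>u\<close> releases \<open>q\<close>: the colors it
    places are those of later spokes and one missing at \<open>v\<close>, while \<open>q\<close>
    belongs to the first spoke.\<close>
  have path: thesis if "fan \<beta> v n' us d" "hd us = u" "miss \<beta> v d" "kempe_equiv \<alpha> \<beta>"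
    "{f \<in> E. \<beta> f = q} = {f \<in> E. \<alpha> f = q}" for \<beta> n' us d
  proof (rule release)
    show "kempe_equiv \<alpha> (recolor v (set us) n' \<beta>)"
      using kempe_equiv_trans[OF that(4) kempe_equiv_path_shift[OF kempe_equiv_coloring[OF that(4)] that(1,3)]] .
    have us: "us \<noteq> []" "v \<notin> set us" "\<And>y. y \<in> set us \<Longrightarrow> {v, y} \<in> E"
      using that(1) fan_center[OF that(1)] by (auto simp: fan_def)
    have "u \<in> set us" using us(1) that(2) by auto
    have \<beta>: "coloring \<beta>" by (rule kempe_equiv_coloring[OF that(4)])
    have vuq: "\<beta> {v, u} = q" using that(5) e by (auto simp: q_def)
    have n'q: "n' y \<noteq> q" if "y \<in> set us" for y
    proof
      assume "n' y = q"
      have "n' y \<in> n' ` set us" using that by simp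
      also have "n' ` set us = (\<lambda>w. \<beta> {v, w}) ` set (tl us) \<union> {d}"
        using \<open>fan \<beta> v n' us d\<close> unfolding fan_def by (metis list.simps(15) list.set(1) set_append set_map)
      finally consider w where "w \<in> set (tl us)" "\<beta> {v, w} = q" | "d = q" using \<open>n' y = q\<close> by auto
      then show False
      proof cases
        case 1
        then have "{v, w} \<in> E" using us list.set_sel(2) by metis
        then have "w = u" using col_inj[OF \<beta> _ e] 1(2) vuq by simp
        then show False using 1(1) \<open>fan \<beta> v n' us d\<close> \<open>hd us = u\<close> us(1) by (cases us) (auto simp: fan_def)
      next
        case 2
        then show False using \<open>miss \<beta> v d\<close> missD e vuq by blast
      qed
    qed
    have atv: "\<beta> {v, y} = q \<longleftrightarrow> y = u" if "{v, y} \<in> E" for y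
      using col_inj[OF \<beta> that e] vuq by auto
    have "{f \<in> E. recolor v (set us) n' \<beta> f = q} = {f \<in> E. \<beta> f = q} - {{v, u}}"
    proof (rule class_eqI)
      have Rv: "recolor v (set us) n' \<beta> {v, y} = q \<longleftrightarrow> {v, y} \<in> {f \<in> E. \<beta> f = q} - {{v, u}}" if "{v, y} \<in> E" for y
        using n'q[of y] atv[OF that] us(2) \<open>u \<in> set us\<close> that
        by (auto simp: recolor_edge doubleton_eq_iff)
      fix x y assume xy: "{x, y} \<in> E"
      have yx: "{y, x} = {x, y}" by auto
      consider "x = v" | "y = v" | "x \<noteq> v" "y \<noteq> v" by auto
      then show "recolor v (set us) n' \<beta> {x, y} = q \<longleftrightarrow> {x, y} \<in> {f \<in> E. \<beta> f = q} - {{v, u}}"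
      proof cases
        case 3
        then show ?thesis using xy by (auto simp: recolor_apart' doubleton_eq_iff)
      qed (use Rv[of x] Rv[of y] xy yx in auto)
    qed auto
    then show "{f \<in> E. recolor v (set us) n' \<beta> f = \<alpha> {v, u}} = {f \<in> E. \<alpha> f = \<alpha> {v, u}} - {{v, u}}"
      using that(5) by (simp add: q_def)
  qed
  show thesis
  proof (cases "miss \<alpha> v c")
    case True
    then show ?thesis using path[OF fan hd _ kempe_equiv_refl[OF \<alpha>]] by simp
  next
    case False
    then obtain w where w: "{v, w} \<in> E" "\<alpha> {v, w} = c"
      using miss_range[OF fy(4)[OF zys]] by (auto simp: miss_def c_def)
    have wys: "w \<in> set ys" using max w by (simp add: c_def z_def)
    obtain as bs where ys: "ys = as @ w # bs" using wys by (meson split_list)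
    show ?thesis
    proof (cases "as = []")
      case True
      then have "cyclic_fan \<alpha> v n ys" using fan w(2) by (simp add: cyclic_fan_def ys)
      then show ?thesis using cyclic hd by blast
    next
      case False
      \<comment> \<open>\<open>A\<close> precedes \<open>w\<close> on the fan, so it misses
        \<open>c\<close> just like \<open>z\<close>. Swapping \<open>c\<close> and \<open>b\<close>
        outside the component of \<open>v\<close> makes at least one of them miss \<open>b\<close>.
        If this happens to \<open>A\<close>, the fan is cut behind \<open>A\<close>.\<close>
      define A where "A = last as"
      have A: "A \<in> set as" using False by (simp add: A_def)
      have fans: "fan \<alpha> v n as c" "fan \<alpha> v n (w # bs) c" "set as \<inter> set (w # bs) = {}"
        using fan w(2) fan_append_iff[OF False] unfolding ys by auto
      have nA: "n A = c" using fan_last[OF fans(1)] by (simp add: A_def)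
      have "z = last (w # bs)" by (simp add: z_def ys)
      then have "z \<in> set (w # bs)" by (metis last_in_set list.distinct(1))
      then have as_z: "y \<in> set ys" "y \<noteq> z" if "y \<in> set as" for y
        using that fans(3) ys by auto
      have hdas: "hd as = u" using hd ys False by simp
      have ct: "c \<in> {1..t}" and bt: "b \<in> {1..t}" using miss_range[OF fy(4)[OF zys]] miss_range[OF b] by (auto simp: c_def)
      have cb: "c \<noteq> b" using missD[OF b w(1)] w(2) by auto
      have "w \<noteq> u" using hdas False fans(3) by (cases as) auto
      then have qc: "q \<noteq> c" using col_inj[OF \<alpha> w(1) e] w(2) by (auto simp: q_def)
      have qb: "q \<noteq> b" using missD[OF b e] by (simp add: q_def)
      have butlast: "y \<in> set (butlast ys)" if "y \<in> set ys" "y \<noteq> z" for y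
        using that fy(1) append_butlast_last_id[OF fy(1)] unfolding z_def
        by (metis Un_iff empty_iff list.set(1) set_ConsD set_append)
      have nb: "n y \<noteq> b" if y: "y \<in> set ys" for y
      proof (cases "y = z")
        case True
        then show ?thesis using cb by (simp add: c_def)
      next
        case F: False
        obtain w' where "w' \<in> set (tl ys)" "n y = \<alpha> {v, w'}"
          using fan_next[OF fan butlast[OF y F]] by blast
        then show ?thesis using missD[OF b fy(3)] list.set_sel(2)[OF fy(1)] by metis
      qed
      have nc: "y = A" if "y \<in> set ys" "y \<noteq> z" "n y = c" for y
        using fan_inj[OF \<alpha> fan butlast butlast, of y A] that as_z[OF A] nA by simp
      define S \<beta> where "S = {y. \<not> linked \<alpha> c b v y}" and "\<beta> = swap_on c b S \<alpha>"
      have cl: "closed \<alpha> c b S" unfolding S_def by (rule closed_co_component)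
      note miss' = miss_swap_on[OF cl ct bt cb, folded \<beta>_def]
      have eq: "kempe_equiv \<alpha> \<beta>" unfolding \<beta>_def by (rule kempe_equiv_swap_on[OF \<alpha> cl ct bt cb])
      have q: "{f \<in> E. \<beta> f = q} = {f \<in> E. \<alpha> f = q}" unfolding \<beta>_def by (rule class_swap_on[OF qc qb])
      have vS: "v \<notin> S" by (simp add: S_def)
      have mb: "miss \<beta> v b" using b vS by (simp add: miss')
      have col: "\<beta> {v, y} = \<alpha> {v, y}" if "y \<in> set ys" for y
        using swap_on_closed[OF cl fy(3)[OF that]] vS by (simp add: \<beta>_def)
      have m1: "miss \<beta> y (n y)" if "y \<in> set ys" "n y \<noteq> c" for y
        using that fy(4)[of y] nb[of y] by (auto simp: miss')
      have m2: "miss \<beta> y b" if "y \<in> set ys" "n y = c" "y \<in> S" for y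
        using that fy(4)[of y] by (simp add: miss')
      have m3: "miss \<beta> y c" if "y \<in> set ys" "n y = c" "y \<notin> S" for y
        using that fy(4)[of y] by (simp add: miss')
      have "v \<noteq> A" "v \<noteq> z" using fy(3)[OF zys] fy(3)[OF as_z(1)[OF A]] by auto
      then have AzS: "A \<in> S \<or> z \<in> S"
        using linked_ends[OF \<alpha> cb, of v A z] b fy(4)[OF zys] fy(4)[OF as_z(1)[OF A]] nA as_z(2)[OF A]
        by (auto simp: S_def c_def)
      show ?thesis
      proof (cases "A \<in> S")
        case True
        have "fan \<beta> v (n(A := b)) as b"
        proof (rule fan_transfer[OF fans(1)])
          show "miss \<beta> y ((n(A := b)) y)" if "y \<in> set as" for y
            using m1[of y] m2[OF _ nA True] nc[of y] as_z[OF that] by auto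
          show "\<beta> {v, y} = \<alpha> {v, y}" if "y \<in> set (tl as)" for y
            using col[of y] list.set_sel(2)[OF False that] ys by simp
        qed (auto simp: A_def)
        then show ?thesis using path[OF _ hdas mb eq q] by blast
      next
        case AS: False
        then have zS: "z \<in> S" using AzS by simp
        \<comment> \<open>Here \<open>A\<close> lies in the component of \<open>v\<close> and keeps
          missing \<open>c\<close>, so the fan remains intact up to \<open>z\<close>, which now
          misses \<open>b\<close>.\<close>
        have "fan \<beta> v (n(z := b)) ys b"
        proof (rule fan_transfer[OF fan])
          show "miss \<beta> y ((n(z := b)) y)" if "y \<in> set ys" for y
            using m1[of y] m2[OF zys _ zS] m3[OF as_z(1)[OF A] nA AS] nA nc[of y] that
            by (cases "y = z"; cases "n y = c") (auto simp: c_def)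
          show "\<beta> {v, y} = \<alpha> {v, y}" if "y \<in> set (tl ys)" for y
            using col[of y] list.set_sel(2)[OF fy(1) that] by simp
        qed (auto simp: z_def)
        then show ?thesis using path[OF _ hd mb eq q] by blast
      qed
    qed
  qed
qed

end

subsection \<open>Invertibility of cyclic fans\<close>

text \<open>The second assumption says that a triangle is a block: once its edges are deleted, no
  path joins two of its corners. Naming the corners in another order yields the other pairs.\<close>

locale block_graph = edge_graph +
  assumes miss_ex: "coloring \<alpha> \<Longrightarrow> \<exists>c. miss \<alpha> x c"
    and triangle_block: "{x, y} \<in> E \<Longrightarrow> {y, z} \<in> E \<Longrightarrow> {x, z} \<in> E \<Longrightarrow>
      \<not> (\<lambda>p q. {p, q} \<in> E - {{x, y}, {y, z}, {x, z}})\<^sup>*\<^sup>* x y"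
begin

text \<open>The chain from \<open>u\<close> to \<open>v\<close> avoids the edge
  \<open>{v, u}\<close>, and outside the triangle there is no way between its corners, so it must
  run along \<open>{u, w}\<close> and \<open>{w, v}\<close>. If \<open>{u, w}\<close> had a third
  color, the part \<open>R u\<close> attached to \<open>u\<close> would be closed; if
  \<open>{v, w}\<close> had one, \<open>R u\<close> together with \<open>R w\<close> would be.
  Neither set contains \<open>v\<close>.\<close>

lemma triangle_linked:
  assumes T: "{v, u} \<in> E" "{u, w} \<in> E" "{v, w} \<in> E"
    and l: "linked \<alpha> c d u v" and vu: "\<alpha> {v, u} \<noteq> c" "\<alpha> {v, u} \<noteq> d"
  shows "(\<alpha> {u, w} = c \<or> \<alpha> {u, w} = d) \<and> (\<alpha> {v, w} = c \<or> \<alpha> {v, w} = d)"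
proof -
  let ?r = "\<lambda>p q. {p, q} \<in> E - {{u, v}, {v, w}, {u, w}}"
  define R where "R p = {x. ?r\<^sup>*\<^sup>* p x}" for p
  have sym: "?r\<^sup>*\<^sup>* p q \<Longrightarrow> ?r\<^sup>*\<^sup>* q p" for p q
    by (rule sympD[OF symp_rtranclp]) (auto simp: symp_def insert_commute)
  have uv: "{u, v} \<in> E" "{u, v} = {v, u}" "{w, v} \<in> E" "{w, u} \<in> E" using T by (auto simp: insert_commute)
  have Ru: "v \<notin> R u" using triangle_block[OF uv(1) T(3,2)] by (simp add: R_def)
  have Ru': "w \<notin> R u"
    using triangle_block[OF T(2) uv(3,1)] by (simp add: R_def insert_commute)
  have Rw: "v \<notin> R w"
    using triangle_block[OF uv(3) T(1) uv(4)] by (simp add: R_def insert_commute)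
  have Rstep: "q \<in> R p" if "x \<in> R p" "{x, q} \<in> E" "{x, q} \<notin> {{u, v}, {v, w}, {u, w}}" for p q x
  proof -
    have "?r x q" using that(2,3) by simp
    with that(1) show ?thesis
      unfolding R_def mem_Collect_eq by (rule rtranclp.rtrancl_into_rtrancl)
  qed
  have R0: "p \<in> R p" for p by (simp add: R_def)
  have "\<alpha> {u, w} = c \<or> \<alpha> {u, w} = d"
  proof (rule ccontr)
    assume uw: "\<not> ?thesis"
    have "closed \<alpha> c d (R u)"
      unfolding closed_def
    proof (intro allI impI, elim conjE)
      fix x y assume xy: "x \<in> R u" "{x, y} \<in> E" "\<alpha> {x, y} = c \<or> \<alpha> {x, y} = d"
      have "{x, y} \<noteq> {u, v}" "{x, y} \<noteq> {u, w}" using xy(3) vu uw uv(2) by auto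
      moreover have "{x, y} \<noteq> {v, w}" using xy(1) Ru Ru' by (auto simp: doubleton_eq_iff)
      ultimately show "y \<in> R u" using Rstep[OF xy(1,2)] by simp
    qed
    then show False using linked_closed[OF l] R0 Ru by blast
  qed
  moreover have "\<alpha> {v, w} = c \<or> \<alpha> {v, w} = d"
  proof (rule ccontr)
    assume vw: "\<not> ?thesis"
    have "closed \<alpha> c d (R u \<union> R w)"
      unfolding closed_def
    proof (intro allI impI, elim conjE)
      fix x y assume xy: "x \<in> R u \<union> R w" "{x, y} \<in> E" "\<alpha> {x, y} = c \<or> \<alpha> {x, y} = d"
      have "{x, y} \<noteq> {u, v}" "{x, y} \<noteq> {v, w}" using xy(3) vu vw uv(2) by auto
      then consider "{x, y} = {u, w}" | "{x, y} \<notin> {{u, v}, {v, w}, {u, w}}" by auto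
      then show "y \<in> R u \<union> R w"
      proof cases
        case 1
        then show ?thesis using R0 by (auto simp: doubleton_eq_iff)
      next
        case 2
        then show ?thesis using Rstep[of x u y] Rstep[of x w y] xy by auto
      qed
    qed
    then show False using linked_closed[OF l] R0 Ru Rw by blast
  qed
  ultimately show ?thesis by simp
qed

text \<open>If the fan were not invertible, \<open>v\<close> would be linked to every leaf. A swap of \<open>b\<close> with another
  color outside the component of \<open>v\<close> therefore preserves the fan. Two such swaps turn the maximal
  fan from \<open>v\<close> at the leaf \<open>x\<close> into a path fan, to which \<open>cyclic_fan_invert_by_leaf\<close> applies.\<close>

lemma cyclic_fan_invertible:
  "coloring \<alpha> \<Longrightarrow> cyclic_fan \<alpha> v m us \<Longrightarrow> kempe_equiv \<alpha> (recolor v (set us) m \<alpha>)"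
proof (induction "length us" arbitrary: \<alpha> m us rule: less_induct)
  case less
  note \<alpha> = less.prems(1) and cyc = less.prems(2)
  obtain x rest where us: "us = x # rest" using cyclic_fanD(1)[OF cyc] by (cases us) auto
  consider "rest = []" | y where "rest = [y]" | "length rest \<ge> 2"
    by (cases rest; cases "tl rest") auto
  then show ?case
  proof cases
    case 1
    \<comment> \<open>The only leaf of such a fan would miss the color of its own spoke.\<close>
    then have "m x = \<alpha> {v, x}" "miss \<alpha> x (m x)" "{v, x} \<in> E"
      using cyc us by (auto simp: cyclic_fan_def fan_def)
    then show ?thesis using missD'[of \<alpha> x "m x" v] by simp
  next
    case 2
    then show ?thesis using cyclic_fan_two[OF \<alpha>] cyc us by simp
  next
    case 3
    then have ne: "rest \<noteq> []" by auto
    define bad where "bad \<beta> \<longleftrightarrow> coloring \<beta> \<and> cyclic_fan \<beta> v m us \<and>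
      \<not> kempe_equiv \<beta> (recolor v (set us) m \<beta>)" for \<beta>
    obtain b where b: "miss \<alpha> v b" using miss_ex[OF \<alpha>] by blast
    have linked_center: "linked \<beta> (m u) b u v" if "bad \<beta>" "miss \<beta> v b" "u \<in> set us" for \<beta> u
      using cyclic_fan_unlinked[of \<beta> v m us b u] that by (auto simp: bad_def)
    have linked_consecutive: "linked \<beta> (m (last rest)) (m x) (last rest) x" if "bad \<beta>" for \<beta>
    proof (rule ccontr)
      assume nl: "\<not> ?thesis"
      have "kempe_equiv \<beta> (recolor v (set (x # rest)) m \<beta>)"
        by (rule cyclic_fan_unlinked_consecutive[OF _ _ ne nl])
          (use that us less.hyps in \<open>auto simp: bad_def\<close>)
      then show False using that us by (simp add: bad_def)
    qed
    have xus: "x \<in> set us" by (simp add: us)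
    \<comment> \<open>Otherwise \<open>v\<close>, \<open>x\<close>, \<open>u\<close> form a
      triangle. The chain from \<open>x\<close> to \<open>v\<close> runs through \<open>u\<close>,
      so \<open>{v, u}\<close> has color \<open>m x\<close> and \<open>u\<close> follows
      \<open>x\<close> on the fan. By symmetry \<open>x\<close> follows \<open>u\<close>, so the fan
      would have only two leaves.\<close>
    have nonadjacent: "{x, u} \<notin> E" if bad: "bad \<beta>" "miss \<beta> v b" and u: "u \<in> set rest" for \<beta> u
    proof
      assume xu: "{x, u} \<in> E"
      have \<beta>: "coloring \<beta>" and c: "cyclic_fan \<beta> v m us" using bad by (auto simp: bad_def)
      note C = cyclic_fanD[OF c]
      have uus: "u \<in> set us" using u us by simp
      have ux: "{u, x} = {x, u}" by auto
      have "\<beta> {v, u} = m x \<or> \<beta> {v, u} = b"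
        using triangle_linked[OF C(3)[OF xus] xu C(3)[OF uus] linked_center[OF bad xus]]
          missD'[OF C(4)[OF xus] C(3)[OF xus]] missD[OF bad(2) C(3)[OF xus]] by simp
      then have 1: "\<beta> {v, u} = m x" using missD[OF bad(2) C(3)[OF uus]] by simp
      have "\<beta> {v, x} = m u \<or> \<beta> {v, x} = b"
        using triangle_linked[OF C(3)[OF uus] _ C(3)[OF xus] linked_center[OF bad uus]] xu ux
          missD'[OF C(4)[OF uus] C(3)[OF uus]] missD[OF bad(2) C(3)[OF uus]] by simp
      then have 2: "\<beta> {v, x} = m u" using missD[OF bad(2) C(3)[OF xus]] by simp
      have map: "map m (x # rest) = map (\<lambda>u. \<beta> {v, u}) rest @ [\<beta> {v, x}]"
        using c us by (simp add: cyclic_fan_def fan_def)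
      have "m x = \<beta> {v, hd rest}" using map ne by (cases rest) auto
      then have hd: "u = hd rest" using 1 col_inj[OF \<beta> C(3)[OF uus]] C(3)[of "hd rest"] us ne by auto
      have "last (map m (x # rest)) = \<beta> {v, x}" unfolding map by simp
      then have "m (last rest) = m u" using 2 ne by (simp add: last_map)
      then have "last rest = u"
        using inj_onD[OF cyclic_fan_inj[OF \<beta> c]] uus us ne by auto
      then show False using hd 3 C(2) us by (cases rest) (auto split: if_splits)
    qed
    have swap: "bad (swap_on c b {y. \<not> linked \<beta> c b v y} \<beta>)"
      "miss (swap_on c b {y. \<not> linked \<beta> c b v y} \<beta>) v b"
      if bad: "bad \<beta>" "miss \<beta> v b" and c: "c \<in> {1..t}" "c \<noteq> b" for \<beta> c
    proof -
      let ?S = "{y. \<not> linked \<beta> c b v y}"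
      have \<beta>: "coloring \<beta>" and cf: "cyclic_fan \<beta> v m us" using bad by (auto simp: bad_def)
      have bt: "b \<in> {1..t}" by (rule miss_range[OF bad(2)])
      have cl: "closed \<beta> c b ?S" by (rule closed_co_component)
      have mu: "m u \<noteq> c \<and> m u \<noteq> b" if "u \<in> set us" "u \<in> ?S" for u
        using linked_center[OF bad that(1)] linked_sym cyclic_fan_miss_center[OF cf bad(2) that(1)] that(2)
        by blast
      show "bad (swap_on c b ?S \<beta>)"
        using cyclic_fan_swap_on[OF \<beta> cf cl _ c(1) bt c(2)] mu bad coloring_swap_on[OF \<beta> cl c(1) bt]
        by (auto simp: bad_def)
      show "miss (swap_on c b ?S \<beta>) v b"
        using bad(2) by (simp add: miss_swap_on[OF cl c(1) bt c(2)])
    qed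
    have leaf: False if "bad \<beta>" "miss \<beta> v b" "fan \<beta> x n ys e" "hd ys = v" "miss \<beta> x e" for \<beta> n ys e
      using cyclic_fan_invert_by_leaf[of \<beta> v m x rest n ys e] nonadjacent[of \<beta>]
        linked_consecutive[of \<beta>] that ne us by (auto simp: bad_def)
    \<comment> \<open>With \<open>c = m x\<close>, the vertices \<open>x\<close> and
      \<open>v\<close> are the two ends of a \<open>(c, b)\<close>-chain, so the last leaf
      \<open>z\<close>, which misses \<open>b\<close>, is not on it. A swap away from
      \<open>v\<close> makes \<open>z\<close> miss \<open>c\<close>, which \<open>x\<close> misses
      as well, and the fan at \<open>x\<close> becomes a path fan.\<close>
    have leaf_b: False if bad: "bad \<beta>" "miss \<beta> v b" and fan: "fan \<beta> x n ys b" and ys: "hd ys = v" "last ys \<noteq> v"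
      and nv: "n v = b" for \<beta> n ys
    proof -
      have \<beta>: "coloring \<beta>" and cf: "cyclic_fan \<beta> v m us" using bad by (auto simp: bad_def)
      note C = cyclic_fanD[OF cf]
      define c z where "c = m x" and "z = last ys"
      have c: "c \<in> {1..t}" "c \<noteq> b" "miss \<beta> x c"
        using C(4)[OF xus] miss_range cyclic_fan_miss_center[OF cf bad(2) xus] by (auto simp: c_def)
      define S \<beta>' where "S = {y. \<not> linked \<beta> c b v y}" and "\<beta>' = swap_on c b S \<beta>"
      have cl: "closed \<beta> c b S" unfolding S_def by (rule closed_co_component)
      have bt: "b \<in> {1..t}" by (rule miss_range[OF bad(2)])
      note miss' = miss_swap_on[OF cl c(1) bt c(2), folded \<beta>'_def]
      have bad': "bad \<beta>'" "miss \<beta>' v b" using swap[OF bad c(1,2)] by (auto simp: \<beta>'_def S_def)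
      have xv: "linked \<beta> c b v x" using linked_center[OF bad xus] linked_sym by (simp add: c_def)
      have S: "x \<notin> S" "v \<notin> S" using xv by (auto simp: S_def)
      have fy: "ys \<noteq> []" "\<And>y. y \<in> set ys \<Longrightarrow> {x, y} \<in> E \<and> miss \<beta> y (n y)" using fan by (auto simp: fan_def)
      have z: "z \<in> set ys" "miss \<beta> z b" "z \<noteq> x" "z \<noteq> v"
        using fy(1) fy(2)[of z] fan_last[OF fan] ys fan_center[OF fan] by (auto simp: z_def)
      have "\<not> linked \<beta> c b v z"
        using linked_ends[OF \<beta> c(2), of v x z] bad(2) c(3) z xv C(6)[OF xus] by auto
      then have zS: "z \<in> S" by (simp add: S_def)
      have vb: "v \<in> set (butlast ys)" using ys fy(1) by (cases ys) (auto split: if_splits)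
      have "fan \<beta>' x (n(z := c)) ys c"
      proof (rule fan_transfer[OF fan])
        show "miss \<beta>' y ((n(z := c)) y)" if y: "y \<in> set ys" for y
        proof (cases "y = z")
          case True
          then show ?thesis using z zS by (simp add: miss')
        next
          case False
          then have yb: "y \<in> set (butlast ys)"
            using y fy(1) append_butlast_last_id[OF fy(1)] unfolding z_def
            by (metis Un_iff empty_iff list.set(1) set_ConsD set_append)
          obtain w where "w \<in> set (tl ys)" "n y = \<beta> {x, w}" using fan_next[OF fan yb] by blast
          then have "n y \<noteq> c" using missD[OF c(3)] fy list.set_sel(2)[OF fy(1)] by metis
          moreover have "y = v" if "n y = b" using fan_inj[OF \<beta> fan yb vb] that nv by simp
          ultimately show ?thesis using False fy(2)[OF y] S(2) by (auto simp: miss')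
        qed
        show "\<beta>' {x, u} = \<beta> {x, u}" if "u \<in> set (tl ys)" for u
          using swap_on_closed[OF cl, of x u] fy list.set_sel(2)[OF fy(1) that] S(1) by (simp add: \<beta>'_def)
      qed (auto simp: z_def)
      moreover have "miss \<beta>' x c" using c(3) S(1) by (simp add: miss')
      ultimately show False using leaf[OF bad' _ ys(1)] by blast
    qed
    show ?thesis
    proof (rule ccontr)
      assume "\<not> ?thesis"
      then have bad: "bad \<alpha>" using \<alpha> cyc by (simp add: bad_def)
      note C = cyclic_fanD[OF cyc]
      have vx: "{v, x} \<in> E" "{x, v} = {v, x}" using C(3)[OF xus] by auto
      define n where "n y = (if y = v then b else SOME c. miss \<alpha> y c)" for y
      have n: "miss \<alpha> y (n y)" for y using b someI_ex[OF miss_ex[OF \<alpha>]] by (simp add: n_def)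
      have nv: "n v = b" by (simp add: n_def)
      obtain ys where fan: "fan \<alpha> x n ys (n (last ys))" and hd: "hd ys = v"
        and max: "\<And>w. {x, w} \<in> E \<Longrightarrow> \<alpha> {x, w} = n (last ys) \<Longrightarrow> w \<in> set ys"
        using fan_maximal[of x v \<alpha> n] n vx by metis
      define z c where "z = last ys" and "c = n z"
      have fan: "fan \<alpha> x n ys c" using fan by (simp add: c_def z_def)
      have fy: "ys \<noteq> []" "distinct ys" "\<And>y. y \<in> set ys \<Longrightarrow> {x, y} \<in> E" using fan by (auto simp: fan_def)
      have "\<not> miss \<alpha> x c" using leaf[OF bad b fan hd] by blast
      then obtain w where w: "{x, w} \<in> E" "\<alpha> {x, w} = c"
        using miss_range[OF n[of z]] by (auto simp: miss_def c_def)
      have wys: "w \<in> set ys" using max w by (simp add: c_def z_def)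
      have "c \<noteq> b"
      proof
        assume "c = b"
        have "last ys \<noteq> v"
        proof
          assume "last ys = v"
          then have "ys = [v]" using hd fy(1,2) by (cases ys) (auto split: if_splits)
          then have "w = v" using wys by simp
          then show False using w \<open>c = b\<close> vx missD[OF b vx(1)] by simp
        qed
        then show False using leaf_b[OF bad b _ hd] nv fan \<open>c = b\<close> by simp
      qed
      have zv: "z \<noteq> v" using nv \<open>c \<noteq> b\<close> by (auto simp: c_def)
      have zys: "z \<in> set ys" using fy(1) by (simp add: z_def)
      have zx: "z \<noteq> x" using fy(3)[OF zys] by auto
      have ct: "c \<in> {1..t}" using miss_range[OF n[of z]] by (simp add: c_def)
      have bt: "b \<in> {1..t}" by (rule miss_range[OF b])
      have vb: "v \<in> set (butlast ys)" using hd fy(1) zv by (cases ys) (auto simp: z_def split: if_splits)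
      have butlast: "y \<in> set (butlast ys)" if "y \<in> set ys" "y \<noteq> z" for y
        using that fy(1) append_butlast_last_id[OF fy(1)] unfolding z_def
        by (metis Un_iff empty_iff list.set(1) set_ConsD set_append)
      have nb: "y = v" if "y \<in> set ys" "n y = b" for y
        using fan_inj[OF \<alpha> fan butlast vb] that nv \<open>c \<noteq> b\<close> by (auto simp: c_def)
      define S \<beta> where "S = {y. \<not> linked \<alpha> c b v y}" and "\<beta> = swap_on c b S \<alpha>"
      have cl: "closed \<alpha> c b S" unfolding S_def by (rule closed_co_component)
      note miss' = miss_swap_on[OF cl ct bt \<open>c \<noteq> b\<close>, folded \<beta>_def]
      have bad': "bad \<beta>" "miss \<beta> v b" using swap[OF bad b ct \<open>c \<noteq> b\<close>] by (auto simp: \<beta>_def S_def)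
      have vS: "v \<notin> S" by (simp add: S_def)
      have m1: "miss \<beta> y (n y)" if "y \<in> set ys" "n y \<noteq> c" for y
        using that n[of y] nb[of y] vS by (auto simp: miss')
      have m2: "miss \<beta> y b" if "n y = c" "y \<in> S" for y using that n[of y] by (simp add: miss')
      have m3: "miss \<beta> y c" if "n y = c" "y \<notin> S" for y using that n[of y] by (simp add: miss')
      have col: "\<beta> {x, u} = (if x \<in> S then (if \<alpha> {x, u} = c then b else if \<alpha> {x, u} = b then c else \<alpha> {x, u}) else \<alpha> {x, u})"
        if "u \<in> set ys" for u
        using swap_on_closed[OF cl fy(3)[OF that]] by (simp add: \<beta>_def)
      obtain as bs where ys: "ys = as @ w # bs" using wys by (meson split_list)
      have z_last: "z = last (w # bs)" by (simp add: z_def ys)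
      show False
      proof (cases "as = []")
        case True
        \<comment> \<open>The fan at \<open>x\<close> closes up at its first leaf \<open>v\<close>,
          so \<open>c\<close> is the color of \<open>{v, x}\<close>, which equals
          \<open>m (last rest)\<close>. Since \<open>v\<close> and \<open>last rest\<close> are the
          two ends of their \<open>(c, b)\<close>-chain, \<open>z\<close> is not on it and the swap
          makes \<open>z\<close> miss \<open>b\<close>.\<close>
        then have "w = v" using hd ys by simp
        then have c_eq: "c = \<alpha> {v, x}" using w vx by simp
        have "linked \<alpha> c b v x" using linked_edge[OF vx(1)] c_eq by blast
        then have xS: "x \<notin> S" by (simp add: S_def)
        have map: "map m (x # rest) = map (\<lambda>u. \<alpha> {v, u}) rest @ [\<alpha> {v, x}]"
          using cyc us by (simp add: cyclic_fan_def fan_def)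
        have "last (map m (x # rest)) = \<alpha> {v, x}" unfolding map by simp
        then have ml: "m (last rest) = c" using ne by (simp add: last_map c_eq)
        have lr: "last rest \<in> set us" "last rest \<in> set rest" using ne us by auto
        have "last rest \<noteq> z" using nonadjacent[OF bad b lr(2)] fy(3)[OF zys] by auto
        moreover have "linked \<alpha> c b v (last rest)" using linked_center[OF bad b lr(1)] ml linked_sym by simp
        ultimately have "\<not> linked \<alpha> c b v z"
          using linked_ends[OF \<alpha> \<open>c \<noteq> b\<close>, of v "last rest" z] b C(4)[OF lr(1)] ml n[of z] zv C(6)[OF lr(1)]
          by (auto simp: c_def)
        then have zS: "z \<in> S" by (simp add: S_def)
        have nc: "n y \<noteq> c" if y: "y \<in> set ys" "y \<noteq> z" for y
        proof
          assume "n y = c"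
          then obtain w' where w': "w' \<in> set (tl ys)" "c = \<alpha> {x, w'}"
            using fan_next[OF fan butlast[OF y]] by metis
          then have "w' = v"
            using col_inj[OF \<alpha> w(1), of w'] fy(3)[of w'] w(2) list.set_sel(2)[OF fy(1)] \<open>w = v\<close> by metis
          then show False using w'(1) ys True \<open>w = v\<close> fy(2) by simp
        qed
        have fan': "fan \<beta> x (n(z := b)) ys b"
          by (rule fan_transfer[OF fan])
            (use m1 m2[of z] nc zS col xS in \<open>auto simp: z_def c_def dest: list.set_sel(2)[OF fy(1)]\<close>)
        then show False using leaf_b[OF bad' fan' hd] zv nv by (simp add: z_def)
      next
        case False
        define A where "A = last as"
        have A: "A \<in> set as" using False by (simp add: A_def)
        have fans: "fan \<alpha> x n as c" "fan \<alpha> x n (w # bs) c" "set as \<inter> set (w # bs) = {}"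
          using fan w(2) fan_append_iff[OF False] unfolding ys by auto
        have "z \<in> set (w # bs)" unfolding z_last by (rule last_in_set) simp
        then have as_z: "y \<in> set ys" "y \<noteq> z" if "y \<in> set as" for y
          using that fans(3) ys by auto
        have nA: "n A = c" using fan_last[OF fans(1)] by (simp add: A_def)
        have Ays: "A \<in> set ys" "A \<noteq> z" using as_z[OF A] by auto
        have Av: "A \<noteq> v" using nA nv \<open>c \<noteq> b\<close> by auto
        have nc: "y = A" if "y \<in> set ys" "y \<noteq> z" "n y = c" for y
          using fan_inj[OF \<alpha> fan butlast butlast, of y A] that Ays nA by simp
        have hdas: "hd as = v" using hd ys False by simp
        have AzS: "A \<in> S \<or> z \<in> S"
          using linked_ends[OF \<alpha> \<open>c \<noteq> b\<close>, of v A z] b n[of A] n[of z] nA Ays Av zv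
          by (auto simp: S_def c_def)
        show False
        proof (cases "x \<in> S")
          case xS: False
          show False
          proof (cases "A \<in> S")
            case True
            have fan': "fan \<beta> x (n(A := b)) as b"
            proof (rule fan_transfer[OF fans(1)])
              show "miss \<beta> y ((n(A := b)) y)" if "y \<in> set as" for y
                using m1[of y] m2[OF nA True] nc[of y] as_z[OF that] by auto
              show "\<beta> {x, u} = \<alpha> {x, u}" if "u \<in> set (tl as)" for u
                using col[of u] xS list.set_sel(2)[OF False that] ys by simp
            qed (auto simp: A_def)
            then show False using leaf_b[OF bad' fan' hdas] Av nv by (simp add: A_def)
          next
            case AS: False
            then have zS: "z \<in> S" using AzS by simp
            have fan': "fan \<beta> x (n(z := b)) ys b"
            proof (rule fan_transfer[OF fan])
              show "miss \<beta> y ((n(z := b)) y)" if "y \<in> set ys" for y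
                using m1[of y] m2[OF _ zS] m3[OF nA AS] nA nc[of y] that
                by (cases "y = z"; cases "n y = c") (auto simp: c_def)
              show "\<beta> {x, u} = \<alpha> {x, u}" if "u \<in> set (tl ys)" for u
                using col[of u] xS list.set_sel(2)[OF fy(1) that] by simp
            qed (auto simp: z_def)
            then show False using leaf_b[OF bad' fan' hd] zv nv by (simp add: z_def)
          qed
        next
          case xS: True
          \<comment> \<open>The swap now exchanges the colors of two spokes at \<open>x\<close>:
            that of \<open>w\<close> turns from \<open>c\<close> into \<open>b\<close>, that of the
            second leaf \<open>y1\<close> from \<open>b\<close> into \<open>c\<close>. The fan is
            reassembled accordingly: from \<open>v\<close>, which misses \<open>b\<close>, to
            \<open>w\<close> and along \<open>bs\<close> to \<open>z\<close>; if \<open>z\<close>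
            still misses \<open>c\<close>, it continues with \<open>y1\<close> up to
            \<open>A\<close>, which then misses \<open>b\<close>.\<close>
          obtain as' where as': "as = v # as'" using hdas False by (cases as) auto
          obtain y1 as'' where as'': "as' = y1 # as''" using as' Av by (cases as') (auto simp: A_def)
          have fan_as: "fan \<alpha> x n (y1 # as'') c" and b_eq: "b = \<alpha> {x, y1}"
            using fans(1) fan_append_iff[of "[v]" \<alpha> x n y1 as'' c] nv unfolding as' as'' by (auto simp: fan_def)
          have dist: "distinct (v # (y1 # as'') @ w # bs)" using fy(2) unfolding ys as' as'' by simp
          have colw: "\<beta> {x, w} = b" using col[OF wys] xS w by simp
          have coly1: "\<beta> {x, y1} = c" using col[of y1] xS b_eq \<open>c \<noteq> b\<close> by (simp add: ys as' as'')
          have colo: "\<beta> {x, u} = \<alpha> {x, u}" if u: "u \<in> set ys" "u \<noteq> w" "u \<noteq> y1" for u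
          proof -
            have "\<alpha> {x, u} \<noteq> c" using u col_inj[OF \<alpha> fy(3)[OF u(1)] w(1)] w(2) by auto
            moreover have "\<alpha> {x, u} \<noteq> b"
              using u col_inj[OF \<alpha> fy(3)[OF u(1)], of y1] b_eq fy(3)[of y1] by (auto simp: ys as' as'')
            ultimately show ?thesis using col[OF u(1)] by simp
          qed
          have fan_v: "fan \<beta> x n' [v] (\<beta> {x, w})" if "n' v = b" for n'
            using colw vx bad'(2) that by (auto simp: fan_def)
          show False
          proof (cases "z \<in> S")
            case zS: True
            let ?n = "n(z := b)"
            have "fan \<beta> x ?n (w # bs) b"
            proof (rule fan_transfer[OF fans(2)])
              show "miss \<beta> y (?n y)" if "y \<in> set (w # bs)" for y
              proof -
                have "y \<in> set ys" "y \<noteq> A" using that ys A fans(3) by auto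
                then show ?thesis using m1[of y] m2[OF _ zS] nc[of y] by (auto simp: c_def)
              qed
              show "\<beta> {x, u} = \<alpha> {x, u}" if "u \<in> set (tl (w # bs))" for u
                using colo[of u] that dist ys by auto
            qed (auto simp: z_last)
            then have fan': "fan \<beta> x ?n ([v] @ w # bs) b"
              using fan_append_iff[of "[v]" \<beta> x ?n w bs b] fan_v[of ?n] zv nv dist by auto
            then show False using leaf_b[OF bad' fan'] zv nv z_last by simp
          next
            case zS: False
            then have AS: "A \<in> S" using AzS by simp
            let ?n = "n(A := b)"
            have A_last: "A = last (y1 # as'')" by (simp add: A_def as' as'')
            have f1: "fan \<beta> x ?n (w # bs) (\<beta> {x, y1})"
            proof (rule fan_transfer[OF fans(2)])
              show "miss \<beta> y (?n y)" if "y \<in> set (w # bs)" for y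
              proof -
                have "y \<in> set ys" "y \<noteq> A" using that ys A fans(3) by auto
                then show ?thesis using m1[of y] m3[OF _ zS] nc[of y]
                  by (cases "y = z"; cases "n y = c") (auto simp: c_def)
              qed
              show "\<beta> {x, u} = \<alpha> {x, u}" if "u \<in> set (tl (w # bs))" for u
                using colo[of u] that dist ys by auto
              show "?n u = n u" if "u \<in> set (w # bs)" for u using that A fans(3) by auto
              show "?n (last (w # bs)) = \<beta> {x, y1}"
                unfolding coly1 z_last[symmetric] using Ays(2) by (simp add: c_def)
            qed
            have f2: "fan \<beta> x ?n (y1 # as'') b"
            proof (rule fan_transfer[OF fan_as])
              show "miss \<beta> y (?n y)" if "y \<in> set (y1 # as'')" for y
              proof -
                have "y \<in> set as" using that by (simp add: as' as'')
                then have "y \<in> set ys" "y \<noteq> z" by (rule as_z)+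
                then show ?thesis using m1[of y] m2[OF nA AS] nc[of y] by auto
              qed
              show "\<beta> {x, u} = \<alpha> {x, u}" if "u \<in> set (tl (y1 # as''))" for u
                using colo[of u] that dist ys as' as'' by auto
            qed (auto simp: A_last)
            have f12: "fan \<beta> x ?n ((w # bs) @ y1 # as'') b"
              using fan_append_iff[of "w # bs" \<beta> x ?n y1 as'' b] f1 f2 dist by auto
            then have fan': "fan \<beta> x ?n ([v] @ w # (bs @ y1 # as'')) b"
              using fan_append_iff[of "[v]" \<beta> x ?n w "bs @ y1 # as''" b] fan_v[of ?n] Av nv dist by auto
            then show False using leaf_b[OF bad' fan'] Av nv A_last by simp
          qed
        qed
      qed
    qed
  qed
qed

subsection \<open>Making a matching a color class\<close>

text \<open>Inverting the cyclic fan that starts at \<open>u\<close> carries \<open>q\<close> from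
  its first spoke to its last one, whose leaf is assigned \<open>q\<close>. As \<open>n\<close> is
  left to the caller, so is the choice of the leaves at which \<open>q\<close> may land.\<close>

lemma move_color:
  assumes \<alpha>: "coloring \<alpha>" and e: "{v, u} \<in> E" "\<alpha> {v, u} = q"
    and n: "\<And>x. {v, x} \<in> E \<Longrightarrow> miss \<alpha> x (n x)"
  obtains (release) \<beta> where "kempe_equiv \<alpha> \<beta>" "{f \<in> E. \<beta> f = q} = {f \<in> E. \<alpha> f = q} - {{v, u}}"
    | (move) \<beta> s where "kempe_equiv \<alpha> \<beta>" "{v, s} \<in> E" "s \<noteq> u" "n s = q"
      "{f \<in> E. \<beta> f = q} = insert {v, s} ({f \<in> E. \<alpha> f = q} - {{v, u}})"
proof -
  obtain b where b: "miss \<alpha> v b" using miss_ex[OF \<alpha>] by blast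
  show thesis
  proof (rule release_or_cyclic[OF \<alpha> e(1) b])
    show "miss \<alpha> x (n x)" if "{v, x} \<in> E" for x by (rule n[OF that])
  next
    fix \<beta> assume "kempe_equiv \<alpha> \<beta>" "{f \<in> E. \<beta> f = \<alpha> {v, u}} = {f \<in> E. \<alpha> f = \<alpha> {v, u}} - {{v, u}}"
    then show thesis using release e(2) by simp
  next
    fix us assume cyclic: "cyclic_fan \<alpha> v n us" "hd us = u"
    note C = cyclic_fanD[OF cyclic(1)]
    have uus: "u \<in> set us" using C(1) cyclic(2) by auto
    define s where "s = last us"
    have s: "s \<in> set us" "n s = q"
      using C(1) fan_last cyclic e(2) unfolding cyclic_fan_def s_def by auto
    have inj: "inj_on n (set us)" by (rule cyclic_fan_inj[OF \<alpha> cyclic(1)])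
    have su: "s \<noteq> u" using missD'[OF C(4)[OF uus] e(1)] s e(2) by auto
    show thesis
    proof (rule move)
      show "kempe_equiv \<alpha> (recolor v (set us) n \<alpha>)" by (rule cyclic_fan_invertible[OF \<alpha> cyclic(1)])
      show "{v, s} \<in> E" "s \<noteq> u" "n s = q" using C(3) s su by auto
      show "{f \<in> E. recolor v (set us) n \<alpha> f = q} = insert {v, s} ({f \<in> E. \<alpha> f = q} - {{v, u}})"
        (is "_ = ?B")
      proof (rule class_eqI)
        have Rv: "recolor v (set us) n \<alpha> {v, y} = q \<longleftrightarrow> {v, y} \<in> ?B" if "{v, y} \<in> E" for y
        proof -
          have 1: "n y = q \<longleftrightarrow> y = s" if "y \<in> set us" using inj_onD[OF inj] s that by auto
          have 2: "\<alpha> {v, y} = q \<longleftrightarrow> y = u" using col_inj[OF \<alpha> that e(1)] e(2) by auto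
          show ?thesis
            using 1 2 C(5) s(1) su uus that by (auto simp: recolor_edge doubleton_eq_iff)
        qed
        fix x y assume xy: "{x, y} \<in> E"
        have yx: "{y, x} = {x, y}" by auto
        consider "x = v" | "y = v" | "x \<noteq> v" "y \<noteq> v" by auto
        then show "recolor v (set us) n \<alpha> {x, y} = q \<longleftrightarrow> {x, y} \<in> ?B"
        proof cases
          case 3
          then show ?thesis using xy by (auto simp: recolor_apart' doubleton_eq_iff)
        qed (use Rv[of x] Rv[of y] xy yx in auto)
      next
        show "?B \<subseteq> E" using C(3) s(1) by auto
      qed
    qed
  qed
qed

text \<open>The symmetric difference of \<open>M\<close> and the class of \<open>q\<close> shrinks. The crucial case is an edge \<open>{x, x'}\<close>
  of \<open>M\<close> with \<open>x\<close> missing \<open>q\<close> and \<open>{x', y}\<close> colored \<open>q\<close>: the color \<open>q\<close> is moved along a fan at the far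
  end \<open>y\<close>, which frees both ends of \<open>{x, x'}\<close> unless \<open>x\<close>, \<open>x'\<close>, \<open>y\<close> form a triangle.\<close>

lemma class_progress:
  assumes \<alpha>: "coloring \<alpha>" and M: "M \<subseteq> E" and matching: "\<And>e f. e \<in> M \<Longrightarrow> f \<in> M \<Longrightarrow> e \<inter> f \<noteq> {} \<Longrightarrow> e = f"
    and q: "q \<in> {1..t}" and uncovered: "\<And>x. x \<notin> \<Union>M \<Longrightarrow> \<exists>c. miss \<alpha> x c \<and> c \<noteq> q"
    and neq: "{e \<in> E. \<alpha> e = q} \<noteq> M"
  obtains (descent) \<beta> where "kempe_equiv \<alpha> \<beta>"
    "card ({e \<in> E. \<beta> e = q} - M) + card (M - {e \<in> E. \<beta> e = q}) <
     card ({e \<in> E. \<alpha> e = q} - M) + card (M - {e \<in> E. \<alpha> e = q})"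
proof -
  define Q where "Q \<beta> = {e \<in> E. \<beta> e = q}" for \<beta> :: "'a set \<Rightarrow> nat"
  have fin: "finite (Q \<beta>)" "finite M" for \<beta> using finite_E M by (auto simp: Q_def intro: finite_subset)
  have better: thesis if "kempe_equiv \<alpha> \<beta>" "card (Q \<beta> - M) \<le> card (Q \<alpha> - M)" "card (M - Q \<beta>) \<le> card (M - Q \<alpha>)"
    "card (Q \<beta> - M) < card (Q \<alpha> - M) \<or> card (M - Q \<beta>) < card (M - Q \<alpha>)" for \<beta>
    by (rule descent[OF that(1)]) (use that(2-4) in \<open>auto simp: Q_def\<close>)
  have better_release: thesis if "kempe_equiv \<alpha> \<beta>" "Q \<beta> = Q \<alpha> - {e}" "e \<in> Q \<alpha> - M" for \<beta> e
  proof (rule better[OF that(1)])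
    have "Q \<beta> - M \<subset> Q \<alpha> - M" "M - Q \<beta> = M - Q \<alpha>" using that(2,3) by auto
    then show "card (Q \<beta> - M) \<le> card (Q \<alpha> - M)" "card (M - Q \<beta>) \<le> card (M - Q \<alpha>)"
      "card (Q \<beta> - M) < card (Q \<alpha> - M) \<or> card (M - Q \<beta>) < card (M - Q \<alpha>)"
      using fin by (auto intro: psubset_card_mono card_mono)
  qed
  have better_gain: thesis if "kempe_equiv \<alpha> \<beta>" "card (Q \<beta> - M) \<le> card (Q \<alpha> - M)" "f \<in> M - Q \<alpha>"
    "M - Q \<beta> \<subseteq> (M - Q \<alpha>) - {f}" for \<beta> f
  proof (rule better[OF that(1,2)])
    have "M - Q \<beta> \<subset> M - Q \<alpha>" using that(3,4) by auto
    then have "card (M - Q \<beta>) < card (M - Q \<alpha>)" using fin by (intro psubset_card_mono) auto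
    then show "card (M - Q \<beta>) \<le> card (M - Q \<alpha>)"
      "card (Q \<beta> - M) < card (Q \<alpha> - M) \<or> card (M - Q \<beta>) < card (M - Q \<alpha>)"
      by auto
  qed
  show thesis
  proof (cases "\<exists>x x'. {x, x'} \<in> M - Q \<alpha> \<and> miss \<alpha> x q")
    case True
    then obtain x x' where bad: "{x, x'} \<in> M - Q \<alpha>" and xq: "miss \<alpha> x q" by blast
    have xE: "{x, x'} \<in> E" using bad M by auto
    have xx: "{x', x} = {x, x'}" by auto
    show thesis
    proof (cases "miss \<alpha> x' q")
      case True
      let ?\<beta> = "recolor x {x'} (\<lambda>_. q) \<alpha>"
      have "Q ?\<beta> = insert {x, x'} (Q \<alpha>)"
        unfolding Q_def class_recolor_single[OF xE] by simp
      then have "Q ?\<beta> - M = Q \<alpha> - M" "M - Q ?\<beta> \<subseteq> (M - Q \<alpha>) - {{x, x'}}" using bad by auto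
      then show thesis
        using better_gain[OF kempe_equiv_recolor_single[OF \<alpha> xE xq True] _ bad] by simp
    next
      case False
      then obtain y where y: "{x', y} \<in> E" "\<alpha> {x', y} = q" using q by (auto simp: miss_def)
      have yx': "{y, x'} = {x', y}" by auto
      have xy: "x \<noteq> y" using y xx bad xE by (auto simp: Q_def)
      have x'y: "x' \<noteq> y" "x \<noteq> x'" using y xE by auto
      have ugly: "{x', y} \<in> Q \<alpha> - M"
        using y matching[of "{x', y}" "{x, x'}"] bad by (auto simp: Q_def)
      obtain n where n: "miss \<alpha> x (n x)" for x using miss_ex[OF \<alpha>] by metis
      show thesis
      proof (rule move_color[OF \<alpha>, of y x' q n])
        show "{y, x'} \<in> E" "\<alpha> {y, x'} = q" using y unfolding yx' by auto
        show "miss \<alpha> x (n x)" for x by (rule n)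
      next
        fix \<beta> assume "kempe_equiv \<alpha> \<beta>" "{f \<in> E. \<beta> f = q} = {f \<in> E. \<alpha> f = q} - {{y, x'}}"
        then show thesis using better_release[OF _ _ ugly] unfolding yx' by (simp add: Q_def)
      next
        fix \<beta> s assume eq: "kempe_equiv \<alpha> \<beta>" and s: "{y, s} \<in> E" "s \<noteq> x'" "n s = q"
          and cl: "{f \<in> E. \<beta> f = q} = insert {y, s} ({f \<in> E. \<alpha> f = q} - {{y, x'}})"
        have \<beta>: "coloring \<beta>" by (rule kempe_equiv_coloring[OF eq])
        have Q\<beta>: "Q \<beta> = insert {y, s} (Q \<alpha> - {{x', y}})" using cl unfolding yx' by (simp add: Q_def)
        show thesis
        proof (cases "s = x")
          case sx: False
          \<comment> \<open>After the move both \<open>x\<close> and \<open>x'\<close> miss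
            \<open>q\<close>, so \<open>{x, x'}\<close> can take it. The edge \<open>{y, s}\<close>
            may lie outside \<open>M\<close>, but it replaces \<open>{x', y}\<close>, so the first
            summand of the measure does not grow.\<close>
          have \<beta>_iff: "\<beta> e = q \<longleftrightarrow> e = {y, s} \<or> (\<alpha> e = q \<and> e \<noteq> {x', y})" if "e \<in> E" for e
          proof -
            have "\<beta> e = q \<longleftrightarrow> e \<in> Q \<beta>" using that by (simp add: Q_def)
            then show ?thesis unfolding Q\<beta> using that by (simp add: Q_def)
          qed
          have "\<beta> {x, w} \<noteq> q" if w: "{x, w} \<in> E" for w
            using \<beta>_iff[OF w] missD[OF xq w] xy sx by (auto simp: doubleton_eq_iff)
          then have m1: "miss \<beta> x q" using q by (auto simp: miss_def)
          have "\<beta> {x', w} \<noteq> q" if w: "{x', w} \<in> E" for w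
          proof
            assume "\<beta> {x', w} = q"
            then have "\<alpha> {x', w} = q" "{x', w} \<noteq> {x', y}"
              using \<beta>_iff[OF w] x'y s(2) by (auto simp: doubleton_eq_iff)
            then show False using col_inj[OF \<alpha> w y(1)] y(2) by auto
          qed
          then have m2: "miss \<beta> x' q" using q by (auto simp: miss_def)
          let ?\<gamma> = "recolor x {x'} (\<lambda>_. q) \<beta>"
          have "Q ?\<gamma> = insert {x, x'} (Q \<beta>)"
            unfolding Q_def class_recolor_single[OF xE] by simp
          then have Q\<gamma>: "Q ?\<gamma> = insert {x, x'} (insert {y, s} (Q \<alpha> - {{x', y}}))" using Q\<beta> by simp
          then have "Q ?\<gamma> - M \<subseteq> insert {y, s} ((Q \<alpha> - M) - {{x', y}})" using bad by auto
          then have "card (Q ?\<gamma> - M) \<le> card (insert {y, s} ((Q \<alpha> - M) - {{x', y}}))"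
            using fin by (intro card_mono) auto
          also have "\<dots> \<le> Suc (card ((Q \<alpha> - M) - {{x', y}}))" by (rule card_insert_le_m1) (auto simp: card_insert_if fin)
          also have "\<dots> = card (Q \<alpha> - M)" using fin ugly by (intro card.remove[symmetric]) auto
          finally show thesis
            using better_gain[OF kempe_equiv_trans[OF eq kempe_equiv_recolor_single[OF \<beta> xE m1 m2]] _ bad] Q\<gamma> ugly by auto
        next
          case True
          then have yx: "{y, x} \<in> E" using s by simp
          \<comment> \<open>The color would land on \<open>{y, x}\<close>, where it blocks
            \<open>x\<close>. The move is given up, and the triangle \<open>x\<close>,
            \<open>x'\<close>, \<open>y\<close> is treated directly in \<open>\<alpha>\<close>:
            either \<open>{x', y}\<close> can be recolored with \<open>b\<close>, possibly after a
            swap at \<open>x'\<close>, or the linkage of \<open>x'\<close> and \<open>y\<close>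
            determines the color of \<open>{x, x'}\<close>.\<close>
          obtain a where a: "miss \<alpha> x' a" using miss_ex[OF \<alpha>] by blast
          obtain b where b: "miss \<alpha> y b" using miss_ex[OF \<alpha>] by blast
          have aq: "a \<noteq> q" and bq: "b \<noteq> q" using missD[OF a y(1)] missD'[OF b y(1)] y(2) by auto
          have at: "a \<in> {1..t}" and bt: "b \<in> {1..t}" using miss_range a b by auto
          have common: thesis if "kempe_equiv \<alpha> \<beta>'" "Q \<beta>' = Q \<alpha>" "miss \<beta>' x' b" "miss \<beta>' y b" for \<beta>'
          proof (rule better_release[OF _ _ ugly])
            show "kempe_equiv \<alpha> (recolor x' {y} (\<lambda>_. b) \<beta>')"
              using kempe_equiv_trans[OF that(1) kempe_equiv_recolor_single[OF kempe_equiv_coloring[OF that(1)] y(1) that(3,4)]] .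
            show "Q (recolor x' {y} (\<lambda>_. b) \<beta>') = Q \<alpha> - {{x', y}}"
              using class_recolor_single[OF y(1), of b \<beta>' q] bq that(2) by (simp add: Q_def)
          qed
          show thesis
          proof (cases "linked \<alpha> a b x' y")
            case False
            show thesis
            proof (cases "a = b")
              case True
              then show thesis using common[OF kempe_equiv_refl[OF \<alpha>]] a b by simp
            next
              case neq: False
              define S where "S = {z. linked \<alpha> a b x' z}"
              have clS: "closed \<alpha> a b S" unfolding S_def by (rule closed_component)
              have S: "x' \<in> S" "y \<notin> S" using False by (auto simp: S_def)
              note miss' = miss_swap_on[OF clS at bt neq]
              show thesis
              proof (rule common[OF kempe_equiv_swap_on[OF \<alpha> clS at bt neq]])
                show "Q (swap_on a b S \<alpha>) = Q \<alpha>"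
                  unfolding Q_def by (rule class_swap_on) (use aq bq in auto)
                show "miss (swap_on a b S \<alpha>) x' b" "miss (swap_on a b S \<alpha>) y b"
                  using S a b neq by (auto simp: miss')
              qed
            qed
          next
            case True
            define c where "c = \<alpha> {x, x'}"
            \<comment> \<open>The chain from \<open>x'\<close> to \<open>y\<close> has to use
              \<open>{x', x}\<close>, and \<open>x'\<close> misses \<open>a\<close>, so this edge
              has color \<open>b\<close>. Since \<open>x\<close> misses \<open>q\<close> and
              \<open>y\<close> misses \<open>b\<close>, the vertices \<open>x\<close>,
              \<open>x'\<close>, \<open>y\<close> form a whole \<open>(q, b)\<close>-component, and
              swapping it carries \<open>q\<close> from \<open>{x', y}\<close> to
              \<open>{x, x'}\<close>.\<close>
            have "\<alpha> {x', x} = a \<or> \<alpha> {x', x} = b"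
              using triangle_linked[OF _ _ yx True] y aq bq xE xx yx' by auto
            then have cb: "c = b" using missD[OF a, of x] xE xx by (auto simp: c_def)
            have yc: "miss \<alpha> y c" using b cb by simp
            have qc: "q \<noteq> c" using bq cb by simp
            have ct: "c \<in> {1..t}" using bt cb by simp
            have at_x: "w = x'" if "{x, w} \<in> E" "\<alpha> {x, w} = q \<or> \<alpha> {x, w} = c" for w
              using that missD[OF xq that(1)] col_inj[OF \<alpha> that(1) xE] by (auto simp: c_def)
            have at_x': "w = x \<or> w = y" if "{x', w} \<in> E" "\<alpha> {x', w} = q \<or> \<alpha> {x', w} = c" for w
              using that col_inj[OF \<alpha> that(1) y(1)] col_inj[OF \<alpha> that(1), of x] xE y(2) unfolding c_def xx by auto
            have at_y: "w = x'" if "{y, w} \<in> E" "\<alpha> {y, w} = q \<or> \<alpha> {y, w} = c" for w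
              using that missD[OF yc that(1)] col_inj[OF \<alpha> that(1), of x'] y unfolding yx' by auto
            define S where "S = {x, x', y}"
            have clS: "closed \<alpha> q c S"
              unfolding closed_def S_def using at_x at_x' at_y by blast
            let ?\<beta> = "swap_on q c S \<alpha>"
            have "Q ?\<beta> = insert {x, x'} (Q \<alpha> - {{x', y}})"
              unfolding Q_def
            proof (rule class_eqI)
              fix p r assume pr: "{p, r} \<in> E"
              have rp: "{r, p} = {p, r}" by auto
              have *: "?\<beta> {p, r} = q \<longleftrightarrow> (if p \<in> S then \<alpha> {p, r} = c else \<alpha> {p, r} = q)"
                using swap_on_closed[OF clS pr] qc by auto
              have c1: "{p, r} = {x, x'}" if "p \<in> S" "\<alpha> {p, r} = c"
              proof -
                have "p = x \<or> p = x' \<or> p = y" using that(1) by (simp add: S_def)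
                moreover have "p \<noteq> y" using missD[OF yc] pr that(2) by blast
                moreover have "r = x'" if "p = x" using at_x pr \<open>\<alpha> {p, r} = c\<close> that by blast
                moreover have "r = x" if "p = x'"
                  using at_x'[of r] pr \<open>\<alpha> {p, r} = c\<close> that y(2) qc by auto
                ultimately show ?thesis by auto
              qed
              have c2: "{p, r} = {x', y}" if "p \<in> S" "\<alpha> {p, r} = q"
              proof -
                have "p = x \<or> p = x' \<or> p = y" using that(1) by (simp add: S_def)
                moreover have "p \<noteq> x" using missD[OF xq] pr that(2) by blast
                moreover have "r = x'" if "p = y" using at_y pr \<open>\<alpha> {p, r} = q\<close> that by blast
                moreover have "r = y" if "p = x'"
                  using at_x'[of r] pr \<open>\<alpha> {p, r} = q\<close> that xx qc by (auto simp: c_def)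
                ultimately show ?thesis by auto
              qed
              have c3: "p \<in> S" if "{p, r} = {x, x'} \<or> {p, r} = {x', y}"
                using that by (auto simp: S_def doubleton_eq_iff)
              show "?\<beta> {p, r} = q \<longleftrightarrow> {p, r} \<in> insert {x, x'} ({e \<in> E. \<alpha> e = q} - {{x', y}})"
              proof -
                have neq: "{x, x'} \<noteq> {x', y}" using xy by (auto simp: doubleton_eq_iff)
                consider (gain) "{p, r} = {x, x'}" | (lose) "{p, r} = {x', y}"
                  | (other) "{p, r} \<noteq> {x, x'}" "{p, r} \<noteq> {x', y}" by blast
                then show ?thesis
                proof cases
                  case gain
                  then show ?thesis unfolding * using c3 by (simp add: c_def)
                next
                  case lose
                  then show ?thesis unfolding * using c3 neq y(2) qc by simp
                next
                  case other
                  then have "?\<beta> {p, r} = q \<longleftrightarrow> \<alpha> {p, r} = q" unfolding * using c1 c2 by (cases "p \<in> S") auto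
                  then show ?thesis using other pr by blast
                qed
              qed
            qed (use xE in auto)
            then have "Q ?\<beta> - M \<subseteq> Q \<alpha> - M" "M - Q ?\<beta> \<subseteq> (M - Q \<alpha>) - {{x, x'}}"
              using bad ugly by auto
            then show thesis
              using better_gain[OF kempe_equiv_swap_on[OF \<alpha> clS q ct qc] _ bad] fin by (simp add: card_mono)
          qed
        qed
      qed
    qed
  next
    case covered: False
    show thesis
    proof (cases "Q \<alpha> \<subseteq> M")
      case False
      then obtain e where e: "e \<in> Q \<alpha> - M" by auto
      then obtain v u where vu: "e = {v, u}" using edgeE[of e] by (auto simp: Q_def)
      \<comment> \<open>With this choice \<open>q\<close> could only land at an end \<open>s\<close>
        of an edge of \<open>M\<close>. Then \<open>s\<close> misses \<open>q\<close>, so that edge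
        is not yet colored \<open>q\<close>, which is the situation excluded by
        \<open>covered\<close>.\<close>
      define n where "n x = (if x \<in> \<Union>M then SOME c. miss \<alpha> x c else SOME c. miss \<alpha> x c \<and> c \<noteq> q)" for x
      have n: "miss \<alpha> x (n x)" "x \<notin> \<Union>M \<Longrightarrow> n x \<noteq> q" for x
        using someI_ex[OF miss_ex[OF \<alpha>, of x]] someI_ex[OF uncovered, of x] by (auto simp: n_def)
      show thesis
      proof (rule move_color[OF \<alpha>, of v u q n])
        show "{v, u} \<in> E" "\<alpha> {v, u} = q" using e vu by (auto simp: Q_def)
        show "miss \<alpha> x (n x)" for x by (rule n)
      next
        fix \<beta> assume "kempe_equiv \<alpha> \<beta>" "{f \<in> E. \<beta> f = q} = {f \<in> E. \<alpha> f = q} - {{v, u}}"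
        then show thesis using better_release[OF _ _ e] vu by (simp add: Q_def)
      next
        fix \<beta> s assume s: "n s = q"
        then have "s \<in> \<Union>M" using n(2) by blast
        then obtain f where f: "f \<in> M" "s \<in> f" by auto
        then obtain s' where s': "f = {s, s'}" using edgeE[of f] M by auto
        have sq: "miss \<alpha> s q" using n(1)[of s] s by simp
        then have "f \<notin> Q \<alpha>" using missD[OF sq, of s'] s' by (auto simp: Q_def)
        then show thesis using covered f s' sq by blast
      qed
    next
      case True
      then obtain f where f: "f \<in> M - Q \<alpha>" using neq by (auto simp: Q_def)
      then obtain x x' where x: "f = {x, x'}" using edgeE[of f] M by auto
      have "miss \<alpha> x q"
        unfolding miss_def
      proof (intro conjI allI impI q notI)
        fix w assume w: "{x, w} \<in> E" "\<alpha> {x, w} = q"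
        then have wQ: "{x, w} \<in> Q \<alpha>" by (simp add: Q_def)
        then have "{x, w} = f" using matching[of "{x, w}" f] True f x by auto
        then show False using wQ f by simp
      qed
      then show thesis using covered f x by blast
    qed
  qed
qed

lemma class_reachable:
  assumes M: "M \<subseteq> E" and matching: "\<And>e f. e \<in> M \<Longrightarrow> f \<in> M \<Longrightarrow> e \<inter> f \<noteq> {} \<Longrightarrow> e = f"
    and q: "q \<in> {1..t}"
    and uncovered: "\<And>\<alpha> x. coloring \<alpha> \<Longrightarrow> x \<notin> \<Union>M \<Longrightarrow> \<exists>c. miss \<alpha> x c \<and> c \<noteq> q"
    and \<alpha>: "coloring \<alpha>"
  shows "\<exists>\<beta>. kempe_equiv \<alpha> \<beta> \<and> {e \<in> E. \<beta> e = q} = M"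
  using \<alpha>
proof (induction "card ({e \<in> E. \<alpha> e = q} - M) + card (M - {e \<in> E. \<alpha> e = q})" arbitrary: \<alpha> rule: less_induct)
  case less
  show ?case
  proof (cases "{e \<in> E. \<alpha> e = q} = M")
    case True
    then show ?thesis using kempe_equiv_refl[OF less.prems] by blast
  next
    case False
    obtain \<beta> where \<beta>: "kempe_equiv \<alpha> \<beta>"
      "card ({e \<in> E. \<beta> e = q} - M) + card (M - {e \<in> E. \<beta> e = q}) <
       card ({e \<in> E. \<alpha> e = q} - M) + card (M - {e \<in> E. \<alpha> e = q})"
      by (rule class_progress[OF less.prems M matching q uncovered[OF less.prems] False])
    then show ?thesis using less.hyps[OF \<beta>(2) kempe_equiv_coloring[OF \<beta>(1)]] kempe_equiv_trans[OF \<beta>(1)] by blast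
  qed
qed

end

subsection \<open>Induction on the number of colors\<close>

definition triangles_are_blocks :: "'a set set \<Rightarrow> bool" where
  "triangles_are_blocks E \<longleftrightarrow>
     (\<forall>x y z. {x, y} \<in> E \<and> {y, z} \<in> E \<and> {x, z} \<in> E \<longrightarrow>
       \<not> (\<lambda>p q. {p, q} \<in> E - {{x, y}, {y, z}, {x, z}})\<^sup>*\<^sup>* x y)"

lemma triangles_are_blocks_mono:
  assumes "triangles_are_blocks E" "F \<subseteq> E"
  shows "triangles_are_blocks F"
  unfolding triangles_are_blocks_def
proof (intro allI impI notI, elim conjE)
  fix x y z
  assume xyz: "{x, y} \<in> F" "{y, z} \<in> F" "{x, z} \<in> F"
  assume "(\<lambda>p q. {p, q} \<in> F - {{x, y}, {y, z}, {x, z}})\<^sup>*\<^sup>* x y"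
  then have "(\<lambda>p q. {p, q} \<in> E - {{x, y}, {y, z}, {x, z}})\<^sup>*\<^sup>* x y"
    by (rule rtranclp_mono[THEN predicate2D, rotated]) (use assms(2) in auto)
  then show False using assms xyz by (auto simp: triangles_are_blocks_def)
qed

text \<open>The edges of \<open>M\<close> have the color \<open>Suc k\<close>, which no chain of
  \<open>E - M\<close> uses. So for two smaller colors the two-colored subgraphs of \<open>E\<close>
  and \<open>E - M\<close> coincide, and every Kempe change lifts verbatim.\<close>

lemma K_equivalent_extend:
  assumes "M \<subseteq> E" "K_equivalent (E - M) k \<phi> \<psi>"
    and matching: "\<And>e f. e \<in> M \<Longrightarrow> f \<in> M \<Longrightarrow> e \<inter> f \<noteq> {} \<Longrightarrow> e = f"
  shows "K_equivalent E (Suc k) (\<lambda>e. if e \<in> M then Suc k else \<phi> e) (\<lambda>e. if e \<in> M then Suc k else \<psi> e)"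
  using assms(2) unfolding K_equivalent_def
proof (induction rule: rtranclp_induct)
  case base
  then show ?case by simp
next
  case (step \<psi> \<chi>)
  let ?ext = "\<lambda>\<phi> e. if e \<in> M then Suc k else \<phi> e"
  obtain c d C where *: "edge_coloring (E - M) k \<psi>" "c \<in> {1..k}" "d \<in> {1..k}" "c \<noteq> d"
    "kempe_chain (E - M) \<psi> c d C" "\<chi> = kempe_swap \<psi> c d C"
    using step.hyps(2) by (auto simp: kempe_step_def)
  have edges: "kempe_edges E (?ext \<psi>) c d = kempe_edges (E - M) \<psi> c d"
    using *(2,3) by (auto simp: kempe_edges_def)
  then have adj: "kempe_adj E (?ext \<psi>) c d = kempe_adj (E - M) \<psi> c d"
    by (simp add: kempe_adj_def)
  have chain: "kempe_chain E (?ext \<psi>) c d C"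
    using *(5) by (simp add: kempe_chain_def edges adj)
  have "C \<subseteq> E - M"
  proof
    fix f assume "f \<in> C"
    then obtain e where "e \<in> kempe_edges (E - M) \<psi> c d" "(e, f) \<in> (kempe_adj (E - M) \<psi> c d)\<^sup>*"
      using *(5) by (auto simp: kempe_chain_def)
    from this(2,1) show "f \<in> E - M"
      by (cases rule: rtranclE) (auto simp: kempe_adj_def kempe_edges_def)
  qed
  then have "?ext \<chi> = kempe_swap (?ext \<psi>) c d C"
    by (intro ext) (auto simp: *(6) kempe_swap_def)
  moreover have "edge_coloring E (Suc k) (?ext \<psi>)"
    unfolding edge_coloring_def
  proof (intro conjI ballI allI impI)
    have range: "\<psi> e \<in> {1..k}" if "e \<in> E - M" for e
      using that *(1) by (auto simp: edge_coloring_def)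
    show "?ext \<psi> e \<in> {1..Suc k}" if "e \<in> E" for e using range[of e] that by auto
    show "?ext \<psi> e = 0" if "e \<notin> E" for e using that *(1) assms(1) by (auto simp: edge_coloring_def)
    show "?ext \<psi> e \<noteq> ?ext \<psi> f" if "e \<in> E" "f \<in> E" "e \<noteq> f \<and> e \<inter> f \<noteq> {}" for e f
    proof -
      have "\<psi> e \<noteq> \<psi> f" if "e \<notin> M" "f \<notin> M"
        using that \<open>e \<in> E\<close> \<open>f \<in> E\<close> \<open>e \<noteq> f \<and> e \<inter> f \<noteq> {}\<close> *(1) by (auto simp: edge_coloring_def)
      moreover have "\<psi> g \<noteq> Suc k" if "g \<in> E - M" for g using range[OF that] by auto
      ultimately show ?thesis using that matching[of e f] by (metis DiffI)
    qed
  qed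
  ultimately have "kempe_step E (Suc k) (?ext \<psi>) (?ext \<chi>)"
    unfolding kempe_step_def using chain *(2-4)
    by (intro conjI exI[of _ c] exI[of _ d] exI[of _ C]) auto
  then show ?case using step.IH by (rule rtranclp.rtrancl_into_rtrancl[rotated])
qed

lemma edge_coloring_restrict:
  assumes "edge_coloring E (Suc k) \<alpha>" "{e \<in> E. \<alpha> e = Suc k} = M"
  shows "edge_coloring (E - M) k (\<lambda>e. if e \<in> M then 0 else \<alpha> e)"
proof -
  have "\<alpha> e \<in> {1..k}" if "e \<in> E - M" for e
  proof -
    have "\<alpha> e \<in> {1..Suc k}" using assms(1) that by (auto simp: edge_coloring_def)
    moreover have "\<alpha> e \<noteq> Suc k" using assms(2) that by auto
    ultimately show ?thesis by auto
  qed
  then show ?thesis using assms(1) by (auto simp: edge_coloring_def)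
qed

text \<open>The coloring \<open>\<gamma>\<close> bounds the degree: its colors are distinct on the
  edges at \<open>x\<close> and lie in \<open>{1..j}\<close>, so at most \<open>j\<close> edges meet
  \<open>x\<close>. Hence the colors of \<open>\<alpha>\<close> at \<open>x\<close> together with
  \<open>A\<close> cannot exhaust all \<open>t\<close> colors.\<close>

lemma missing_color_ex:
  assumes \<gamma>: "edge_coloring E k \<gamma>" and "finite E" and \<alpha>: "edge_coloring E t \<alpha>"
    and sub: "\<gamma> ` {e \<in> E. x \<in> e} \<subseteq> {1..j}" and "finite A" and card: "j + card A < t"
  shows "\<exists>c\<in>{1..t} - A. \<forall>e\<in>E. x \<in> e \<longrightarrow> \<alpha> e \<noteq> c"
proof -
  let ?I = "{e \<in> E. x \<in> e}"
  have "inj_on \<gamma> ?I"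
  proof (rule inj_onI)
    fix e f assume ef: "e \<in> ?I" "f \<in> ?I" "\<gamma> e = \<gamma> f"
    then have "e \<inter> f \<noteq> {}" by auto
    then show "e = f" using \<gamma> ef unfolding edge_coloring_def by (metis (lifting) mem_Collect_eq)
  qed
  then have "card ?I \<le> j" using card_inj_on_le[of \<gamma> ?I "{1..j}"] sub by simp
  then have "card (\<alpha> ` ?I) \<le> j" using \<open>finite E\<close> card_image_le[of ?I \<alpha>] by simp
  then have "card (\<alpha> ` ?I \<union> A) < card {1..t}" using card_Un_le[of "\<alpha> ` ?I" A] card by simp
  moreover have "finite (\<alpha> ` ?I \<union> A)" using \<open>finite E\<close> \<open>finite A\<close> by simp
  ultimately have "\<not> {1..t} \<subseteq> \<alpha> ` ?I \<union> A"
    using card_mono[of "\<alpha> ` ?I \<union> A" "{1..t}"] by linarith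
  then obtain c where "c \<in> {1..t} - A" "c \<notin> \<alpha> ` ?I" by blast
  then show ?thesis by (intro bexI[of _ c]) auto
qed

text \<open>Formulated with a \<open>k\<close>-coloring in place of the maximum degree: deleting a
  color class of \<open>\<gamma>\<close> leaves a coloring with one color less, so the induction
  needs no bookkeeping of degrees.\<close>

lemma K_equivalent_Suc:
  assumes "finite E" and "\<And>e. e \<in> E \<Longrightarrow> \<exists>x y. x \<noteq> y \<and> e = {x, y}" and "triangles_are_blocks E"
    and "edge_coloring E k \<gamma>" "edge_coloring E (Suc k) \<alpha>" "edge_coloring E (Suc k) \<beta>"
  shows "K_equivalent E (Suc k) \<alpha> \<beta>"
  using assms
proof (induction k arbitrary: E \<gamma> \<alpha> \<beta>)
  case 0
  then have "E = {}" by (auto simp: edge_coloring_def)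
  then have "\<alpha> = \<beta>" using 0 by (auto simp: edge_coloring_def)
  then show ?case by (simp add: K_equivalent_def)
next
  case (Suc k)
  define q where "q = Suc (Suc k)"
  define M where "M = {e \<in> E. \<gamma> e = Suc k}"
  interpret edge_graph E q
    by unfold_locales (use Suc.prems in auto)
  have missing: "\<exists>c. miss \<phi> x c \<and> c \<notin> A"
    if "coloring \<phi>" "\<gamma> ` {e \<in> E. x \<in> e} \<subseteq> {1..j}" "finite A" "j + card A < q" for \<phi> x j A
    using missing_color_ex[OF Suc.prems(4) finite_E that] by (fastforce simp: miss_def)
  interpret block_graph E q
  proof unfold_locales
    show "\<exists>c. miss \<phi> x c" if "coloring \<phi>" for \<phi> x
    proof -
      have "\<gamma> ` {e \<in> E. x \<in> e} \<subseteq> {1..Suc k}" using Suc.prems(4) by (auto simp: edge_coloring_def)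
      then show ?thesis using missing[OF that, of x "Suc k" "{}"] by (auto simp: q_def)
    qed
    show "\<not> (\<lambda>p q. {p, q} \<in> E - {{x, y}, {y, z}, {x, z}})\<^sup>*\<^sup>* x y"
      if "{x, y} \<in> E" "{y, z} \<in> E" "{x, z} \<in> E" for x y z
      using Suc.prems(3) that by (auto simp: triangles_are_blocks_def)
  qed
  have ME: "M \<subseteq> E" by (auto simp: M_def)
  have matching: "e = f" if "e \<in> M" "f \<in> M" "e \<inter> f \<noteq> {}" for e f
  proof -
    have "e \<in> E" "f \<in> E" "\<gamma> e = \<gamma> f" using that by (auto simp: M_def)
    then show ?thesis using Suc.prems(4) that(3) unfolding edge_coloring_def by blast
  qed
  \<comment> \<open>At a vertex off \<open>M\<close> there are at most \<open>k\<close> edges, one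
    for each color of \<open>\<gamma>\<close> other than \<open>Suc k\<close>. A coloring with
    \<open>k + 2\<close> colors therefore misses at least two there, one of them different from
    \<open>q\<close>.\<close>
  have uncovered: "\<exists>c. miss \<phi> x c \<and> c \<noteq> q" if "coloring \<phi>" "x \<notin> \<Union>M" for \<phi> x
  proof -
    have "\<gamma> e \<in> {1..k}" if "e \<in> E" "x \<in> e" for e
    proof -
      have "\<gamma> e \<in> {1..Suc k}" using Suc.prems(4) that by (auto simp: edge_coloring_def)
      moreover have "\<gamma> e \<noteq> Suc k" using \<open>x \<notin> \<Union>M\<close> that by (auto simp: M_def)
      ultimately show ?thesis by auto
    qed
    then have "\<gamma> ` {e \<in> E. x \<in> e} \<subseteq> {1..k}" by blast
    then show ?thesis using missing[OF that(1), of x k "{q}"] by (auto simp: q_def)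
  qed
  have qq: "q \<in> {1..q}" by (simp add: q_def)
  note reach = class_reachable[OF ME matching qq uncovered]
  obtain \<alpha>' where \<alpha>': "kempe_equiv \<alpha> \<alpha>'" "{e \<in> E. \<alpha>' e = q} = M"
    using reach[of \<alpha>] Suc.prems(5) by (auto simp: q_def)
  obtain \<beta>' where \<beta>': "kempe_equiv \<beta> \<beta>'" "{e \<in> E. \<beta>' e = q} = M"
    using reach[of \<beta>] Suc.prems(6) by (auto simp: q_def)
  \<comment> \<open>Colorings must be 0 off the edge set, so the edges of \<open>M\<close> are reset
    to 0 when \<open>M\<close> is deleted.\<close>
  let ?res = "\<lambda>\<phi> e. if e \<in> M then 0 else \<phi> e"
  have "K_equivalent (E - M) (Suc k) (?res \<alpha>') (?res \<beta>')"
  proof (rule Suc.IH)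
    show "finite (E - M)" using finite_E by simp
    show "\<exists>x y. x \<noteq> y \<and> e = {x, y}" if "e \<in> E - M" for e using edgeE that by simp
    show "triangles_are_blocks (E - M)" using triangles_are_blocks_mono[OF Suc.prems(3)] by auto
    show "edge_coloring (E - M) k (?res \<gamma>)"
      by (rule edge_coloring_restrict[OF Suc.prems(4)]) (simp add: M_def)
    show "edge_coloring (E - M) (Suc k) (?res \<alpha>')"
      by (rule edge_coloring_restrict[OF kempe_equiv_coloring[OF \<alpha>'(1), unfolded q_def] \<alpha>'(2)[unfolded q_def]])
    show "edge_coloring (E - M) (Suc k) (?res \<beta>')"
      by (rule edge_coloring_restrict[OF kempe_equiv_coloring[OF \<beta>'(1), unfolded q_def] \<beta>'(2)[unfolded q_def]])
  qed
  from K_equivalent_extend[OF ME this matching]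
  have "K_equivalent E q (\<lambda>e. if e \<in> M then q else ?res \<alpha>' e) (\<lambda>e. if e \<in> M then q else ?res \<beta>' e)"
    unfolding q_def .
  moreover have ext: "(\<lambda>e. if e \<in> M then q else ?res \<phi> e) = \<phi>" if "{e \<in> E. \<phi> e = q} = M" for \<phi>
  proof
    fix e
    have "\<phi> e = q" if "e \<in> M" using \<open>{e \<in> E. \<phi> e = q} = M\<close> that by blast
    then show "(if e \<in> M then q else ?res \<phi> e) = \<phi> e" by simp
  qed
  ultimately have "K_equivalent E q \<alpha>' \<beta>'" unfolding ext[OF \<alpha>'(2)] ext[OF \<beta>'(2)] by blast
  then have "kempe_equiv \<alpha>' \<beta>'"
    using kempe_equiv_coloring[OF \<alpha>'(1)] kempe_equiv_coloring[OF \<beta>'(1)] by (simp add: kempe_equiv_def)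
  then have "kempe_equiv \<alpha> \<beta>" using kempe_equiv_trans[OF \<alpha>'(1)] kempe_equiv_trans[OF _ kempe_equiv_sym[OF \<beta>'(1)]] by blast
  then have "K_equivalent E q \<alpha> \<beta>" by (simp add: kempe_equiv_def)
  then show ?case by (simp add: q_def)
qed

section \<open>Triangles in chordless graphs\<close>

lemma is_cycleI:
  assumes path: "rtrancl_path (\<lambda>p q. {p, q} \<in> E) x xs y" and "distinct (x # xs)" "2 \<le> length xs"
    and "{y, x} \<in> E"
  shows "is_cycle E (x # xs)"
  unfolding is_cycle_def
proof (intro conjI allI impI)
  show "3 \<le> length (x # xs)" "distinct (x # xs)" using assms by auto
  have last: "last xs = y" using rtrancl_path_last[OF path] assms(3) by fastforce
  fix i assume i: "i < length (x # xs)"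
  show "{(x # xs) ! i, (x # xs) ! ((i + 1) mod length (x # xs))} \<in> E"
  proof (cases "i < length xs")
    case True
    then show ?thesis using rtrancl_path_nth[OF path True] by simp
  next
    case False
    then have "i = length xs" using i by simp
    moreover have "(x # xs) ! length xs = y"
      using last assms(3) by (cases xs rule: rev_cases) (auto simp: nth_append)
    ultimately show ?thesis using assms(4) by simp
  qed
qed

text \<open>The path from \<open>x\<close> to \<open>y\<close> closes up through \<open>z\<close> to
  a cycle. Since the path has at least two edges and \<open>z\<close> lies on the other side,
  \<open>x\<close> and \<open>y\<close> are not consecutive on this cycle, and \<open>{x, y}\<close>
  is a chord.\<close>

lemma chordless_no_detour:
  assumes "chordless E" and T: "{x, y} \<in> E" "{y, z} \<in> E" "{x, z} \<in> E"
    and path: "rtrancl_path (\<lambda>p q. {p, q} \<in> E) x xs y" and dist: "distinct (x # xs)" "z \<notin> set (x # xs)"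
    and len: "2 \<le> length xs"
  shows False
proof -
  have "rtrancl_path (\<lambda>p q. {p, q} \<in> E) y [z] z" using T(2) by (auto intro: rtrancl_path.intros)
  then have "rtrancl_path (\<lambda>p q. {p, q} \<in> E) x (xs @ [z]) z" by (rule rtrancl_path_trans[OF path])
  then have cycle: "is_cycle E (x # xs @ [z])"
    by (rule is_cycleI) (use dist len T(3) in \<open>auto simp: insert_commute\<close>)
  have "last xs = y" using rtrancl_path_last[OF path] len by fastforce
  then have "(x # xs @ [z]) ! length xs = y"
    using len by (cases xs rule: rev_cases) (auto simp: nth_append)
  then show False
    using assms(1) cycle T(1) len unfolding chordless_def
    by (elim notE, intro exI[of _ "x # xs @ [z]"] exI[of _ 0] exI[of _ "length xs"]) auto
qed

text \<open>A path that avoids the edges of the triangle has at least two edges between two corners.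
  If it misses \<open>z\<close>, it is a detour for \<open>{x, y}\<close>; if it meets
  \<open>z\<close>, its initial part ends at \<open>z\<close> before reaching \<open>y\<close> and
  is a detour for \<open>{x, z}\<close>, with \<open>y\<close> as the third corner.\<close>

lemma chordless_triangles_are_blocks:
  assumes "chordless E" and loop: "\<And>x. {x} \<notin> E"
  shows "triangles_are_blocks E"
  unfolding triangles_are_blocks_def
proof (intro allI impI notI, elim conjE)
  fix x y z
  assume T: "{x, y} \<in> E" "{y, z} \<in> E" "{x, z} \<in> E"
  let ?r = "\<lambda>p q. {p, q} \<in> E - {{x, y}, {y, z}, {x, z}}"
  assume "?r\<^sup>*\<^sup>* x y"
  then obtain xs where "rtrancl_path ?r x xs y" unfolding rtranclp_eq_rtrancl_path by (rule exE)
  then obtain xs where path: "rtrancl_path ?r x xs y" and dist: "distinct (x # xs)"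
    by (rule rtrancl_path_distinct)
  have neq: "x \<noteq> y" "y \<noteq> z" "x \<noteq> z" using T loop by auto
  have long: "2 \<le> length us" if "rtrancl_path ?r x us w" "w = y \<or> w = z" for us w
  proof (rule ccontr)
    assume "\<not> ?thesis"
    then consider "us = []" | a where "us = [a]" by (cases us; cases "tl us") auto
    then show False
    proof cases
      case 1
      then have "x = w" using that(1) by (auto elim: rtrancl_path.cases)
      then show False using that(2) neq by auto
    next
      case 2
      then have "a = w" "?r x a"
        using rtrancl_path_last[OF that(1)] rtrancl_path_nth[OF that(1), of 0] by auto
      then show False using that(2) by auto
    qed
  qed
  have weaken: "rtrancl_path (\<lambda>p q. {p, q} \<in> E) x us w" if "rtrancl_path ?r x us w" for us w
    using that by (rule rtrancl_path_mono) auto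
  show False
  proof (cases "z \<in> set xs")
    case False
    show False
      by (rule chordless_no_detour[OF assms(1) T weaken[OF path] dist])
        (use False neq long[OF path] in auto)
  next
    case True
    then obtain ps qs where xs: "xs = ps @ z # qs" by (meson split_list)
    then have path': "rtrancl_path ?r x (ps @ [z]) z" using path by (auto elim: rtrancl_path_appendE)
    have "last xs = y" using rtrancl_path_last[OF path] xs by simp
    then have "y \<in> set qs" using xs neq by (auto split: if_splits)
    then have "y \<notin> set (x # ps @ [z])" "distinct (x # ps @ [z])" using dist xs neq by auto
    moreover have "{z, y} \<in> E" using T(2) by (simp add: insert_commute)
    ultimately show False
      using chordless_no_detour[OF assms(1) T(3) _ T(1) weaken[OF path']] long[OF path'] by blast
  qed
qed

theorem theorem1p2:
  fixes V :: "'a set" and E :: "'a set set"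
  assumes "simple_graph V E"
    and "chromatic_index E = max_degree V E"
    and "triangle_free E \<or> chordless E"
    and "edge_coloring E (max_degree V E + 1) \<alpha>"
    and "edge_coloring E (max_degree V E + 1) \<beta>"
  shows "K_equivalent E (max_degree V E + 1) \<alpha> \<beta>"
proof -
  have edge: "\<exists>x y. x \<noteq> y \<and> e = {x, y}" if "e \<in> E" for e
    using assms(1) that unfolding simple_graph_def by metis
  have loop: "{x} \<notin> E" for x
    using edge[of "{x}"] by (auto simp: doubleton_eq_iff)
  have "E \<subseteq> Pow V" using assms(1) by (auto simp: simple_graph_def)
  then have fin: "finite E" using assms(1) by (auto simp: simple_graph_def intro: finite_subset)
  have blocks: "triangles_are_blocks E"
    using assms(3)
  proof
    assume "triangle_free E"
    moreover have "x \<noteq> y" if "{x, y} \<in> E" for x y using that loop by auto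
    ultimately show ?thesis unfolding triangles_are_blocks_def triangle_free_def by metis
  next
    assume "chordless E"
    then show ?thesis using chordless_triangles_are_blocks loop by blast
  qed
  \<comment> \<open>The \<open>LEAST\<close> value is attained because \<open>\<alpha>\<close> shows
    that some number of colors suffices.\<close>
  have "\<exists>\<gamma>. edge_coloring E (chromatic_index E) \<gamma>"
    unfolding chromatic_index_def by (rule LeastI_ex) (use assms(4) in blast)
  then obtain \<gamma> where "edge_coloring E (max_degree V E) \<gamma>" using assms(2) by auto
  then show ?thesis using K_equivalent_Suc[OF fin edge blocks] assms(4,5) by simp
qed

end
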